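(* Let $(M,g)$ be an $n$-dimensional Riemannian manifold and let $F:(M,g)\to\mathbb{R}^{n+k}$ be an isometric immersion. (i) If $Q_F<\beta_F\, g$, then $(M,g)$ has property $(\mathbf N_1)$. (ii) Let $p\ge 2$ be an integer. If $Q_F<-(p-2)\gamma_F\, g$, then $(M,g)$ has property $(\mathbf N_p)$.
   Context: Let $B$ be the second fundamental form of $F$, $H=\operatorname{tr}_g B$ its mean curvature vector, and $\mathrm{Ric}$ the Ricci tensor of $(M,g)$. Define the symmetric tensor $Q_F(Y,Z):=\langle H,B(Y,Z)\rangle-2\,\mathrm{Ric}(Y,Z)$, and $\beta_F:=\inf\mathcal S_F$, $\gamma_F:=\sup\mathcal S_F$, where $\mathcal S_F:=\{\|B(Z,Z)\|_w^2 : w\in M,\ Z\in T_wM,\ \|Z\|=1\}$. (For $p=2$ the hypothesis in (ii) reads $Q_F<0$.) Inequalities between symmetric 2-tensors are in the sense of quadratic forms at each point. $X=(\mathcal V,E)$ denotes a finite connected graph with vertex set $\mathcal V$ and (nonempty) set $E$ of oriented edges (loops and multiple edges are allowed); $\bar e\in E$ is the reverse of $e\in E$. A weight function is a map $m_E:E\to\mathbb{R}_{>0}$ with $m_E(\bar e)=m_E(e)$, and $(X,m_E)$ is a finite weighted graph. $X$ is identified with the corresponding 1-dimensional CW-complex: each $e$ is identified with $[0,1]$ with parameter $t$, and $\bar e$ is parametrized by $1-t$. A discrete map $f:X\to M$ is a map such that $f_e:=f|_e:[0,1]\to M$ is $C^k$ ($k\ge2$) for every $e\in E$. It is an immersion if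 $\dot f_e\neq0$ everywhere along every edge. For an integer $p\ge1$, $\mathbf E^p(f):=\frac1p\sum_{e\in E}m_E(e)\int_0^1\|\dot f_e\|_g^p\,dt$. A deformation of $f$ is a piecewise smooth family $\{f_s\}_{s\in(-\epsilon,\epsilon)}$ of discrete maps with $f_0=f$ (for each $e$, $(s,t)\mapsto(f_s)_e(t)$ is smooth in $s$ and as regular in $t$ as $f_e$); $f$ is critical for $\mathbf E^p$ if $\frac{d}{ds}\mathbf E^p(f_s)|_{s=0}=0$ for all deformations, and a critical $f$ is stable if $\frac{d^2}{ds^2}\mathbf E^p(f_s)|_{s=0}\ge0$ for all deformations. A discrete minimal immersion is an immersion critical for $\mathbf E^1$; for $p\ge2$, a discrete $p$-harmonic map is a discrete map critical for $\mathbf E^p$. Property $(\mathbf N_1)$: there is no stable discrete minimal immersion from a finite weighted graph into $(M,g)$. Property $(\mathbf N_p)$, $p\ge2$: there is no non-constant stable discrete $p$-harmonic map from a finite weighted graph into $(M,g)$. *)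

theory Defs
  imports "HOL-Analysis.Analysis" "Graph_Theory.Digraph_Component" "Graph_Theory.Bidirected_Digraph"
begin

section \<open>Smooth manifolds and Riemannian metrics\<close>

text \<open>Meaningful for open \<open>S\<close>: continuous partial derivatives up to order \<open>k\<close> on \<open>S\<close>.\<close>

fun Ck_on :: "nat \<Rightarrow> ('a::euclidean_space \<Rightarrow> 'b::real_normed_vector) \<Rightarrow> 'a set \<Rightarrow> bool" where
  "Ck_on 0 h S \<longleftrightarrow> continuous_on S h"
| "Ck_on (Suc k) h S \<longleftrightarrow>
     (\<forall>x\<in>S. h differentiable (at x)) \<and> (\<forall>v. Ck_on k (\<lambda>x. frechet_derivative h (at x) v) S)"

definition smooth_on :: "'a::euclidean_space set \<Rightarrow> ('a \<Rightarrow> 'b::real_normed_vector) \<Rightarrow> bool" where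
  "smooth_on S h \<longleftrightarrow> (\<forall>k. Ck_on k h S)"

text \<open>The manifold \<open>M\<close> is the whole type \<open>'m\<close>, and its smooth structure is given by an atlas
  that need not be maximal. A chart is a domain together with a coordinate map.\<close>

type_synonym ('m, 'n) chart = "'m set \<times> ('m \<Rightarrow> real ^ 'n)"

abbreviation dom_c :: "('m, 'n) chart \<Rightarrow> 'm set" where "dom_c \<equiv> fst"

abbreviation coord :: "('m, 'n) chart \<Rightarrow> 'm \<Rightarrow> real ^ 'n" where "coord \<equiv> snd"

definition img_c :: "('m, 'n) chart \<Rightarrow> (real ^ 'n) set" where
  "img_c c = coord c ` dom_c c"

definition param :: "('m, 'n) chart \<Rightarrow> real ^ 'n \<Rightarrow> 'm" where
  "param c = inv_into (dom_c c) (coord c)"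

definition transition :: "('m, 'n) chart \<Rightarrow> ('m, 'n) chart \<Rightarrow> real ^ 'n \<Rightarrow> real ^ 'n" where
  "transition c d = coord d \<circ> param c"

definition smooth_atlas ::
    "('m::{second_countable_topology, t2_space}, 'n::finite) chart set \<Rightarrow> bool" where
  "smooth_atlas A \<longleftrightarrow>
     (\<Union>c\<in>A. dom_c c) = UNIV \<and>
     (\<forall>c\<in>A. open (dom_c c) \<and> open (img_c c) \<and>
        homeomorphism (dom_c c) (img_c c) (coord c) (param c)) \<and>
     (\<forall>c\<in>A. \<forall>d\<in>A. smooth_on (coord c ` (dom_c c \<inter> dom_c d)) (transition c d))"

text \<open>A tensor is represented by its coordinate expressions: its value at the point with
  coordinates \<open>x\<close> in the chart \<open>c\<close>, on tangent vectors given by their components in \<open>c\<close>.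
  For the metric, \<open>g c x\<close> is the Gram matrix of the coordinate frame.\<close>

type_synonym ('m, 'n) metric = "('m, 'n) chart \<Rightarrow> real ^ 'n \<Rightarrow> real ^ 'n ^ 'n"

definition metric_form ::
    "('m, 'n::finite) metric \<Rightarrow> ('m, 'n) chart \<Rightarrow> real ^ 'n \<Rightarrow> real ^ 'n \<Rightarrow> real ^ 'n \<Rightarrow> real" where
  "metric_form g c x Y Z = Y \<bullet> (g c x *v Z)"

definition riemannian_metric ::
    "('m::{second_countable_topology, t2_space}, 'n::finite) chart set \<Rightarrow> ('m, 'n) metric \<Rightarrow> bool" where
  "riemannian_metric A g \<longleftrightarrow>
     (\<forall>c\<in>A. smooth_on (img_c c) (g c)) \<and>
     (\<forall>c\<in>A. \<forall>x\<in>img_c c. transpose (g c x) = g c x \<and> (\<forall>Z. Z \<noteq> 0 \<longrightarrow> 0 < metric_form g c x Z Z)) \<and>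
     (\<forall>c\<in>A. \<forall>d\<in>A. \<forall>x\<in>coord c ` (dom_c c \<inter> dom_c d). \<forall>Y Z.
        metric_form g c x Y Z =
        metric_form g d (transition c d x)
          (frechet_derivative (transition c d) (at x) Y)
          (frechet_derivative (transition c d) (at x) Z))"

section \<open>Ricci tensor\<close>

definition pderivative :: "'n::finite \<Rightarrow> (real ^ 'n \<Rightarrow> real) \<Rightarrow> real ^ 'n \<Rightarrow> real" where
  "pderivative i h x = frechet_derivative h (at x) (axis i 1)"

text \<open>\<open>christoffel g c l i j\<close> is the upper-\<open>l\<close> component: \<open>\<nabla>\<close> of the \<open>j\<close>-th coordinate field along
  the \<open>i\<close>-th one, for the Levi-Civita connection.\<close>

definition christoffel ::
    "('m, 'n::finite) metric \<Rightarrow> ('m, 'n) chart \<Rightarrow> 'n \<Rightarrow> 'n \<Rightarrow> 'n \<Rightarrow> real ^ 'n \<Rightarrow> real" where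
  "christoffel g c l i j x =
     (1 / 2) * (\<Sum>q\<in>UNIV. matrix_inv (g c x) $ l $ q *
        (pderivative i (\<lambda>y. g c y $ j $ q) x + pderivative j (\<lambda>y. g c y $ i $ q) x
          - pderivative q (\<lambda>y. g c y $ i $ j) x))"

text \<open>\<open>riemann g c l i j k\<close> is the \<open>l\<close>-component of \<open>R(\<partial>\<^sub>i, \<partial>\<^sub>j)\<partial>\<^sub>k\<close>, where
  \<open>R(X, Y)Z = \<nabla>\<^sub>X\<nabla>\<^sub>Y Z - \<nabla>\<^sub>Y\<nabla>\<^sub>X Z - \<nabla>\<^bsub>[X,Y]\<^esub> Z\<close>.\<close>

definition riemann ::
    "('m, 'n::finite) metric \<Rightarrow> ('m, 'n) chart \<Rightarrow> 'n \<Rightarrow> 'n \<Rightarrow> 'n \<Rightarrow> 'n \<Rightarrow> real ^ 'n \<Rightarrow> real" where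
  "riemann g c l i j k x =
     pderivative i (christoffel g c l j k) x - pderivative j (christoffel g c l i k) x
     + (\<Sum>q\<in>UNIV. christoffel g c l i q x * christoffel g c q j k x
                  - christoffel g c l j q x * christoffel g c q i k x)"

text \<open>\<open>Ric(Y, Z)\<close> is the trace of \<open>X \<mapsto> R(X, Y)Z\<close>; it is positive on round spheres.\<close>

definition ricci ::
    "('m, 'n::finite) metric \<Rightarrow> ('m, 'n) chart \<Rightarrow> real ^ 'n \<Rightarrow> real ^ 'n \<Rightarrow> real ^ 'n \<Rightarrow> real" where
  "ricci g c x Y Z =
     (\<Sum>j\<in>UNIV. \<Sum>k\<in>UNIV. Y $ j * Z $ k * (\<Sum>i\<in>UNIV. riemann g c i i j k x))"

section \<open>Isometric immersions and their second fundamental form\<close>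

definition local_rep ::
    "('m \<Rightarrow> real ^ 'd) \<Rightarrow> ('m, 'n) chart \<Rightarrow> real ^ 'n \<Rightarrow> real ^ 'd" where
  "local_rep F c = F \<circ> param c"

definition differential ::
    "('m \<Rightarrow> real ^ 'd::finite) \<Rightarrow> ('m, 'n::finite) chart \<Rightarrow> real ^ 'n \<Rightarrow> real ^ 'n \<Rightarrow> real ^ 'd" where
  "differential F c x = frechet_derivative (local_rep F c) (at x)"

definition isometric_immersion ::
    "('m::{second_countable_topology, t2_space}, 'n::finite) chart set \<Rightarrow> ('m, 'n) metric \<Rightarrow>
     ('m \<Rightarrow> real ^ 'd::finite) \<Rightarrow> bool" where
  "isometric_immersion A g F \<longleftrightarrow>
     (\<forall>c\<in>A. smooth_on (img_c c) (local_rep F c)) \<and>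
     (\<forall>c\<in>A. \<forall>x\<in>img_c c. inj (differential F c x) \<and>
        (\<forall>Y Z. differential F c x Y \<bullet> differential F c x Z = metric_form g c x Y Z))"

definition normal_part :: "'a::euclidean_space set \<Rightarrow> 'a \<Rightarrow> 'a" where
  "normal_part T v = (THE w. w \<in> orthogonal_comp T \<and> v - w \<in> T)"

text \<open>\<open>B(Y, Z)\<close> is the normal part of the derivative in direction \<open>Y\<close> of \<open>dF(Z)\<close>, with \<open>Z\<close> extended
  by constant components in the chart.\<close>

definition second_ff ::
    "('m \<Rightarrow> real ^ 'd::finite) \<Rightarrow> ('m, 'n::finite) chart \<Rightarrow> real ^ 'n \<Rightarrow> real ^ 'n \<Rightarrow> real ^ 'n \<Rightarrow> real ^ 'd" where
  "second_ff F c x Y Z =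
     normal_part (range (differential F c x))
       (frechet_derivative (\<lambda>y. differential F c y Z) (at x) Y)"

definition mean_curvature ::
    "('m, 'n::finite) metric \<Rightarrow> ('m \<Rightarrow> real ^ 'd::finite) \<Rightarrow> ('m, 'n) chart \<Rightarrow> real ^ 'n \<Rightarrow> real ^ 'd" where
  "mean_curvature g F c x =
     (\<Sum>i\<in>UNIV. \<Sum>j\<in>UNIV. (matrix_inv (g c x) $ i $ j) *\<^sub>R second_ff F c x (axis i 1) (axis j 1))"

definition Q_tensor ::
    "('m, 'n::finite) metric \<Rightarrow> ('m \<Rightarrow> real ^ 'd::finite) \<Rightarrow> ('m, 'n) chart \<Rightarrow>
     real ^ 'n \<Rightarrow> real ^ 'n \<Rightarrow> real ^ 'n \<Rightarrow> real" where
  "Q_tensor g F c x Y Z = mean_curvature g F c x \<bullet> second_ff F c x Y Z - 2 * ricci g c x Y Z"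

definition S_set ::
    "('m, 'n::finite) chart set \<Rightarrow> ('m, 'n) metric \<Rightarrow> ('m \<Rightarrow> real ^ 'd::finite) \<Rightarrow> real set" where
  "S_set A g F =
     {(norm (second_ff F c x Z Z))\<^sup>2 | c x Z. c \<in> A \<and> x \<in> img_c c \<and> sqrt (metric_form g c x Z Z) = 1}"

text \<open>Extended reals, because the supremum may be infinite.\<close>

definition beta ::
    "('m, 'n::finite) chart set \<Rightarrow> ('m, 'n) metric \<Rightarrow> ('m \<Rightarrow> real ^ 'd::finite) \<Rightarrow> ereal" where
  "beta A g F = (INF b\<in>S_set A g F. ereal b)"

definition gamma ::
    "('m, 'n::finite) chart set \<Rightarrow> ('m, 'n) metric \<Rightarrow> ('m \<Rightarrow> real ^ 'd::finite) \<Rightarrow> ereal" where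
  "gamma A g F = (SUP b\<in>S_set A g F. ereal b)"

text \<open>\<open>Q < a g\<close> as quadratic forms at every point. Since \<open>0 * \<infinity> = 0\<close> for extended reals,
  \<open>a = - ((p - 2) * \<gamma>)\<close> gives \<open>Q < 0\<close> when \<open>p = 2\<close>, even if \<open>\<gamma> = \<infinity>\<close>; when \<open>p > 2\<close> and
  \<open>\<gamma> = \<infinity>\<close> the inequality is unsatisfiable.\<close>

definition Q_less ::
    "('m, 'n::finite) chart set \<Rightarrow> ('m, 'n) metric \<Rightarrow> ('m \<Rightarrow> real ^ 'd::finite) \<Rightarrow> ereal \<Rightarrow> bool" where
  "Q_less A g F a \<longleftrightarrow>
     (\<forall>c\<in>A. \<forall>x\<in>img_c c. \<forall>Z. Z \<noteq> 0 \<longrightarrow>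
        ereal (Q_tensor g F c x Z Z) < a * ereal (metric_form g c x Z Z))"

section \<open>Weighted graphs and discrete maps\<close>

text \<open>Arcs are the oriented edges and \<open>arev\<close> is the fixed-point free reversal; loops and multiple
  arcs are allowed. (The locale \<^locale>\<open>bidirected_digraph\<close> also normalises \<open>arev\<close> to be the identity
  off the arcs.)\<close>

definition finite_weighted_graph ::
    "('v, 'e) pre_digraph \<Rightarrow> ('e \<Rightarrow> 'e) \<Rightarrow> ('e \<Rightarrow> real) \<Rightarrow> bool" where
  "finite_weighted_graph X arev w \<longleftrightarrow>
     fin_digraph X \<and> bidirected_digraph X arev \<and> Digraph_Component.connected X \<and> arcs X \<noteq> {} \<and>
     (\<forall>e\<in>arcs X. 0 < w e \<and> w (arev e) = w e)"

text \<open>In each chart, \<open>D i\<close> is the \<open>i\<close>-th derivative of the coordinate expression of the curve on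
  the (relatively open) part of \<open>[0,1]\<close> mapped into the chart; derivatives are one-sided at \<open>0\<close> and
  \<open>1\<close>.\<close>

definition curve_Ck ::
    "('m::{second_countable_topology, t2_space}, 'n::finite) chart set \<Rightarrow> nat \<Rightarrow> (real \<Rightarrow> 'm) \<Rightarrow> bool" where
  "curve_Ck A k \<gamma> \<longleftrightarrow>
     continuous_on {0..1} \<gamma> \<and>
     (\<forall>c\<in>A. let T = {t \<in> {0..1}. \<gamma> t \<in> dom_c c} in
        \<exists>D :: nat \<Rightarrow> real \<Rightarrow> real ^ 'n.
          (\<forall>t\<in>T. D 0 t = coord c (\<gamma> t)) \<and>
          (\<forall>i\<le>k. continuous_on T (D i)) \<and>
          (\<forall>i<k. \<forall>t\<in>T. (D i has_vector_derivative D (Suc i) t) (at t within {0..1})))"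

text \<open>\<open>f e t\<close> is the value at parameter \<open>t\<close> on the edge \<open>e\<close>; it matters only for arcs \<open>e\<close> and
  \<open>t \<in> [0,1]\<close>. The first two conjuncts say that \<open>f\<close> is a map on the one-dimensional complex.\<close>

definition discrete_map ::
    "('m::{second_countable_topology, t2_space}, 'n::finite) chart set \<Rightarrow> nat \<Rightarrow>
     ('v, 'e) pre_digraph \<Rightarrow> ('e \<Rightarrow> 'e) \<Rightarrow> ('e \<Rightarrow> real \<Rightarrow> 'm) \<Rightarrow> bool" where
  "discrete_map A k X arev f \<longleftrightarrow>
     (\<exists>fv :: 'v \<Rightarrow> 'm. \<forall>e\<in>arcs X. f e 0 = fv (tail X e) \<and> f e 1 = fv (head X e)) \<and>
     (\<forall>e\<in>arcs X. \<forall>t\<in>{0..1}. f (arev e) t = f e (1 - t)) \<and>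
     (\<forall>e\<in>arcs X. curve_Ck A k (f e))"

definition non_constant :: "('v, 'e) pre_digraph \<Rightarrow> ('e \<Rightarrow> real \<Rightarrow> 'm) \<Rightarrow> bool" where
  "non_constant X f \<longleftrightarrow> (\<exists>e\<in>arcs X. \<exists>e'\<in>arcs X. \<exists>t\<in>{0..1}. \<exists>t'\<in>{0..1}. f e t \<noteq> f e' t')"

definition velocity :: "('m, 'n::finite) chart \<Rightarrow> (real \<Rightarrow> 'm) \<Rightarrow> real \<Rightarrow> real ^ 'n" where
  "velocity c \<gamma> t = vector_derivative (coord c \<circ> \<gamma>) (at t within {0..1})"

definition chart_at :: "('m, 'n) chart set \<Rightarrow> 'm \<Rightarrow> ('m, 'n) chart" where
  "chart_at A w = (SOME c. c \<in> A \<and> w \<in> dom_c c)"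

text \<open>The norm of the velocity; it does not depend on the chosen chart.\<close>

definition speed ::
    "('m, 'n::finite) chart set \<Rightarrow> ('m, 'n) metric \<Rightarrow> (real \<Rightarrow> 'm) \<Rightarrow> real \<Rightarrow> real" where
  "speed A g \<gamma> t =
     (let c = chart_at A (\<gamma> t) in
      sqrt (metric_form g c (coord c (\<gamma> t)) (velocity c \<gamma> t) (velocity c \<gamma> t)))"

definition immersion ::
    "('m, 'n::finite) chart set \<Rightarrow> ('v, 'e) pre_digraph \<Rightarrow> ('e \<Rightarrow> real \<Rightarrow> 'm) \<Rightarrow> bool" where
  "immersion A X f \<longleftrightarrow>
     (\<forall>e\<in>arcs X. \<forall>t\<in>{0..1}. \<forall>c\<in>A. f e t \<in> dom_c c \<longrightarrow> velocity c (f e) t \<noteq> 0)"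

definition energy ::
    "('m, 'n::finite) chart set \<Rightarrow> ('m, 'n) metric \<Rightarrow> ('v, 'e) pre_digraph \<Rightarrow> ('e \<Rightarrow> real) \<Rightarrow>
     nat \<Rightarrow> ('e \<Rightarrow> real \<Rightarrow> 'm) \<Rightarrow> real" where
  "energy A g X w p f =
     (1 / real p) * (\<Sum>e\<in>arcs X. w e * integral {0..1} (\<lambda>t. speed A g (f e) t ^ p))"

section \<open>Deformations, criticality and stability\<close>

text \<open>\<open>(s, t) \<mapsto> \<phi> s t\<close> is smooth in \<open>s\<close> and of class \<open>C\<^sup>k\<close> in \<open>t\<close>: all mixed partial derivatives
  \<open>D i l\<close>, of order \<open>i\<close> in \<open>s\<close> and order \<open>l \<le> k\<close> in \<open>t\<close>, of its coordinate expressions exist and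
  are jointly continuous.\<close>

definition family_regular ::
    "('m::{second_countable_topology, t2_space}, 'n::finite) chart set \<Rightarrow> nat \<Rightarrow> real \<Rightarrow>
     (real \<Rightarrow> real \<Rightarrow> 'm) \<Rightarrow> bool" where
  "family_regular A k \<epsilon> \<phi> \<longleftrightarrow>
     continuous_on ({-\<epsilon><..<\<epsilon>} \<times> {0..1}) (\<lambda>(s, t). \<phi> s t) \<and>
     (\<forall>c\<in>A. let W = {(s, t). s \<in> {-\<epsilon><..<\<epsilon>} \<and> t \<in> {0..1} \<and> \<phi> s t \<in> dom_c c} in
        \<exists>D :: nat \<Rightarrow> nat \<Rightarrow> real \<Rightarrow> real \<Rightarrow> real ^ 'n.
          (\<forall>(s, t)\<in>W. D 0 0 s t = coord c (\<phi> s t)) \<and>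
          (\<forall>i. \<forall>l\<le>k. continuous_on W (\<lambda>(s, t). D i l s t)) \<and>
          (\<forall>i. \<forall>l\<le>k. \<forall>(s, t)\<in>W.
             ((\<lambda>\<sigma>. D i l \<sigma> t) has_vector_derivative D (Suc i) l s t) (at s)) \<and>
          (\<forall>i. \<forall>l<k. \<forall>(s, t)\<in>W.
             ((\<lambda>\<tau>. D i l s \<tau>) has_vector_derivative D i (Suc l) s t) (at t within {0..1})))"

text \<open>The last conjunct makes the family as regular in \<open>t\<close> on each edge as \<open>f\<close> is there, also
  where \<open>f\<close> is more regular than the prescribed class \<open>C\<^sup>k\<close>.\<close>

definition deformation ::
    "('m::{second_countable_topology, t2_space}, 'n::finite) chart set \<Rightarrow> nat \<Rightarrow>
     ('v, 'e) pre_digraph \<Rightarrow> ('e \<Rightarrow> 'e) \<Rightarrow> ('e \<Rightarrow> real \<Rightarrow> 'm) \<Rightarrow> real \<Rightarrow>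
     (real \<Rightarrow> 'e \<Rightarrow> real \<Rightarrow> 'm) \<Rightarrow> bool" where
  "deformation A k X arev f \<epsilon> \<Phi> \<longleftrightarrow>
     0 < \<epsilon> \<and>
     (\<forall>e\<in>arcs X. \<forall>t\<in>{0..1}. \<Phi> 0 e t = f e t) \<and>
     (\<forall>s\<in>{-\<epsilon><..<\<epsilon>}. discrete_map A k X arev (\<Phi> s)) \<and>
     (\<forall>e\<in>arcs X. \<forall>j. curve_Ck A j (f e) \<longrightarrow> family_regular A j \<epsilon> (\<lambda>s. \<Phi> s e))"

definition critical ::
    "('m::{second_countable_topology, t2_space}, 'n::finite) chart set \<Rightarrow> ('m, 'n) metric \<Rightarrow> nat \<Rightarrow>
     ('v, 'e) pre_digraph \<Rightarrow> ('e \<Rightarrow> 'e) \<Rightarrow> ('e \<Rightarrow> real) \<Rightarrow> nat \<Rightarrow> ('e \<Rightarrow> real \<Rightarrow> 'm) \<Rightarrow> bool" where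
  "critical A g k X arev w p f \<longleftrightarrow>
     (\<forall>\<epsilon> \<Phi>. deformation A k X arev f \<epsilon> \<Phi> \<longrightarrow>
        ((\<lambda>s. energy A g X w p (\<Phi> s)) has_real_derivative 0) (at 0))"

text \<open>The second derivative exists whenever \<open>p \<ge> 2\<close>, or \<open>p = 1\<close> and \<open>f\<close> is an immersion.\<close>

definition stable ::
    "('m::{second_countable_topology, t2_space}, 'n::finite) chart set \<Rightarrow> ('m, 'n) metric \<Rightarrow> nat \<Rightarrow>
     ('v, 'e) pre_digraph \<Rightarrow> ('e \<Rightarrow> 'e) \<Rightarrow> ('e \<Rightarrow> real) \<Rightarrow> nat \<Rightarrow> ('e \<Rightarrow> real \<Rightarrow> 'm) \<Rightarrow> bool" where
  "stable A g k X arev w p f \<longleftrightarrow>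
     critical A g k X arev w p f \<and>
     (\<forall>\<epsilon> \<Phi>. deformation A k X arev f \<epsilon> \<Phi> \<longrightarrow>
        0 \<le> (deriv ^^ 2) (\<lambda>s. energy A g X w p (\<Phi> s)) 0)"

definition discrete_minimal_immersion ::
    "('m::{second_countable_topology, t2_space}, 'n::finite) chart set \<Rightarrow> ('m, 'n) metric \<Rightarrow> nat \<Rightarrow>
     ('v, 'e) pre_digraph \<Rightarrow> ('e \<Rightarrow> 'e) \<Rightarrow> ('e \<Rightarrow> real) \<Rightarrow> ('e \<Rightarrow> real \<Rightarrow> 'm) \<Rightarrow> bool" where
  "discrete_minimal_immersion A g k X arev w f \<longleftrightarrow>
     discrete_map A k X arev f \<and> immersion A X f \<and> critical A g k X arev w 1 f"

definition discrete_p_harmonic ::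
    "('m::{second_countable_topology, t2_space}, 'n::finite) chart set \<Rightarrow> ('m, 'n) metric \<Rightarrow> nat \<Rightarrow>
     ('v, 'e) pre_digraph \<Rightarrow> ('e \<Rightarrow> 'e) \<Rightarrow> ('e \<Rightarrow> real) \<Rightarrow> nat \<Rightarrow> ('e \<Rightarrow> real \<Rightarrow> 'm) \<Rightarrow> bool" where
  "discrete_p_harmonic A g k X arev w p f \<longleftrightarrow>
     discrete_map A k X arev f \<and> critical A g k X arev w p f"

text \<open>The type argument fixes the types of vertices and edges of the graphs quantified over; a
  theorem leaving them as type variables covers all finite weighted graphs.\<close>

definition property_N1 ::
    "('v \<times> 'e) itself \<Rightarrow> ('m::{second_countable_topology, t2_space}, 'n::finite) chart set \<Rightarrow>
     ('m, 'n) metric \<Rightarrow> nat \<Rightarrow> bool" where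
  "property_N1 (_ :: ('v \<times> 'e) itself) A g k \<longleftrightarrow>
     \<not> (\<exists>(X :: ('v, 'e) pre_digraph) arev w f. finite_weighted_graph X arev w \<and>
          discrete_minimal_immersion A g k X arev w f \<and> stable A g k X arev w 1 f)"

definition property_N ::
    "('v \<times> 'e) itself \<Rightarrow> nat \<Rightarrow> ('m::{second_countable_topology, t2_space}, 'n::finite) chart set \<Rightarrow>
     ('m, 'n) metric \<Rightarrow> nat \<Rightarrow> bool" where
  "property_N (_ :: ('v \<times> 'e) itself) p A g k \<longleftrightarrow>
     \<not> (\<exists>(X :: ('v, 'e) pre_digraph) arev w f. finite_weighted_graph X arev w \<and>
          discrete_p_harmonic A g k X arev w p f \<and> non_constant X f \<and> stable A g k X arev w p f)"

end

theory Submission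
  imports Defs
begin

text \<open>Let \<open>B\<close> be the second fundamental form and \<open>H\<close> the mean curvature vector of the immersion \<open>F\<close>. The proof averages
  the second variation over parallel fields of the ambient space. Given a critical map \<open>f\<close> and a vector \<open>v\<close> of the
  ambient space, deform \<open>f\<close> by moving every point in the direction of the tangential part \<open>V\<close> of \<open>v\<close>. If \<open>f\<close> is stable,
  the second variation of the energy is nonnegative for each \<open>v\<close>, and so is its sum over an orthonormal basis. But
  this sum is an integral over the edges which can be computed pointwise. Let \<open>\<xi>\<close> be the velocity of an edge, let
  \<open>w = dF \<xi>\<close>, and let \<open>V'\<close> be the derivative of \<open>V\<close> along the edge. The tangential part of \<open>V'\<close> is given by
  \<open>V' \<bullet> dF Z = v \<bullet> B (\<xi>, Z)\<close> and the normal part by \<open>B (\<xi>, V)\<close>; the acceleration of the deformation has normal part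
  \<open>B (V, V)\<close>, which enters through \<open>- B (V, V) \<bullet> B (\<xi>, \<xi>)\<close>. Summation over \<open>v\<close> and the Gauss equation turn the integrand
  into

  \<open>norm w powi (p - 2) * Q (\<xi>, \<xi>) + (p - 2) * norm w powi (p - 4) * (norm (B (\<xi>, \<xi>)))\<^sup>2\<close>

  (\<open>variation_trace\<close>), and the hypothesis on \<open>Q\<close> makes this negative wherever \<open>w \<noteq> 0\<close>. An immersion moves everywhere,
  and a non-constant map moves somewhere (\<open>moving_point\<close>), so \<open>f\<close> cannot be stable (\<open>not_stable\<close>).

  The deformation comes from a family of smooth maps \<open>\<psi> s\<close> of \<open>M\<close> to itself with \<open>\<psi> 0\<close> the identity and with initial
  velocity \<open>V\<close> on the compact image of \<open>f\<close>. It is a composition of maps that are supported in single charts and have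
  the form \<open>x + s X x\<close> there (\<open>realisable_on_compact\<close>). The acceleration of such a family has a tangential part of no
  particular shape, but this part is again the projection of a smooth function on \<open>M\<close>. Hence it is the initial velocity
  of another family, and because \<open>f\<close> is critical its contribution vanishes (\<open>stability_inequality\<close>).

  Three analytic facts support this. The maps \<open>\<psi> s \<circ> f\<close> have all the mixed partial derivatives that a deformation
  must have, although \<open>f\<close> is only of class \<open>C\<^sup>k\<close> along the edges (\<open>mixed_regular_along_curve\<close>). The function \<open>norm w ^ p\<close> is
  twice continuously differentiable also at \<open>0\<close> when \<open>p \<ge> 2\<close>, so the energy can be differentiated twice under the
  integral sign (\<open>energy_variation\<close>). And the Ricci tensor, defined by Christoffel symbols in a chart, satisfies the traced
  Gauss equation (\<open>ricci_eq\<close>).\<close>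

section \<open>Calculus of smooth maps\<close>

lemma Ck_on_differentiable: "Ck_on (Suc k) h S \<Longrightarrow> x \<in> S \<Longrightarrow> h differentiable (at x)"
  by simp

lemma has_frechet_derivative:
  "h differentiable (at x) \<Longrightarrow> (h has_derivative frechet_derivative h (at x)) (at x)"
  by (rule iffD1[OF frechet_derivative_works])

lemma frechet_derivative_eqI: "(h has_derivative D) (at x) \<Longrightarrow> frechet_derivative h (at x) = D"
  by (rule frechet_derivative_at[symmetric])

lemma Ck_on_subset: "Ck_on k h S \<Longrightarrow> T \<subseteq> S \<Longrightarrow> Ck_on k h T"
  by (induction k arbitrary: h) (auto intro: continuous_on_subset)

lemma Ck_on_cong:
  assumes "open S" "\<And>x. x \<in> S \<Longrightarrow> h x = h' x" "Ck_on k h S"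
  shows "Ck_on k h' S"
  using assms(2,3)
proof (induction k arbitrary: h h')
  case 0
  then show ?case by (auto cong: continuous_on_cong)
next
  case (Suc k)
  have d: "h' differentiable (at x)" "frechet_derivative h' (at x) = frechet_derivative h (at x)"
    if "x \<in> S" for x
  proof -
    have "(h has_derivative frechet_derivative h (at x)) (at x)"
      using Suc.prems that by (auto intro: has_frechet_derivative)
    then have "(h' has_derivative frechet_derivative h (at x)) (at x)"
      by (rule has_derivative_transform_within_open[OF _ assms(1) that Suc.prems(1)])
    then show "h' differentiable (at x)" "frechet_derivative h' (at x) = frechet_derivative h (at x)"
      by (auto simp: differentiable_def intro: frechet_derivative_eqI)
  qed
  have "Ck_on k (\<lambda>x. frechet_derivative h' (at x) v) S" for v
    using Suc.IH[of "\<lambda>x. frechet_derivative h (at x) v" "\<lambda>x. frechet_derivative h' (at x) v"] d Suc.prems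
    by auto
  then show ?case using d by auto
qed

lemma Ck_on_imp_continuous_on: "Ck_on k h S \<Longrightarrow> continuous_on S h"
  by (cases k) (auto intro!: continuous_at_imp_continuous_on differentiable_imp_continuous_within)

lemma Ck_on_Suc_imp: "Ck_on (Suc k) h S \<Longrightarrow> Ck_on k h S"
proof (induction k arbitrary: h)
  case 0
  then show ?case using Ck_on_imp_continuous_on by fastforce
next
  case (Suc k)
  then show ?case by (metis Ck_on.simps(2))
qed

lemma Ck_on_local:
  assumes "\<And>x. x \<in> S \<Longrightarrow> \<exists>N. open N \<and> x \<in> N \<and> Ck_on k h N"
  shows "Ck_on k h S"
  using assms
proof (induction k arbitrary: h)
  case 0
  then show ?case
    by (auto intro!: continuous_at_imp_continuous_on) (meson continuous_on_eq_continuous_at)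
next
  case (Suc k)
  have "h differentiable (at x)" if "x \<in> S" for x
    using Suc.prems[OF that] by auto
  moreover have "Ck_on k (\<lambda>x. frechet_derivative h (at x) v) S" for v
    using Suc.prems by (intro Suc.IH) (metis Ck_on.simps(2))
  ultimately show ?case by simp
qed

lemma Ck_on_SucI:
  assumes "open S" "\<And>x. x \<in> S \<Longrightarrow> (h has_derivative h' x) (at x)"
    and "\<And>v. Ck_on k (\<lambda>x. h' x v) S"
  shows "Ck_on (Suc k) h S"
proof -
  have "frechet_derivative h (at x) = h' x" if "x \<in> S" for x
    using assms that by (auto intro: frechet_derivative_eqI)
  then have "Ck_on k (\<lambda>x. frechet_derivative h (at x) v) S" for v
    using assms by (auto intro: Ck_on_cong[OF assms(1), of "\<lambda>x. h' x v"])
  then show ?thesis using assms by (auto simp: differentiable_def)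
qed

lemma Ck_on_const: "Ck_on k (\<lambda>x. c) S"
  by (induction k arbitrary: c) auto

lemma Ck_on_bounded_linear:
  assumes "bounded_linear f" "open S" shows "Ck_on k f S"
proof (cases k)
  case 0
  then show ?thesis using assms by (auto intro: linear_continuous_on)
next
  case (Suc j)
  then show ?thesis
    using Ck_on_SucI[OF assms(2) bounded_linear_imp_has_derivative[OF assms(1)] Ck_on_const] by simp
qed

lemma Ck_on_add:
  assumes "open S" "Ck_on k f S" "Ck_on k h S" shows "Ck_on k (\<lambda>x. f x + h x) S"
  using assms(2,3)
proof (induction k arbitrary: f h)
  case 0 then show ?case by (auto intro: continuous_intros)
next
  case (Suc k)
  show ?case
    by (rule Ck_on_SucI[OF assms(1) has_derivative_add[OF has_frechet_derivative has_frechet_derivative]])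
      (use Suc in auto)
qed

lemma Ck_on_sum:
  assumes "open S" "\<And>i. i \<in> I \<Longrightarrow> Ck_on k (f i) S" shows "Ck_on k (\<lambda>x. \<Sum>i\<in>I. f i x) S"
  using assms(2) by (induction I rule: infinite_finite_induct) (auto intro!: Ck_on_const Ck_on_add assms(1))

lemma Ck_on_bilinear:
  assumes "bounded_bilinear B" "open S" "Ck_on k f S" "Ck_on k h S"
  shows "Ck_on k (\<lambda>x. B (f x) (h x)) S"
  using assms(3,4)
proof (induction k arbitrary: f h)
  case 0 then show ?case by (auto intro: bounded_bilinear.continuous_on[OF assms(1)])
next
  case (Suc k)
  show ?case
  proof (rule Ck_on_SucI[OF assms(2) bounded_bilinear.FDERIV[OF assms(1) has_frechet_derivative has_frechet_derivative]])
    fix v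
    show "Ck_on k (\<lambda>x. B (f x) (frechet_derivative h (at x) v) + B (frechet_derivative f (at x) v) (h x)) S"
      using Suc.prems by (intro Ck_on_add[OF assms(2)] Suc.IH Ck_on_Suc_imp[OF Suc.prems(1)]
          Ck_on_Suc_imp[OF Suc.prems(2)]) auto
  qed (use Suc in auto)
qed

lemma Ck_on_compose:
  fixes f :: "'a::euclidean_space \<Rightarrow> 'b::euclidean_space"
  assumes "open S" "open T" "Ck_on k h T" "Ck_on k f S" "f ` S \<subseteq> T"
  shows "Ck_on k (\<lambda>x. h (f x)) S"
  using assms(3,4)
proof (induction k arbitrary: h)
  case 0
  then show ?case using assms(5) by (auto intro: continuous_on_compose2)
next
  case (Suc k)
  have hd: "h differentiable (at (f x))" if "x \<in> S" for x using Suc.prems assms(5) that by auto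
  have fd: "f differentiable (at x)" if "x \<in> S" for x using Suc.prems that by auto
  have expand: "frechet_derivative h (at (f x)) w = (\<Sum>b\<in>Basis. (w \<bullet> b) *\<^sub>R frechet_derivative h (at (f x)) b)"
    if "x \<in> S" for x w
  proof -
    have l: "linear (frechet_derivative h (at (f x)))" using linear_frechet_derivative[OF hd[OF that]] .
    have "frechet_derivative h (at (f x)) w = frechet_derivative h (at (f x)) (\<Sum>b\<in>Basis. (w \<bullet> b) *\<^sub>R b)"
      by (simp add: euclidean_representation)
    then show ?thesis by (simp only: linear_sum[OF l] linear_scale[OF l])
  qed
  show ?case
  proof (rule Ck_on_SucI[OF assms(1)])
    fix x assume x: "x \<in> S"
    show "((\<lambda>x. h (f x)) has_derivative
        (\<lambda>v. frechet_derivative h (at (f x)) (frechet_derivative f (at x) v))) (at x)"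
      by (rule has_derivative_compose[OF has_frechet_derivative[OF fd[OF x]] has_frechet_derivative[OF hd[OF x]]])
  next
    fix v
    have "Ck_on k (\<lambda>x. \<Sum>b\<in>Basis. (frechet_derivative f (at x) v \<bullet> b) *\<^sub>R frechet_derivative h (at (f x)) b) S"
    proof (intro Ck_on_sum[OF assms(1)] Ck_on_bilinear[OF bounded_bilinear_scaleR assms(1)]
        Ck_on_bilinear[OF bounded_bilinear_inner assms(1)] Ck_on_const)
      show "Ck_on k (\<lambda>x. frechet_derivative f (at x) v) S" using Suc.prems by auto
      fix b :: 'b
      show "Ck_on k (\<lambda>x. frechet_derivative h (at (f x)) b) S"
        by (rule Suc.IH[OF _ Ck_on_Suc_imp[OF Suc.prems(2)]]) (use Suc.prems(1) in auto)
    qed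
    then show "Ck_on k (\<lambda>x. frechet_derivative h (at (f x)) (frechet_derivative f (at x) v)) S"
      by (rule Ck_on_cong[OF assms(1), rotated]) (simp add: expand)
  qed
qed

lemma Ck_on_inverse:
  fixes f :: "'a::euclidean_space \<Rightarrow> real"
  assumes "open S" "Ck_on k f S" "\<And>x. x \<in> S \<Longrightarrow> f x \<noteq> 0"
  shows "Ck_on k (\<lambda>x. inverse (f x)) S"
  using assms(2)
proof (induction k)
  case 0
  then show ?case using assms(3) by (auto intro: continuous_intros)
next
  case (Suc k)
  show ?case
  proof (rule Ck_on_SucI[OF assms(1) Deriv.has_derivative_inverse])
    fix v
    have i: "Ck_on k (\<lambda>x. inverse (f x)) S" using Suc.IH Ck_on_Suc_imp[OF Suc.prems] .
    have d: "Ck_on k (\<lambda>x. frechet_derivative f (at x) v) S" using Suc.prems by auto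
    have "Ck_on k (\<lambda>x. (-1) * (inverse (f x) * frechet_derivative f (at x) v * inverse (f x))) S"
      by (intro Ck_on_bilinear[OF bounded_bilinear_mult assms(1)] i d Ck_on_const)
    then show "Ck_on k (\<lambda>x. - (inverse (f x) * frechet_derivative f (at x) v * inverse (f x))) S"
      by simp
  qed (use Suc.prems assms(3) in \<open>auto intro: has_frechet_derivative\<close>)
qed

subsection \<open>Germs of smooth maps\<close>

text \<open>On a manifold the natural domains of coordinate expressions vary from step to step. Working
  with germs avoids naming them.\<close>

definition smooth_near :: "('a::euclidean_space \<Rightarrow> 'b::real_normed_vector) \<Rightarrow> 'a \<Rightarrow> bool" where
  "smooth_near h x \<longleftrightarrow> (\<exists>N. open N \<and> x \<in> N \<and> smooth_on N h)"

lemma smooth_on_subset: "smooth_on S h \<Longrightarrow> T \<subseteq> S \<Longrightarrow> smooth_on T h"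
  unfolding smooth_on_def using Ck_on_subset by blast

lemma smooth_on_cong: "open S \<Longrightarrow> smooth_on S h \<Longrightarrow> (\<And>x. x \<in> S \<Longrightarrow> h x = h' x) \<Longrightarrow> smooth_on S h'"
  unfolding smooth_on_def using Ck_on_cong by blast

lemma smooth_on_imp_near: "open S \<Longrightarrow> smooth_on S h \<Longrightarrow> x \<in> S \<Longrightarrow> smooth_near h x"
  unfolding smooth_near_def by blast

lemma smooth_near_imp_on:
  assumes "\<And>x. x \<in> S \<Longrightarrow> smooth_near h x" shows "smooth_on S h"
  unfolding smooth_on_def
proof
  fix k
  have "\<exists>N. open N \<and> x \<in> N \<and> Ck_on k h N" if "x \<in> S" for x
    using assms[OF that] unfolding smooth_near_def smooth_on_def by blast
  then show "Ck_on k h S" by (rule Ck_on_local)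
qed

lemma smooth_near_cong:
  assumes "smooth_near h x" "\<forall>\<^sub>F y in nhds x. h y = h' y" shows "smooth_near h' x"
proof -
  obtain N where N: "open N" "x \<in> N" "smooth_on N h" using assms(1) unfolding smooth_near_def by blast
  obtain N' where N': "open N'" "x \<in> N'" "\<And>y. y \<in> N' \<Longrightarrow> h y = h' y"
    using assms(2) unfolding eventually_nhds by blast
  have "smooth_on (N \<inter> N') h'"
    by (rule smooth_on_cong[OF _ smooth_on_subset[OF N(3)]]) (use N N' in auto)
  then show ?thesis unfolding smooth_near_def using N N' by (meson IntI open_Int)
qed

lemma smooth_near_cong_open:
  assumes "smooth_near h x" "open N" "x \<in> N" "\<And>y. y \<in> N \<Longrightarrow> h y = h' y" shows "smooth_near h' x"
  using assms by (intro smooth_near_cong[OF assms(1)]) (auto simp: eventually_nhds)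

lemma smooth_near_common:
  assumes "smooth_near f x" "smooth_near h x"
  obtains N where "open N" "x \<in> N" "smooth_on N f" "smooth_on N h"
  using assms unfolding smooth_near_def by (meson IntI open_Int smooth_on_subset inf_le1 inf_le2)

lemma smooth_near_const: "smooth_near (\<lambda>x. c) x"
  unfolding smooth_near_def smooth_on_def by (intro exI[of _ UNIV]) (auto intro: Ck_on_const)

lemma smooth_near_bounded_linear: "bounded_linear f \<Longrightarrow> smooth_near f x"
  unfolding smooth_near_def smooth_on_def by (intro exI[of _ UNIV]) (auto intro: Ck_on_bounded_linear)

lemma smooth_near_bilinear:
  assumes "bounded_bilinear B" "smooth_near f x" "smooth_near h x"
  shows "smooth_near (\<lambda>x. B (f x) (h x)) x"
proof -
  obtain N where N: "open N" "x \<in> N" "smooth_on N f" "smooth_on N h"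
    using smooth_near_common[OF assms(2,3)] .
  then have "smooth_on N (\<lambda>x. B (f x) (h x))"
    using Ck_on_bilinear[OF assms(1) N(1)] unfolding smooth_on_def by blast
  then show ?thesis using smooth_on_imp_near N by blast
qed

lemmas smooth_near_scaleR = smooth_near_bilinear[OF bounded_bilinear_scaleR]
  and smooth_near_inner = smooth_near_bilinear[OF bounded_bilinear_inner]
  and smooth_near_mult = smooth_near_bilinear[OF bounded_bilinear_mult]

lemma smooth_near_add:
  assumes "smooth_near f x" "smooth_near h x" shows "smooth_near (\<lambda>x. f x + h x) x"
proof -
  obtain N where N: "open N" "x \<in> N" "smooth_on N f" "smooth_on N h"
    using smooth_near_common[OF assms] .
  then have "smooth_on N (\<lambda>x. f x + h x)"
    using Ck_on_add[OF N(1)] unfolding smooth_on_def by blast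
  then show ?thesis using smooth_on_imp_near N by blast
qed

lemma smooth_near_minus:
  assumes "smooth_near f x" shows "smooth_near (\<lambda>x. - f x) x"
  using smooth_near_scaleR[OF smooth_near_const[where c = "-1"] assms] by simp

lemma smooth_near_diff:
  assumes "smooth_near f x" "smooth_near h x" shows "smooth_near (\<lambda>x. f x - h x) x"
  using smooth_near_add[OF assms(1) smooth_near_minus[OF assms(2)]] by simp

lemma smooth_near_sum:
  assumes "\<And>i. i \<in> I \<Longrightarrow> smooth_near (f i) x" shows "smooth_near (\<lambda>x. \<Sum>i\<in>I. f i x) x"
  using assms by (induction I rule: infinite_finite_induct) (auto intro!: smooth_near_const smooth_near_add)

lemma smooth_near_prod:
  fixes f :: "'i \<Rightarrow> 'a::euclidean_space \<Rightarrow> real"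
  assumes "\<And>i. i \<in> I \<Longrightarrow> smooth_near (f i) x" shows "smooth_near (\<lambda>x. \<Prod>i\<in>I. f i x) x"
  using assms by (induction I rule: infinite_finite_induct) (auto intro!: smooth_near_const smooth_near_mult)

lemma smooth_near_inverse:
  fixes f :: "'a::euclidean_space \<Rightarrow> real"
  assumes "smooth_near f x" "f x \<noteq> 0" shows "smooth_near (\<lambda>x. inverse (f x)) x"
proof -
  obtain N where N: "open N" "x \<in> N" "smooth_on N f" using assms(1) unfolding smooth_near_def by blast
  have "continuous_on N f" using N(3) Ck_on_imp_continuous_on unfolding smooth_on_def by blast
  then have "open (N \<inter> f -` (- {0}))" by (rule continuous_open_preimage[OF _ N(1)]) auto
  moreover have "smooth_on (N \<inter> f -` (- {0})) (\<lambda>x. inverse (f x))"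
    using smooth_on_subset[OF N(3), of "N \<inter> f -` (- {0})"] calculation unfolding smooth_on_def
    by (auto intro!: Ck_on_inverse)
  ultimately show ?thesis unfolding smooth_near_def using N(2) assms(2) by blast
qed

lemma smooth_near_imp_continuous:
  assumes "smooth_near h x" shows "isCont h x"
proof -
  obtain N where N: "open N" "x \<in> N" "Ck_on 0 h N"
    using assms unfolding smooth_near_def smooth_on_def by blast
  then show ?thesis by (simp add: continuous_on_eq_continuous_at)
qed

lemma smooth_near_compose:
  fixes f :: "'a::euclidean_space \<Rightarrow> 'b::euclidean_space"
  assumes "smooth_near h (f x)" "smooth_near f x" shows "smooth_near (\<lambda>x. h (f x)) x"
proof -
  obtain N where N: "open N" "x \<in> N" "smooth_on N f" using assms(2) unfolding smooth_near_def by blast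
  obtain T where T: "open T" "f x \<in> T" "smooth_on T h" using assms(1) unfolding smooth_near_def by blast
  have "continuous_on N f" using N(3) Ck_on_imp_continuous_on unfolding smooth_on_def by blast
  then have o: "open (N \<inter> f -` T)" by (rule continuous_open_preimage[OF _ N(1) T(1)])
  have "Ck_on k (\<lambda>x. h (f x)) (N \<inter> f -` T)" for k
  proof (rule Ck_on_compose[OF o T(1)])
    show "Ck_on k h T" using T(3) unfolding smooth_on_def by blast
    show "Ck_on k f (N \<inter> f -` T)" using N(3) Ck_on_subset unfolding smooth_on_def by blast
  qed auto
  then show ?thesis unfolding smooth_near_def smooth_on_def using o N(2) T(2) by blast
qed

lemma smooth_near_Pair:
  fixes f :: "'a::euclidean_space \<Rightarrow> 'b::euclidean_space" and h :: "'a \<Rightarrow> 'c::euclidean_space"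
  assumes "smooth_near f x" "smooth_near h x" shows "smooth_near (\<lambda>x. (f x, h x)) x"
proof -
  have "smooth_near (\<lambda>x. (f x, 0) + (0::'b, h x)) x"
    by (intro smooth_near_add smooth_near_compose[OF smooth_near_bounded_linear assms(1)]
      smooth_near_compose[OF smooth_near_bounded_linear assms(2)] bounded_linear_intros)
  then show ?thesis by simp
qed

lemma smooth_near_fst: "smooth_near fst x" and smooth_near_snd: "smooth_near snd x"
  by (auto intro: smooth_near_bounded_linear bounded_linear_fst bounded_linear_snd)

lemma smooth_near_ident: "smooth_near (\<lambda>x. x) x"
  by (intro smooth_near_bounded_linear bounded_linear_ident)

lemma smooth_near_vec_lambda:
  fixes f :: "'i::finite \<Rightarrow> 'a::euclidean_space \<Rightarrow> real"
  assumes "\<And>i. smooth_near (f i) x" shows "smooth_near (\<lambda>x. \<chi> i. f i x) x"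
proof -
  have "smooth_near (\<lambda>x. \<Sum>i\<in>UNIV. f i x *\<^sub>R axis i (1::real)) x"
    by (intro smooth_near_sum smooth_near_scaleR assms smooth_near_const)
  moreover have "(\<Sum>i\<in>UNIV. f i x *\<^sub>R axis i (1::real)) = (\<chi> i. f i x)" for x
    by (simp add: vec_eq_iff axis_def sum_component if_distrib cong: if_cong)
  ultimately show ?thesis by simp
qed

lemma smooth_near_differentiable: "smooth_near h x \<Longrightarrow> h differentiable (at x)"
  unfolding smooth_near_def smooth_on_def using Ck_on_differentiable[of 0] by blast

lemma smooth_near_frechet: "smooth_near h x \<Longrightarrow> smooth_near (\<lambda>y. frechet_derivative h (at y) v) x"
  unfolding smooth_near_def smooth_on_def using Ck_on.simps(2) by blast

lemma smooth_near_eventually: "smooth_near h x \<Longrightarrow> \<forall>\<^sub>F y in nhds x. smooth_near h y"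
  unfolding eventually_nhds smooth_near_def by blast

subsection \<open>Symmetry of second derivatives\<close>

lemma DERIV_along_line:
  fixes h :: "'a::real_normed_vector \<Rightarrow> real"
  assumes "h differentiable (at (x + s *\<^sub>R u))"
  shows "DERIV (\<lambda>s. h (x + s *\<^sub>R u)) s :> frechet_derivative h (at (x + s *\<^sub>R u)) u"
proof -
  let ?D = "frechet_derivative h (at (x + s *\<^sub>R u))"
  have "((\<lambda>s. x + s *\<^sub>R u) has_derivative (\<lambda>r. r *\<^sub>R u)) (at s)"
    by (auto intro!: derivative_eq_intros)
  from has_derivative_compose[OF this has_frechet_derivative[OF assms]]
  have "((\<lambda>s. h (x + s *\<^sub>R u)) has_derivative (\<lambda>r. ?D (r *\<^sub>R u))) (at s)" .
  moreover have "?D (r *\<^sub>R u) = ?D u * r" for r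
    using linear_scale[OF linear_frechet_derivative[OF assms]] by (simp add: mult.commute)
  ultimately show ?thesis by (simp add: has_field_derivative_def)
qed

text \<open>The second difference of \<open>h\<close> over a small parallelogram, divided by its size, is by the mean value
  theorem a value of either mixed derivative.\<close>

lemma second_difference:
  fixes h :: "'a::euclidean_space \<Rightarrow> real"
  assumes S: "\<And>s t. 0 \<le> s \<Longrightarrow> s \<le> r \<Longrightarrow> 0 \<le> t \<Longrightarrow> t \<le> r \<Longrightarrow> x + s *\<^sub>R u + t *\<^sub>R v \<in> S"
    and "0 < r" "Ck_on 2 h S"
  obtains s t where "0 < s" "s < r" "0 < t" "t < r"
    "h (x + r *\<^sub>R u + r *\<^sub>R v) - h (x + r *\<^sub>R u) - h (x + r *\<^sub>R v) + h x
      = r * r * frechet_derivative (\<lambda>y. frechet_derivative h (at y) u) (at (x + s *\<^sub>R u + t *\<^sub>R v)) v"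
proof -
  let ?hu = "\<lambda>y. frechet_derivative h (at y) u"
  have d1: "h differentiable (at y)" and d2: "?hu differentiable (at y)" if "y \<in> S" for y
    using assms(3) that by (auto simp: numeral_2_eq_2)
  have "DERIV (\<lambda>s. h (x + s *\<^sub>R u + r *\<^sub>R v) - h (x + s *\<^sub>R u)) s :>
      ?hu (x + s *\<^sub>R u + r *\<^sub>R v) - ?hu (x + s *\<^sub>R u)" if "0 \<le> s" "s \<le> r" for s
  proof (rule DERIV_diff)
    have "x + r *\<^sub>R v + s *\<^sub>R u \<in> S" using S[of s r] that assms(2) by (simp add: algebra_simps)
    from DERIV_along_line[OF d1[OF this]]
    show "DERIV (\<lambda>s. h (x + s *\<^sub>R u + r *\<^sub>R v)) s :> ?hu (x + s *\<^sub>R u + r *\<^sub>R v)"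
      by (simp add: algebra_simps)
    have "x + s *\<^sub>R u \<in> S" using S[of s 0] that assms(2) by simp
    from DERIV_along_line[OF d1[OF this]]
    show "DERIV (\<lambda>s. h (x + s *\<^sub>R u)) s :> ?hu (x + s *\<^sub>R u)" .
  qed
  from MVT2[OF assms(2) this] obtain s where s: "0 < s" "s < r"
    "h (x + r *\<^sub>R u + r *\<^sub>R v) - h (x + r *\<^sub>R u) - (h (x + 0 *\<^sub>R u + r *\<^sub>R v) - h (x + 0 *\<^sub>R u))
      = (r - 0) * (?hu (x + s *\<^sub>R u + r *\<^sub>R v) - ?hu (x + s *\<^sub>R u))" by blast
  have "DERIV (\<lambda>t. ?hu (x + s *\<^sub>R u + t *\<^sub>R v)) t :>
      frechet_derivative ?hu (at (x + s *\<^sub>R u + t *\<^sub>R v)) v" if "0 \<le> t" "t \<le> r" for t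
    using S[of s t] that s by (intro DERIV_along_line d2) auto
  from MVT2[OF assms(2) this] obtain t where t: "0 < t" "t < r"
    "?hu (x + s *\<^sub>R u + r *\<^sub>R v) - ?hu (x + s *\<^sub>R u + 0 *\<^sub>R v)
      = (r - 0) * frechet_derivative ?hu (at (x + s *\<^sub>R u + t *\<^sub>R v)) v" by blast
  show thesis by (rule that[OF s(1,2) t(1,2)]) (use s(3) t(3) in \<open>simp add: algebra_simps\<close>)
qed

lemma symmetric_second_derivative_real:
  fixes h :: "'a::euclidean_space \<Rightarrow> real"
  assumes "open S" "Ck_on 2 h S" "x \<in> S"
  shows "frechet_derivative (\<lambda>y. frechet_derivative h (at y) u) (at x) v
    = frechet_derivative (\<lambda>y. frechet_derivative h (at y) v) (at x) u"
    (is "?a x = ?b x")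
proof (rule ccontr)
  assume ne: "?a x \<noteq> ?b x"
  define e where "e = \<bar>?a x - ?b x\<bar> / 2"
  have e: "e > 0" using ne by (simp add: e_def)
  have ca: "isCont ?a x" and cb: "isCont ?b x"
    using assms by (auto simp: numeral_2_eq_2 continuous_on_eq_continuous_at)
  obtain d where d: "d > 0" "\<And>y. dist y x < d \<Longrightarrow> y \<in> S \<and> dist (?a y) (?a x) < e \<and> dist (?b y) (?b x) < e"
  proof -
    obtain d1 where "d1 > 0" "ball x d1 \<subseteq> S" using assms openE by blast
    moreover obtain d2 where "d2 > 0" "\<forall>y. dist y x < d2 \<longrightarrow> dist (?a y) (?a x) < e"
      using ca e unfolding continuous_at_eps_delta dist_norm by blast
    moreover obtain d3 where "d3 > 0" "\<forall>y. dist y x < d3 \<longrightarrow> dist (?b y) (?b x) < e"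
      using cb e unfolding continuous_at_eps_delta dist_norm by blast
    ultimately show thesis
      by (intro that[of "min d1 (min d2 d3)"]) (auto simp: dist_commute)
  qed
  \<comment> \<open>a parallelogram with sides \<open>r u\<close> and \<open>r v\<close> stays within distance \<open>d\<close> of \<open>x\<close>\<close>
  define r where "r = d / (norm u + norm v + 1)"
  have r: "r > 0" using d(1) by (simp add: r_def add_nonneg_pos)
  have close: "dist (x + s *\<^sub>R u + t *\<^sub>R v) x < d" if "0 \<le> s" "s \<le> r" "0 \<le> t" "t \<le> r" for s t
  proof -
    have "dist (x + s *\<^sub>R u + t *\<^sub>R v) x \<le> s * norm u + t * norm v"
      using that by (simp add: dist_norm) (metis abs_of_nonneg norm_scaleR norm_triangle_ineq)
    also have "\<dots> \<le> r * norm u + r * norm v" using that by (intro add_mono mult_right_mono) auto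
    also have "\<dots> < r * (norm u + norm v + 1)" using r by (simp add: algebra_simps)
    also have "\<dots> = d" unfolding r_def using norm_ge_zero[of u] norm_ge_zero[of v]
      by (smt (verit) nonzero_eq_divide_eq)
    finally show ?thesis .
  qed
  obtain s t where st: "0 < s" "s < r" "0 < t" "t < r"
    "h (x + r *\<^sub>R u + r *\<^sub>R v) - h (x + r *\<^sub>R u) - h (x + r *\<^sub>R v) + h x = r * r * ?a (x + s *\<^sub>R u + t *\<^sub>R v)"
    by (rule second_difference[of r x u v S h]) (use close d r assms in auto)
  obtain s' t' where st': "0 < s'" "s' < r" "0 < t'" "t' < r"
    "h (x + r *\<^sub>R v + r *\<^sub>R u) - h (x + r *\<^sub>R v) - h (x + r *\<^sub>R u) + h x = r * r * ?b (x + s' *\<^sub>R v + t' *\<^sub>R u)"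
  proof (rule second_difference[of r x v u S h])
    show "x + s *\<^sub>R v + t *\<^sub>R u \<in> S" if "0 \<le> s" "s \<le> r" "0 \<le> t" "t \<le> r" for s t
      using close[of t s] d(2) that by (simp add: algebra_simps)
  qed (use r assms in auto)
  have eq: "?a (x + s *\<^sub>R u + t *\<^sub>R v) = ?b (x + s' *\<^sub>R v + t' *\<^sub>R u)"
  proof -
    have "r * r * ?a (x + s *\<^sub>R u + t *\<^sub>R v) = r * r * ?b (x + s' *\<^sub>R v + t' *\<^sub>R u)"
      unfolding st(5)[symmetric] st'(5)[symmetric] by (simp add: algebra_simps)
    then show ?thesis using r by simp
  qed
  have c1: "dist (?a (x + s *\<^sub>R u + t *\<^sub>R v)) (?a x) < e"
    using d(2)[OF close[of s t]] st(1-4) by auto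
  have c2: "dist (?b (x + s' *\<^sub>R v + t' *\<^sub>R u)) (?b x) < e"
    using d(2)[OF close[of t' s']] st'(1-4) by (auto simp: algebra_simps)
  have "dist (?a x) (?b x) < e + e"
    by (rule dist_triangle_less_add[OF c1[THEN dist_commute_lessI, unfolded eq] c2[THEN dist_commute_lessI]])
  then show False by (simp add: e_def dist_real_def)
qed

lemma frechet_derivative_inner:
  assumes "h differentiable (at x)"
  shows "frechet_derivative (\<lambda>y. h y \<bullet> b) (at x) v = frechet_derivative h (at x) v \<bullet> b"
  by (simp add: frechet_derivative_eqI[OF has_derivative_inner_left[OF has_frechet_derivative[OF assms]]])

lemma symmetric_second_derivative:
  fixes h :: "'a::euclidean_space \<Rightarrow> 'b::real_inner"
  assumes "open S" "Ck_on 2 h S" "x \<in> S"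
  shows "frechet_derivative (\<lambda>y. frechet_derivative h (at y) u) (at x) v
    = frechet_derivative (\<lambda>y. frechet_derivative h (at y) v) (at x) u"
proof -
  have dh: "h differentiable (at y)" and dhu: "(\<lambda>y. frechet_derivative h (at y) u) differentiable (at y)"
    if "y \<in> S" for y u using assms(2) that by (auto simp: numeral_2_eq_2)
  have comp: "frechet_derivative (\<lambda>y. frechet_derivative h (at y) u) (at x) v \<bullet> b
    = frechet_derivative (\<lambda>y. frechet_derivative (\<lambda>y. h y \<bullet> b) (at y) u) (at x) v" for u v b
  proof -
    have "frechet_derivative (\<lambda>y. frechet_derivative (\<lambda>y. h y \<bullet> b) (at y) u) (at x)
        = frechet_derivative (\<lambda>y. frechet_derivative h (at y) u \<bullet> b) (at x)"
    proof (rule frechet_derivative_transform_within_open[OF _ assms(1,3), symmetric])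
      show "(\<lambda>y. frechet_derivative h (at y) u \<bullet> b) differentiable (at x)"
        using has_derivative_inner_left[OF has_frechet_derivative[OF dhu[OF assms(3)]]]
        by (rule differentiableI)
      show "frechet_derivative h (at y) u \<bullet> b = frechet_derivative (\<lambda>y. h y \<bullet> b) (at y) u" if "y \<in> S" for y
        using frechet_derivative_inner[OF dh[OF that]] by (rule sym)
    qed
    then show ?thesis using frechet_derivative_inner[OF dhu[OF assms(3)], of u b v] by (simp only:)
  qed
  have "Ck_on 2 (\<lambda>y. h y \<bullet> b) S" for b
    by (intro Ck_on_bilinear[OF bounded_bilinear_inner] assms Ck_on_const)
  from symmetric_second_derivative_real[OF assms(1) this assms(3)]
  have "frechet_derivative (\<lambda>y. frechet_derivative h (at y) u) (at x) v \<bullet> b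
    = frechet_derivative (\<lambda>y. frechet_derivative h (at y) v) (at x) u \<bullet> b" for b
    unfolding comp .
  then show ?thesis by (rule vector_eq_rdot[THEN iffD1, OF allI])
qed

subsection \<open>Smooth cutoff functions\<close>

text \<open>The derivative of each of these functions is a linear combination of two others, hence all of them are
  smooth. The one with \<open>n = 0\<close> is the usual flat function \<open>exp (- 1 / x)\<close>.\<close>

definition flat_exp :: "nat \<Rightarrow> real \<Rightarrow> real" where
  "flat_exp n x = (if 0 < x then exp (- (1 / x)) * (1 / x) ^ n else 0)"

lemma flat_exp_tendsto_0: "((\<lambda>x. exp (- (1 / x)) * (1 / x) ^ n) \<longlongrightarrow> (0::real)) (at_right 0)"
proof -
  have "((\<lambda>y. y ^ n / exp y) \<longlongrightarrow> (0::real)) at_top" by (rule tendsto_power_div_exp_0)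
  then have "((\<lambda>x. inverse x ^ n / exp (inverse x)) \<longlongrightarrow> (0::real)) (at_right 0)"
    by (rule filterlim_compose[OF _ filterlim_inverse_at_top_right])
  then show ?thesis by (simp add: exp_minus field_simps)
qed

lemma DERIV_flat_exp: "DERIV (flat_exp n) x :> flat_exp (n + 2) x - real n * flat_exp (n + 1) x"
proof -
  consider "x > 0" | "x < 0" | "x = 0" by linarith
  then show ?thesis
  proof cases
    case 1
    have "DERIV (\<lambda>x. exp (- (1 / x)) * (1 / x) ^ n) x :> flat_exp (n + 2) x - real n * flat_exp (n + 1) x"
      using 1 by (auto intro!: derivative_eq_intros simp: flat_exp_def power2_eq_square field_simps)
        (cases n; simp add: field_simps)
    then show ?thesis
      by (rule has_field_derivative_transform_within_open[where S = "{0<..}"]) (use 1 in \<open>auto simp: flat_exp_def\<close>)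
  next
    case 2
    have "DERIV (\<lambda>x. 0) x :> flat_exp (n + 2) x - real n * flat_exp (n + 1) x"
      using 2 by (simp add: flat_exp_def)
    then show ?thesis
      by (rule has_field_derivative_transform_within_open[where S = "{..<0}"]) (use 2 in \<open>auto simp: flat_exp_def\<close>)
  next
    case 3
    have "((\<lambda>h. flat_exp n h / h) \<longlongrightarrow> 0) (at_right 0)"
      by (rule Lim_transform_eventually[OF flat_exp_tendsto_0[of "Suc n"]])
        (auto simp: eventually_at_filter flat_exp_def)
    moreover have "((\<lambda>h. flat_exp n h / h) \<longlongrightarrow> 0) (at_left 0)"
      by (rule tendsto_eventually) (auto simp: eventually_at_filter flat_exp_def)
    ultimately have "((\<lambda>h. flat_exp n h / h) \<longlongrightarrow> 0) (at 0)"
      using filterlim_split_at by blast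
    then show ?thesis using 3 by (simp add: DERIV_def flat_exp_def)
  qed
qed

lemma smooth_flat_exp: "smooth_near (flat_exp n) x"
proof -
  have "Ck_on k (flat_exp n) UNIV" for k
  proof (induction k arbitrary: n)
    case 0
    then show ?case using DERIV_flat_exp by (auto intro!: continuous_at_imp_continuous_on DERIV_isCont)
  next
    case (Suc k)
    show ?case
    proof (rule Ck_on_SucI[OF open_UNIV DERIV_flat_exp[unfolded has_field_derivative_def]])
      fix v :: real
      have "Ck_on k (\<lambda>x. flat_exp (n + 2) x * v + (- real n * v) * flat_exp (n + 1) x) UNIV"
        by (intro Ck_on_add Ck_on_bilinear[OF bounded_bilinear_mult] Ck_on_const Suc open_UNIV)
      then show "Ck_on k (\<lambda>x. (flat_exp (n + 2) x - real n * flat_exp (n + 1) x) * v) UNIV"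
        by (simp add: algebra_simps)
    qed
  qed
  then show ?thesis unfolding smooth_near_def smooth_on_def by blast
qed

text \<open>A quotient \<open>a / (a + b)\<close> is \<open>1\<close> where \<open>b\<close> vanishes and \<open>0\<close> where \<open>a\<close> does. Here \<open>b\<close> vanishes within distance
  \<open>\<delta>\<close> of the centre and \<open>a\<close> outside distance \<open>2 \<delta>\<close>; they never vanish together.\<close>

definition cutoff :: "'a::euclidean_space \<Rightarrow> real \<Rightarrow> 'a \<Rightarrow> real" where
  "cutoff a \<delta> x = (let r = (x - a) \<bullet> (x - a) in
     flat_exp 0 (4 * \<delta>\<^sup>2 - r) * inverse (flat_exp 0 (4 * \<delta>\<^sup>2 - r) + flat_exp 0 (r - \<delta>\<^sup>2)))"

lemma smooth_cutoff: assumes "\<delta> > 0" shows "smooth_near (cutoff a \<delta>) x"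
proof -
  have r: "smooth_near (\<lambda>x. (x - a) \<bullet> (x - a)) x"
    by (intro smooth_near_inner smooth_near_diff smooth_near_ident smooth_near_const)
  have 1: "smooth_near (\<lambda>x. flat_exp 0 (4 * \<delta>\<^sup>2 - (x - a) \<bullet> (x - a))) x"
    by (rule smooth_near_compose[OF smooth_flat_exp smooth_near_diff[OF smooth_near_const r]])
  have 2: "smooth_near (\<lambda>x. flat_exp 0 ((x - a) \<bullet> (x - a) - \<delta>\<^sup>2)) x"
    by (rule smooth_near_compose[OF smooth_flat_exp smooth_near_diff[OF r smooth_near_const]])
  have pos: "flat_exp 0 (4 * \<delta>\<^sup>2 - r) + flat_exp 0 (r - \<delta>\<^sup>2) > 0" for r
  proof (cases "r < 4 * \<delta>\<^sup>2")
    case False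
    then have "r > \<delta>\<^sup>2" using assms by (smt (verit) zero_less_power)
    then show ?thesis by (auto simp: flat_exp_def add_nonneg_pos)
  qed (auto simp: flat_exp_def add_pos_nonneg)
  show ?thesis unfolding cutoff_def Let_def
    using pos[of "(x - a) \<bullet> (x - a)"] by (intro smooth_near_mult smooth_near_inverse smooth_near_add 1 2) simp
qed

lemma cutoff_eq_1: assumes "dist a x \<le> \<delta>" "\<delta> > 0" shows "cutoff a \<delta> x = 1"
proof -
  have "(x - a) \<bullet> (x - a) = (dist a x)\<^sup>2" by (metis dist_commute dist_norm power2_norm_eq_inner)
  moreover have "(dist a x)\<^sup>2 \<le> \<delta>\<^sup>2" using assms by (simp add: power_mono)
  moreover have "\<delta>\<^sup>2 > 0" using assms by simp
  ultimately have "(x - a) \<bullet> (x - a) < 4 * \<delta>\<^sup>2" "(x - a) \<bullet> (x - a) \<le> \<delta>\<^sup>2" by linarith+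
  then show ?thesis by (simp add: cutoff_def Let_def flat_exp_def)
qed

lemma cutoff_eq_0: assumes "dist a x \<ge> 2 * \<delta>" "\<delta> > 0" shows "cutoff a \<delta> x = 0"
proof -
  have "(x - a) \<bullet> (x - a) = (dist a x)\<^sup>2" by (metis dist_commute dist_norm power2_norm_eq_inner)
  moreover have "(dist a x)\<^sup>2 \<ge> (2 * \<delta>)\<^sup>2" using assms by (intro power_mono) auto
  ultimately show ?thesis by (simp add: cutoff_def Let_def flat_exp_def)
qed

section \<open>Regularity of families of curves\<close>

text \<open>The vertical strip \<open>{(s, t). 0 \<le> t \<le> 1}\<close> contains the domains of all families; the relevant sets are
  relatively open in it because derivatives in \<open>t\<close> are one-sided at the ends.\<close>

abbreviation strip :: "(real \<times> real) set" where "strip \<equiv> UNIV \<times> {0..1}"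

definition mixed_partials ::
    "nat \<Rightarrow> (nat \<Rightarrow> nat \<Rightarrow> real \<Rightarrow> real \<Rightarrow> 'a::real_normed_vector) \<Rightarrow> (real \<times> real) set \<Rightarrow> bool" where
  "mixed_partials k D W \<longleftrightarrow>
     (\<forall>i. \<forall>l\<le>k. continuous_on W (\<lambda>(s, t). D i l s t)) \<and>
     (\<forall>i. \<forall>l\<le>k. \<forall>s t. (s, t) \<in> W \<longrightarrow> ((\<lambda>\<sigma>. D i l \<sigma> t) has_vector_derivative D (Suc i) l s t) (at s)) \<and>
     (\<forall>i. \<forall>l<k. \<forall>s t. (s, t) \<in> W \<longrightarrow> ((\<lambda>\<tau>. D i l s \<tau>) has_vector_derivative D i (Suc l) s t) (at t within {0..1}))"

definition mixed_regular ::
    "nat \<Rightarrow> (real \<Rightarrow> real \<Rightarrow> 'a::real_normed_vector) \<Rightarrow> (real \<times> real) set \<Rightarrow> bool" where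
  "mixed_regular k h W \<longleftrightarrow> (\<exists>D. (\<forall>s t. (s, t) \<in> W \<longrightarrow> D 0 0 s t = h s t) \<and> mixed_partials k D W)"

lemma mixed_partials_subset: "mixed_partials k D W \<Longrightarrow> V \<subseteq> W \<Longrightarrow> mixed_partials k D V"
  unfolding mixed_partials_def by (auto intro: continuous_on_subset)

lemma mixed_partials_continuous: "mixed_partials k D W \<Longrightarrow> l \<le> k \<Longrightarrow> continuous_on W (\<lambda>(s, t). D i l s t)"
  and mixed_partials_s: "mixed_partials k D W \<Longrightarrow> l \<le> k \<Longrightarrow> (s, t) \<in> W \<Longrightarrow>
    ((\<lambda>\<sigma>. D i l \<sigma> t) has_vector_derivative D (Suc i) l s t) (at s)"
  and mixed_partials_t: "mixed_partials k D W \<Longrightarrow> l < k \<Longrightarrow> (s, t) \<in> W \<Longrightarrow>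
    ((\<lambda>\<tau>. D i l s \<tau>) has_vector_derivative D i (Suc l) s t) (at t within {0..1})"
  unfolding mixed_partials_def by auto

lemma continuous_on_slice:
  assumes "continuous_on W (\<lambda>(s, t). h s t)" "\<And>t. t \<in> T \<Longrightarrow> (s, t) \<in> W"
  shows "continuous_on T (\<lambda>t. h s t)"
proof -
  have pair: "continuous_on T (\<lambda>t. (s, t))" by (rule continuous_on_Pair[OF continuous_on_const continuous_on_id])
  have "(\<lambda>t. (s, t)) ` T \<subseteq> W" using assms(2) by auto
  from continuous_on_compose2[OF assms(1) pair this] show ?thesis by simp
qed

lemma has_vector_derivative_s_cong:
  assumes "openin (top_of_set strip) W" "(s, t) \<in> W" "\<And>\<sigma> \<tau>. (\<sigma>, \<tau>) \<in> W \<Longrightarrow> f \<sigma> \<tau> = h \<sigma> \<tau>"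
    and "((\<lambda>\<sigma>. f \<sigma> t) has_vector_derivative d) (at s)"
  shows "((\<lambda>\<sigma>. h \<sigma> t) has_vector_derivative d) (at s)"
proof -
  obtain P where P: "open P" "W = strip \<inter> P" using assms(1) unfolding openin_open by blast
  have "open ((\<lambda>\<sigma>. (\<sigma>, t)) -` P)" by (intro open_vimage P continuous_intros)
  then show ?thesis
    by (rule has_vector_derivative_transform_within_open[OF assms(4)]) (use assms(2,3) P in auto)
qed

lemma has_vector_derivative_t_cong:
  assumes "openin (top_of_set strip) W" "(s, t) \<in> W" "\<And>\<sigma> \<tau>. (\<sigma>, \<tau>) \<in> W \<Longrightarrow> f \<sigma> \<tau> = h \<sigma> \<tau>"
    and "((\<lambda>\<tau>. f s \<tau>) has_vector_derivative d) (at t within {0..1})"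
  shows "((\<lambda>\<tau>. h s \<tau>) has_vector_derivative d) (at t within {0..1})"
proof -
  obtain P where P: "open P" "W = strip \<inter> P" using assms(1) unfolding openin_open by blast
  have "open ((\<lambda>\<tau>. (s, \<tau>)) -` P)" by (intro open_vimage P continuous_intros)
  moreover have "t \<in> (\<lambda>\<tau>. (s, \<tau>)) -` P" using assms(2) P by auto
  ultimately obtain e where e: "e > 0" "ball t e \<subseteq> (\<lambda>\<tau>. (s, \<tau>)) -` P" using openE by blast
  show ?thesis
    by (rule has_vector_derivative_transform_within[OF assms(4) e(1)])
      (use assms(2,3) P e(2) in \<open>auto simp: dist_commute subset_iff\<close>)
qed

lemma islimpt_Icc_unit: "t \<in> {0..1} \<Longrightarrow> t islimpt {0..1::real}"
  using connected_imp_perfect[of "{0..1::real}" t] by auto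

text \<open>Each partial derivative is a limit of difference quotients that only involve points of \<open>W\<close>, because \<open>W\<close> is
  relatively open in the strip. So the lower order ones determine the next.\<close>

lemma mixed_partials_unique:
  assumes "openin (top_of_set strip) W" "mixed_partials k D W" "mixed_partials k D' W"
    and "\<And>s t. (s, t) \<in> W \<Longrightarrow> D 0 0 s t = D' 0 0 s t" "l \<le> k" "(s, t) \<in> W"
  shows "D i l s t = D' i l s t"
  using assms(5,6)
proof (induction l arbitrary: i s t)
  case 0
  then show ?case
  proof (induction i arbitrary: s t)
    case 0
    then show ?case using assms(4) by blast
  next
    case (Suc i)
    have "((\<lambda>\<sigma>. D' i 0 \<sigma> t) has_vector_derivative D (Suc i) 0 s t) (at s)"
      by (rule has_vector_derivative_s_cong[OF assms(1) Suc.prems(2) Suc.IH])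
        (use mixed_partials_s[OF assms(2)] Suc.prems in auto)
    moreover have "((\<lambda>\<sigma>. D' i 0 \<sigma> t) has_vector_derivative D' (Suc i) 0 s t) (at s)"
      by (rule mixed_partials_s[OF assms(3) Suc.prems])
    ultimately show ?case by (rule vector_derivative_unique_at)
  qed
next
  case (Suc l)
  have t: "t \<in> {0..1}" using assms(1) Suc.prems(2) openin_imp_subset by fastforce
  have "((\<lambda>\<tau>. D' i l s \<tau>) has_vector_derivative D i (Suc l) s t) (at t within {0..1})"
    by (rule has_vector_derivative_t_cong[OF assms(1) Suc.prems(2) Suc.IH])
      (use mixed_partials_t[OF assms(2)] Suc.prems in auto)
  moreover have "((\<lambda>\<tau>. D' i l s \<tau>) has_vector_derivative D' i (Suc l) s t) (at t within {0..1})"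
    using mixed_partials_t[OF assms(3)] Suc.prems by auto
  moreover have "at t within {0..1} \<noteq> bot"
    using islimpt_Icc_unit[OF t] by (simp add: trivial_limit_within)
  ultimately show ?case using vector_derivative_unique_within by metis
qed

text \<open>By uniqueness the partial derivatives found on the pieces agree on overlaps, and they can be pasted.\<close>

lemma mixed_regular_local:
  assumes "\<And>z. z \<in> W \<Longrightarrow> \<exists>V. z \<in> V \<and> openin (top_of_set strip) V \<and> V \<subseteq> W \<and> mixed_regular k h V"
  shows "mixed_regular k h W"
proof -
  have "\<forall>z\<in>W. \<exists>V D. z \<in> V \<and> openin (top_of_set strip) V \<and> V \<subseteq> W
      \<and> (\<forall>s t. (s, t) \<in> V \<longrightarrow> D 0 0 s t = h s t) \<and> mixed_partials k D V"
  proof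
    fix z assume "z \<in> W"
    from assms[OF this] obtain V where "z \<in> V" "openin (top_of_set strip) V" "V \<subseteq> W" "mixed_regular k h V"
      by auto
    moreover from this(4) obtain D where "\<forall>s t. (s, t) \<in> V \<longrightarrow> D 0 0 s t = h s t" "mixed_partials k D V"
      unfolding mixed_regular_def by auto
    ultimately show "\<exists>V D. z \<in> V \<and> openin (top_of_set strip) V \<and> V \<subseteq> W
      \<and> (\<forall>s t. (s, t) \<in> V \<longrightarrow> D 0 0 s t = h s t) \<and> mixed_partials k D V"
      by (intro exI conjI)
  qed
  then obtain V D where VD: "\<forall>z\<in>W. z \<in> V z \<and> openin (top_of_set strip) (V z) \<and> V z \<subseteq> W
      \<and> (\<forall>s t. (s, t) \<in> V z \<longrightarrow> D z 0 0 s t = h s t) \<and> mixed_partials k (D z) (V z)"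
    unfolding bchoice_iff by (elim exE) (rule that)
  then have V: "\<And>z. z \<in> W \<Longrightarrow> z \<in> V z" "\<And>z. z \<in> W \<Longrightarrow> openin (top_of_set strip) (V z)"
      "\<And>z. z \<in> W \<Longrightarrow> V z \<subseteq> W" "\<And>z s t. z \<in> W \<Longrightarrow> (s, t) \<in> V z \<Longrightarrow> D z 0 0 s t = h s t"
      "\<And>z. z \<in> W \<Longrightarrow> mixed_partials k (D z) (V z)"
    by (auto simp only:)
  define E where "E i l s t = D (s, t) i l s t" for i l s t
  have E: "D z i l s t = E i l s t" if "z \<in> W" "(s, t) \<in> V z" "l \<le> k" for z i l s t
  proof -
    have st: "(s, t) \<in> W" using V(3)[OF that(1)] that(2) by auto
    have "D z i l s t = D (s, t) i l s t"
    proof (rule mixed_partials_unique[of "V (s, t) \<inter> V z" k "D z" "D (s, t)"])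
      show "openin (top_of_set strip) (V (s, t) \<inter> V z)" by (intro openin_Int V st that)
      show "mixed_partials k (D z) (V (s, t) \<inter> V z)"
        by (rule mixed_partials_subset[OF V(5)[OF that(1)]]) simp
      show "mixed_partials k (D (s, t)) (V (s, t) \<inter> V z)"
        by (rule mixed_partials_subset[OF V(5)[OF st]]) simp
      show "D z 0 0 s' t' = D (s, t) 0 0 s' t'" if "(s', t') \<in> V (s, t) \<inter> V z" for s' t'
        using V(4)[OF st, of s' t'] V(4)[OF \<open>z \<in> W\<close>, of s' t'] that by simp
      show "(s, t) \<in> V (s, t) \<inter> V z" using V(1)[OF st] that(2) by simp
    qed (rule that(3))
    then show ?thesis unfolding E_def .
  qed
  have Wst: "W \<subseteq> strip"
  proof
    fix z assume z: "z \<in> W"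
    show "z \<in> strip" using openin_imp_subset[OF V(2)[OF z]] V(1)[OF z] by (rule subsetD)
  qed
  have "continuous_on W (\<lambda>(s, t). E i l s t)" if l: "l \<le> k" for i l
    unfolding continuous_on_eq_continuous_within
  proof
    fix z assume z: "z \<in> W"
    obtain P where P: "open P" "V z = strip \<inter> P" using V(2)[OF z] unfolding openin_open by auto
    have "continuous_on (V z) (\<lambda>(s, t). E i l s t)"
      by (rule continuous_on_eq[OF mixed_partials_continuous[OF V(5)[OF z] l, of i]]) (use E[OF z _ l] in auto)
    then have "continuous (at z within V z) (\<lambda>(s, t). E i l s t)"
      using V(1)[OF z] by (simp add: continuous_on_eq_continuous_within)
    moreover have "at z within V z = at z within W"
    proof (rule at_within_nhd[of z P])
      show "z \<in> P" using V(1)[OF z] P(2) by simp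
      show "V z \<inter> P - {z} = W \<inter> P - {z}" using V(3)[OF z] Wst unfolding P(2) by blast
    qed (rule P(1))
    ultimately show "continuous (at z within W) (\<lambda>(s, t). E i l s t)" by simp
  qed
  moreover have "((\<lambda>\<sigma>. E i l \<sigma> t) has_vector_derivative E (Suc i) l s t) (at s)"
    if l: "l \<le> k" and st: "(s, t) \<in> W" for i l s t
  proof -
    have "((\<lambda>\<sigma>. D (s, t) i l \<sigma> t) has_vector_derivative E (Suc i) l s t) (at s)"
      using mixed_partials_s[OF V(5)[OF st] l V(1)[OF st], of i] by (simp add: E_def)
    with E[OF st _ l] show ?thesis
      by (rule has_vector_derivative_s_cong[where f = "D (s, t) i l" and h = "E i l", OF V(2)[OF st] V(1)[OF st]])
  qed
  moreover have "((\<lambda>\<tau>. E i l s \<tau>) has_vector_derivative E i (Suc l) s t) (at t within {0..1})"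
    if l: "l < k" and st: "(s, t) \<in> W" for i l s t
  proof -
    have "((\<lambda>\<tau>. D (s, t) i l s \<tau>) has_vector_derivative E i (Suc l) s t) (at t within {0..1})"
      using mixed_partials_t[OF V(5)[OF st] l V(1)[OF st], of i] by (simp add: E_def)
    with E[OF st _ less_imp_le[OF l]] show ?thesis
      by (rule has_vector_derivative_t_cong[where f = "D (s, t) i l" and h = "E i l", OF V(2)[OF st] V(1)[OF st]])
  qed
  ultimately have "mixed_partials k E W" unfolding mixed_partials_def by (intro conjI allI impI)
  moreover have "E 0 0 s t = h s t" if "(s, t) \<in> W" for s t
    unfolding E_def by (rule V(4)[OF that V(1)[OF that]])
  ultimately show ?thesis unfolding mixed_regular_def by (intro exI[of _ E] conjI allI impI)
qed

text \<open>Derivatives in \<open>s\<close> are given from the start, as a sequence; those in \<open>t\<close> are then added one order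
  at a time.\<close>

definition s_partials :: "(nat \<Rightarrow> real \<Rightarrow> real \<Rightarrow> 'a::real_normed_vector) \<Rightarrow> (real \<times> real) set \<Rightarrow> bool" where
  "s_partials D W \<longleftrightarrow> (\<forall>i. continuous_on W (\<lambda>(s, t). D i s t)) \<and>
     (\<forall>i s t. (s, t) \<in> W \<longrightarrow> ((\<lambda>\<sigma>. D i \<sigma> t) has_vector_derivative D (Suc i) s t) (at s))"

fun regular_sequence ::
    "nat \<Rightarrow> (nat \<Rightarrow> real \<Rightarrow> real \<Rightarrow> 'a::real_normed_vector) \<Rightarrow> (real \<times> real) set \<Rightarrow> bool" where
  "regular_sequence 0 D W \<longleftrightarrow> s_partials D W"
| "regular_sequence (Suc k) D W \<longleftrightarrow> s_partials D W \<and> (\<exists>E. regular_sequence k E W \<and>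
     (\<forall>i s t. (s, t) \<in> W \<longrightarrow> ((\<lambda>\<tau>. D i s \<tau>) has_vector_derivative E i s t) (at t within {0..1})))"

lemma regular_sequence_mixed_partials:
  "regular_sequence k D W \<Longrightarrow> \<exists>E. mixed_partials k E W \<and> (\<forall>i. E i 0 = D i)"
proof (induction k arbitrary: D)
  case 0
  then show ?case
    by (intro exI[of _ "\<lambda>i l. D i"]) (auto simp: mixed_partials_def s_partials_def)
next
  case (Suc k)
  then obtain D' where D': "regular_sequence k D' W"
    "\<And>i s t. (s, t) \<in> W \<Longrightarrow> ((\<lambda>\<tau>. D i s \<tau>) has_vector_derivative D' i s t) (at t within {0..1})"
    by auto
  from Suc.IH[OF D'(1)] obtain E where E: "mixed_partials k E W" "\<And>i. E i 0 = D' i" by auto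
  have D: "s_partials D W" using Suc.prems by simp
  define G where "G i l = (case l of 0 \<Rightarrow> D i | Suc l \<Rightarrow> E i l)" for i l
  have "mixed_partials (Suc k) G W"
    using E(1) D D'(2) E(2) unfolding mixed_partials_def s_partials_def G_def
    by (auto split: nat.split simp: less_Suc_eq_0_disj)
  moreover have "\<forall>i. G i 0 = D i" by (simp add: G_def)
  ultimately show ?case by blast
qed

lemma regular_sequence_Suc_imp: "regular_sequence (Suc k) D W \<Longrightarrow> regular_sequence k D W"
proof (induction k arbitrary: D)
  case (Suc k)
  from Suc.prems obtain E where "s_partials D W" "regular_sequence (Suc k) E W"
    "\<forall>i s t. (s, t) \<in> W \<longrightarrow> ((\<lambda>\<tau>. D i s \<tau>) has_vector_derivative E i s t) (at t within {0..1})"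
    unfolding regular_sequence.simps(2)[of "Suc k"] by auto
  with Suc.IH[of E] show ?case by auto
qed simp

lemma s_partials_add:
  assumes "s_partials D W" "s_partials E W" shows "s_partials (\<lambda>i s t. D i s t + E i s t) W"
  using assms unfolding s_partials_def
  by (auto intro!: continuous_on_add has_vector_derivative_add simp: case_prod_unfold)

lemma regular_sequence_add:
  "regular_sequence k D W \<Longrightarrow> regular_sequence k E W \<Longrightarrow> regular_sequence k (\<lambda>i s t. D i s t + E i s t) W"
proof (induction k arbitrary: D E)
  case 0
  then show ?case by (simp add: s_partials_add)
next
  case (Suc k)
  from Suc.prems obtain D' E' where DE: "regular_sequence k D' W" "regular_sequence k E' W"
    "\<And>i s t. (s, t) \<in> W \<Longrightarrow> ((\<lambda>\<tau>. D i s \<tau>) has_vector_derivative D' i s t) (at t within {0..1})"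
    "\<And>i s t. (s, t) \<in> W \<Longrightarrow> ((\<lambda>\<tau>. E i s \<tau>) has_vector_derivative E' i s t) (at t within {0..1})"
    by auto
  show ?case
    using Suc.IH[OF DE(1,2)] DE(3,4) Suc.prems
    by (auto intro!: s_partials_add exI[of _ "\<lambda>i s t. D' i s t + E' i s t"] has_vector_derivative_add)
qed

lemma regular_sequence_0: "regular_sequence k (\<lambda>i s t. 0) W"
  by (induction k) (auto simp: s_partials_def intro!: exI[of _ "\<lambda>i s t. 0"])

lemma regular_sequence_sum:
  "(\<And>b. b \<in> I \<Longrightarrow> regular_sequence k (D b) W) \<Longrightarrow> regular_sequence k (\<lambda>i s t. \<Sum>b\<in>I. D b i s t) W"
  by (induction I rule: infinite_finite_induct) (auto intro: regular_sequence_0 regular_sequence_add)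

definition curve_derivatives :: "nat \<Rightarrow> (nat \<Rightarrow> real \<Rightarrow> 'a::real_normed_vector) \<Rightarrow> real set \<Rightarrow> bool" where
  "curve_derivatives k a T \<longleftrightarrow> (\<forall>l\<le>k. continuous_on T (a l)) \<and>
     (\<forall>l<k. \<forall>t\<in>T. (a l has_vector_derivative a (Suc l) t) (at t within {0..1}))"

lemma curve_derivatives_tail: "curve_derivatives (Suc k) a T \<Longrightarrow> curve_derivatives k (\<lambda>l. a (Suc l)) T"
  and curve_derivatives_Suc_imp: "curve_derivatives (Suc k) a T \<Longrightarrow> curve_derivatives k a T"
  unfolding curve_derivatives_def by auto

lemma s_partials_scaleR:
  assumes "s_partials D W" "continuous_on T a" "W \<subseteq> UNIV \<times> T"
  shows "s_partials (\<lambda>i s t. a t *\<^sub>R D i s t) W"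
proof -
  have "continuous_on W (\<lambda>z. a (snd z))"
    by (rule continuous_on_compose2[OF assms(2) continuous_on_snd[OF continuous_on_id]]) (use assms(3) in auto)
  then show ?thesis using assms(1) unfolding s_partials_def
    by (auto intro!: continuous_on_scaleR simp: case_prod_unfold
      intro: bounded_linear.has_vector_derivative[OF bounded_linear_scaleR_right])
qed

lemma regular_sequence_scaleR:
  assumes "W \<subseteq> UNIV \<times> T"
  shows "regular_sequence k D W \<Longrightarrow> curve_derivatives k a T \<Longrightarrow> regular_sequence k (\<lambda>i s t. a 0 t *\<^sub>R D i s t) W"
proof (induction k arbitrary: D a)
  case 0
  then show ?case using s_partials_scaleR assms by (auto simp: curve_derivatives_def)
next
  case (Suc k)
  from Suc.prems(1) obtain E where E: "regular_sequence k E W" "s_partials D W"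
    "\<And>i s t. (s, t) \<in> W \<Longrightarrow> ((\<lambda>\<tau>. D i s \<tau>) has_vector_derivative E i s t) (at t within {0..1})"
    by auto
  have a: "continuous_on T (a 0)" "\<And>t. t \<in> T \<Longrightarrow> (a 0 has_vector_derivative a 1 t) (at t within {0..1})"
    using Suc.prems(2) unfolding curve_derivatives_def by auto
  have "regular_sequence k (\<lambda>i s t. a 0 t *\<^sub>R E i s t + a (Suc 0) t *\<^sub>R D i s t) W"
    by (intro regular_sequence_add Suc.IH[OF E(1) curve_derivatives_Suc_imp[OF Suc.prems(2)]]
      Suc.IH[OF regular_sequence_Suc_imp[OF Suc.prems(1)] curve_derivatives_tail[OF Suc.prems(2)]])
  moreover have "((\<lambda>\<tau>. a 0 \<tau> *\<^sub>R D i s \<tau>) has_vector_derivative a 0 t *\<^sub>R E i s t + a (Suc 0) t *\<^sub>R D i s t)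
      (at t within {0..1})" if "(s, t) \<in> W" for i s t
    using has_vector_derivative_scaleR[OF a(2)[unfolded has_real_derivative_iff_has_vector_derivative[symmetric]] E(3)[OF that]]
      that assms by auto
  ultimately show ?case
    using s_partials_scaleR[OF E(2) a(1) assms] by auto
qed

subsection \<open>Smooth functions of a parameter and a point on a curve\<close>

abbreviation d_par :: "(real \<times> 'b::euclidean_space \<Rightarrow> 'a::euclidean_space) \<Rightarrow> real \<times> 'b \<Rightarrow> 'a" where
  "d_par H \<equiv> (\<lambda>z. frechet_derivative H (at z) (1, 0))"

lemma has_vector_derivative_chain:
  assumes f: "(f has_vector_derivative f') (at t within S)" and h: "(h has_derivative D) (at (f t))"
  shows "((\<lambda>t. h (f t)) has_vector_derivative D f') (at t within S)"
proof -
  have "((\<lambda>t. h (f t)) has_derivative (\<lambda>r. D (r *\<^sub>R f'))) (at t within S)"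
    by (rule has_derivative_compose[OF f[unfolded has_vector_derivative_def] h])
  then show ?thesis by (simp add: has_vector_derivative_def linear_scale[OF has_derivative_linear[OF h]])
qed

lemma smooth_on_frechet:
  assumes "smooth_on N H" shows "smooth_on N (\<lambda>z. frechet_derivative H (at z) v)"
  unfolding smooth_on_def
proof
  fix k
  have "Ck_on (Suc k) H N" using assms by (simp only: smooth_on_def)
  then show "Ck_on k (\<lambda>z. frechet_derivative H (at z) v) N" by simp
qed

lemma smooth_on_differentiable: assumes "smooth_on N H" "z \<in> N" shows "H differentiable (at z)"
proof -
  have "Ck_on (Suc 0) H N" using assms by (simp only: smooth_on_def)
  then show ?thesis using assms(2) by simp
qed

lemma smooth_on_continuous: assumes "smooth_on N H" shows "continuous_on N H"
proof -
  have "Ck_on 0 H N" using assms by (simp only: smooth_on_def)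
  then show ?thesis by simp
qed

lemma smooth_on_d_par: "smooth_on N H \<Longrightarrow> smooth_on N ((d_par ^^ i) H)"
  by (induction i) (simp_all add: smooth_on_frechet)

lemma smooth_on_symmetric_derivative:
  fixes H :: "'a::euclidean_space \<Rightarrow> 'b::euclidean_space"
  assumes "open N" "smooth_on N H" "z \<in> N"
  shows "frechet_derivative (\<lambda>y. frechet_derivative H (at y) u) (at z) v
    = frechet_derivative (\<lambda>y. frechet_derivative H (at y) v) (at z) u"
  by (rule symmetric_second_derivative[OF assms(1) _ assms(3)]) (use assms(2) in \<open>simp add: smooth_on_def\<close>)

text \<open>By symmetry of second derivatives the parameter derivatives pass through any directional derivative.\<close>

lemma d_par_commute:
  assumes "open N" "smooth_on N H" "z \<in> N"
  shows "frechet_derivative ((d_par ^^ i) H) (at z) v = (d_par ^^ i) (\<lambda>y. frechet_derivative H (at y) v) z"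
  using assms(3)
proof (induction i arbitrary: z)
  case (Suc i)
  let ?G = "(d_par ^^ i) H"
  have "frechet_derivative ((d_par ^^ Suc i) H) (at z) v
      = frechet_derivative (\<lambda>y. frechet_derivative ?G (at y) v) (at z) (1, 0)"
    using smooth_on_symmetric_derivative[OF assms(1) smooth_on_d_par[OF assms(2)] Suc.prems, of i] by simp
  also have "frechet_derivative (\<lambda>y. frechet_derivative ?G (at y) v) (at z)
      = frechet_derivative ((d_par ^^ i) (\<lambda>y. frechet_derivative H (at y) v)) (at z)"
    by (rule frechet_derivative_transform_within_open[OF _ assms(1) Suc.prems Suc.IH])
      (intro smooth_on_differentiable[OF smooth_on_frechet[OF smooth_on_d_par[OF assms(2)]] Suc.prems])
  finally show ?case by simp
qed simp

lemma has_vector_derivative_par: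
  fixes H :: "real \<times> 'b::euclidean_space \<Rightarrow> 'a::euclidean_space"
  assumes "H differentiable (at (s, y))"
  shows "((\<lambda>\<sigma>. H (\<sigma>, y)) has_vector_derivative d_par H (s, y)) (at s)"
  by (rule has_vector_derivative_chain[OF has_vector_derivative_Pair[OF has_vector_derivative_id
    has_vector_derivative_const] has_frechet_derivative[OF assms]])

lemma has_vector_derivative_along_curve:
  fixes H :: "real \<times> 'b::euclidean_space \<Rightarrow> 'a::real_normed_vector"
  assumes "H differentiable (at (s, x t))" "(x has_vector_derivative x') (at t within S)"
  shows "((\<lambda>\<tau>. H (s, x \<tau>)) has_vector_derivative
    (\<Sum>b\<in>Basis. (x' \<bullet> b) *\<^sub>R frechet_derivative H (at (s, x t)) (0, b))) (at t within S)"
proof -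
  let ?D = "frechet_derivative H (at (s, x t))"
  have l: "linear (\<lambda>v. ?D (0, v))"
    using linear_compose[OF _ linear_frechet_derivative[OF assms(1)], of "\<lambda>v. (0, v)"]
    by (simp add: o_def linear_iff)
  have "?D (0, x') = ?D (0, \<Sum>b\<in>Basis. (x' \<bullet> b) *\<^sub>R b)" by (simp only: euclidean_representation)
  also have "\<dots> = (\<Sum>b\<in>Basis. (x' \<bullet> b) *\<^sub>R ?D (0, b))"
    by (simp only: linear_sum[OF l] linear_scale[OF l])
  finally show ?thesis
    using has_vector_derivative_chain[OF has_vector_derivative_Pair[OF has_vector_derivative_const assms(2)]
      has_frechet_derivative[OF assms(1)]] by simp
qed

lemma s_partials_compose:
  fixes H :: "real \<times> 'b::euclidean_space \<Rightarrow> 'a::euclidean_space"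
  assumes "W \<subseteq> UNIV \<times> T" "smooth_on N H" "continuous_on T x" "\<And>s t. (s, t) \<in> W \<Longrightarrow> (s, x t) \<in> N"
  shows "s_partials (\<lambda>i s t. (d_par ^^ i) H (s, x t)) W"
  unfolding s_partials_def
proof (intro conjI allI impI)
  fix i
  have "continuous_on W (\<lambda>z. (fst z, x (snd z)))"
    using assms(1) by (intro continuous_intros continuous_on_compose2[OF assms(3)]) auto
  then show "continuous_on W (\<lambda>(s, t). (d_par ^^ i) H (s, x t))"
    unfolding case_prod_unfold
    by (rule continuous_on_compose2[OF smooth_on_continuous[OF smooth_on_d_par[OF assms(2)]]])
      (use assms(4) in auto)
next
  fix i s t assume "(s, t) \<in> W"
  then show "((\<lambda>\<sigma>. (d_par ^^ i) H (\<sigma>, x t)) has_vector_derivative (d_par ^^ Suc i) H (s, x t)) (at s)"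
    using has_vector_derivative_par[OF smooth_on_differentiable[OF smooth_on_d_par[OF assms(2)] assms(4)]]
    by simp
qed

text \<open>The derivative of \<open>H (s, x t)\<close> in \<open>t\<close> is a sum of products of a component of \<open>x' t\<close> and a function of the
  same form, with \<open>H\<close> replaced by a partial derivative. This drives the induction on the order in \<open>t\<close>.\<close>

lemma regular_sequence_compose:
  fixes H :: "real \<times> 'b::euclidean_space \<Rightarrow> 'a::euclidean_space"
  assumes "open N" "W \<subseteq> UNIV \<times> T" "\<And>s t. (s, t) \<in> W \<Longrightarrow> (s, x 0 t) \<in> N"
  shows "smooth_on N H \<Longrightarrow> curve_derivatives k x T \<Longrightarrow>
    regular_sequence k (\<lambda>i s t. (d_par ^^ i) H (s, x 0 t)) W"
proof (induction k arbitrary: H)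
  case 0
  then show ?case using s_partials_compose[OF assms(2) 0(1)] assms(3) by (simp add: curve_derivatives_def)
next
  case (Suc k)
  have c: "continuous_on T (x 0)" using Suc.prems(2) by (simp add: curve_derivatives_def)
  define E where "E i s t = (\<Sum>b\<in>Basis. (x 1 t \<bullet> b) *\<^sub>R
    (d_par ^^ i) (\<lambda>y. frechet_derivative H (at y) (0, b)) (s, x 0 t))" for i s t
  have "regular_sequence k E W"
    unfolding E_def
  proof (rule regular_sequence_sum)
    fix b :: 'b
    have "curve_derivatives k (\<lambda>l t. x (Suc l) t \<bullet> b) T"
      using curve_derivatives_tail[OF Suc.prems(2)] unfolding curve_derivatives_def
      by (auto intro!: continuous_on_inner continuous_on_const
        bounded_linear.has_vector_derivative[OF bounded_linear_inner_left])
    from regular_sequence_scaleR[OF assms(2) Suc.IH[OF smooth_on_frechet[OF Suc.prems(1)]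
      curve_derivatives_Suc_imp[OF Suc.prems(2)]] this]
    show "regular_sequence k (\<lambda>i s t. (x 1 t \<bullet> b) *\<^sub>R
      (d_par ^^ i) (\<lambda>y. frechet_derivative H (at y) (0, b)) (s, x 0 t)) W" by simp
  qed
  moreover have "((\<lambda>\<tau>. (d_par ^^ i) H (s, x 0 \<tau>)) has_vector_derivative E i s t) (at t within {0..1})"
    if st: "(s, t) \<in> W" for i s t
  proof -
    have "(x 0 has_vector_derivative x 1 t) (at t within {0..1})"
      using Suc.prems(2) st assms(2) by (auto simp: curve_derivatives_def)
    from has_vector_derivative_along_curve[OF smooth_on_differentiable[OF smooth_on_d_par[OF Suc.prems(1)] assms(3)[OF st]] this]
    show ?thesis by (simp add: E_def d_par_commute[OF assms(1) Suc.prems(1) assms(3)[OF st]])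
  qed
  ultimately show ?case
    using s_partials_compose[OF assms(2) Suc.prems(1) c assms(3)] by auto
qed

lemma mixed_regular_compose:
  fixes H :: "real \<times> 'b::euclidean_space \<Rightarrow> 'a::euclidean_space"
  assumes "open N" "smooth_on N H" "W \<subseteq> UNIV \<times> T" "curve_derivatives k x T"
    and "\<And>s t. (s, t) \<in> W \<Longrightarrow> (s, x 0 t) \<in> N" "\<And>s t. (s, t) \<in> W \<Longrightarrow> h s t = H (s, x 0 t)"
  shows "mixed_regular k h W"
proof -
  from regular_sequence_mixed_partials[OF regular_sequence_compose[OF assms(1,3,5,2,4)]]
  obtain E where "mixed_partials k E W" "\<And>i. E i 0 = (\<lambda>s t. (d_par ^^ i) H (s, x 0 t))" by auto
  then show ?thesis unfolding mixed_regular_def using assms(6) by (intro exI[of _ E]) simp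
qed

section \<open>Smooth maps on the manifold\<close>

lemma matrix_inv_inverse:
  fixes B :: "real ^ 'n ^ 'n::finite"
  assumes "invertible B" shows "B ** matrix_inv B = mat 1" "matrix_inv B ** B = mat 1"
  using someI_ex[OF assms[unfolded invertible_def]] unfolding matrix_inv_def by simp_all

text \<open>Cramer's rule expresses the entries of the inverse by determinants.\<close>

lemma smooth_near_inverse_matrix:
  fixes M :: "'a::euclidean_space \<Rightarrow> real ^ 'n ^ 'n::finite"
  assumes "\<And>i j. smooth_near (\<lambda>x. M x $ i $ j) x" "\<forall>\<^sub>F y in nhds x. invertible (M y)"
  shows "smooth_near (\<lambda>x. matrix_inv (M x) $ k $ j) x"
proof -
  have det: "smooth_near (\<lambda>x. det (N x)) x"
    if "\<And>i j. smooth_near (\<lambda>x. N x $ i $ j) x" for N :: "'a \<Rightarrow> real ^ 'n ^ 'n"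
    unfolding det_def by (intro smooth_near_sum smooth_near_mult smooth_near_const smooth_near_prod that)
  have nz: "det (M x) \<noteq> 0" using eventually_nhds_x_imp_x[OF assms(2)] invertible_det_nz by auto
  have cramer_inv: "matrix_inv B $ k $ j
      = det (\<chi> i l. if l = k then axis j 1 $ i else B $ i $ l) * inverse (det B)"
    if "invertible B" for B :: "real ^ 'n ^ 'n"
  proof -
    have "B *v (matrix_inv B *v axis j 1) = axis j 1"
      using matrix_inv_inverse(1)[OF that] by (simp add: matrix_vector_mul_assoc)
    then have "matrix_inv B *v axis j 1
        = (\<chi> k. det (\<chi> i l. if l = k then axis j 1 $ i else B $ i $ l) / det B)"
      using cramer[of B] that invertible_det_nz by auto
    moreover have "matrix_inv B $ k $ j = (matrix_inv B *v axis j 1) $ k"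
      by (simp add: matrix_vector_mult_basis column_def)
    ultimately show ?thesis by (simp add: divide_inverse)
  qed
  have "smooth_near (\<lambda>x. (\<chi> i l. if l = k then axis j 1 $ i else M x $ i $ l) $ a $ b) x" for a b
    using assms(1)[of a b] smooth_near_const[where c = "axis j (1::real) $ a"] by (cases "b = k") simp_all
  then have "smooth_near (\<lambda>x. det (\<chi> i l. if l = k then axis j 1 $ i else M x $ i $ l) * inverse (det (M x))) x"
    by (intro smooth_near_mult smooth_near_inverse det assms(1) nz)
  then show ?thesis
    by (rule smooth_near_cong) (use assms(2) in \<open>auto elim!: eventually_mono simp: cramer_inv\<close>)
qed

locale immersed_manifold =
  fixes A :: "('m::{second_countable_topology, t2_space}, 'n::finite) chart set"
    and g :: "('m, 'n) metric" and F :: "'m \<Rightarrow> real ^ 'd::finite"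
  assumes atlas: "smooth_atlas A" and metric: "riemannian_metric A g"
    and isometric: "isometric_immersion A g F"
begin

lemma chart_at: "chart_at A m \<in> A" "m \<in> dom_c (chart_at A m)"
proof -
  have "m \<in> (\<Union>c\<in>A. dom_c c)" using atlas unfolding smooth_atlas_def by simp
  then have "\<exists>c. c \<in> A \<and> m \<in> dom_c c" by (auto simp del: split_paired_Ex)
  from someI_ex[OF this] show "chart_at A m \<in> A" "m \<in> dom_c (chart_at A m)"
    unfolding chart_at_def by (simp_all del: split_paired_Ex)
qed

context
  fixes c assumes c: "c \<in> A"
begin

lemma open_dom: "open (dom_c c)" and open_img: "open (img_c c)"
  and homeo: "homeomorphism (dom_c c) (img_c c) (coord c) (param c)"
  using atlas c unfolding smooth_atlas_def by (metis (no_types, lifting))+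

lemma param_coord: "m \<in> dom_c c \<Longrightarrow> param c (coord c m) = m"
  and coord_param: "x \<in> img_c c \<Longrightarrow> coord c (param c x) = x"
  and coord_in_img: "m \<in> dom_c c \<Longrightarrow> coord c m \<in> img_c c"
  and param_in_dom: "x \<in> img_c c \<Longrightarrow> param c x \<in> dom_c c"
  and continuous_coord: "continuous_on (dom_c c) (coord c)"
  and continuous_param: "continuous_on (img_c c) (param c)"
  using homeo unfolding homeomorphism_def by auto

lemma open_coord_image:
  assumes "open U" shows "open (coord c ` (dom_c c \<inter> U))"
proof -
  have "coord c ` (dom_c c \<inter> U) = img_c c \<inter> param c -` U"
  proof (intro equalityI subsetI)
    fix x assume "x \<in> coord c ` (dom_c c \<inter> U)"
    then obtain m where "m \<in> dom_c c" "m \<in> U" "x = coord c m" by blast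
    then show "x \<in> img_c c \<inter> param c -` U" by (simp add: param_coord coord_in_img)
  next
    fix x assume "x \<in> img_c c \<inter> param c -` U"
    then show "x \<in> coord c ` (dom_c c \<inter> U)"
      using coord_param[of x] param_in_dom[of x] by (intro image_eqI[of _ _ "param c x"]) auto
  qed
  then show ?thesis using continuous_open_preimage[OF continuous_param open_img assms] by simp
qed

lemma smooth_near_transition:
  assumes "d \<in> A" "m \<in> dom_c c" "m \<in> dom_c d" shows "smooth_near (transition c d) (coord c m)"
proof (rule smooth_on_imp_near[OF open_coord_image[OF _]])
  show "smooth_on (coord c ` (dom_c c \<inter> dom_c d)) (transition c d)"
    using atlas c assms(1) unfolding smooth_atlas_def by blast
  show "open (dom_c d)" using atlas assms(1) unfolding smooth_atlas_def by blast
qed (use assms in auto)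

lemma smooth_near_local_rep: "x \<in> img_c c \<Longrightarrow> smooth_near (local_rep F c) x"
  using isometric c smooth_on_imp_near[OF open_img] unfolding isometric_immersion_def by auto

lemma differential_has_derivative:
  "x \<in> img_c c \<Longrightarrow> (local_rep F c has_derivative differential F c x) (at x)"
  unfolding differential_def by (intro has_frechet_derivative smooth_near_differentiable smooth_near_local_rep)

lemma linear_differential: "x \<in> img_c c \<Longrightarrow> linear (differential F c x)"
  using has_derivative_linear[OF differential_has_derivative] .

lemma differential_inner:
  "x \<in> img_c c \<Longrightarrow> differential F c x Y \<bullet> differential F c x Z = metric_form g c x Y Z"
  using isometric c unfolding isometric_immersion_def by simp

lemma inj_differential: "x \<in> img_c c \<Longrightarrow> inj (differential F c x)"
  using isometric c unfolding isometric_immersion_def by simp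

lemma metric_symmetric: "x \<in> img_c c \<Longrightarrow> g c x $ i $ j = g c x $ j $ i"
proof -
  assume "x \<in> img_c c"
  then have "transpose (g c x) = g c x" using metric c unfolding riemannian_metric_def by blast
  then have "transpose (g c x) $ j $ i = g c x $ j $ i" by simp
  then show ?thesis by (simp add: transpose_def)
qed

lemma metric_positive: "x \<in> img_c c \<Longrightarrow> Z \<noteq> 0 \<Longrightarrow> 0 < metric_form g c x Z Z"
  using metric c unfolding riemannian_metric_def by auto

lemma smooth_near_metric: "x \<in> img_c c \<Longrightarrow> smooth_near (\<lambda>x. g c x $ i $ j) x"
proof -
  assume x: "x \<in> img_c c"
  have "smooth_near (g c) x"
    using metric c smooth_on_imp_near[OF open_img _ x] unfolding riemannian_metric_def by auto
  then have "smooth_near (\<lambda>x. axis i (axis j 1) \<bullet> g c x) x"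
    by (intro smooth_near_inner smooth_near_const)
  then show ?thesis by (simp add: inner_axis')
qed

lemma invertible_metric: "x \<in> img_c c \<Longrightarrow> invertible (g c x)"
proof -
  assume x: "x \<in> img_c c"
  have "inj ((*v) (g c x))"
  proof (rule linear_injective_0[THEN iffD2, OF matrix_vector_mul_linear], intro allI impI)
    fix Z assume "g c x *v Z = 0"
    then have "metric_form g c x Z Z = 0" by (simp add: metric_form_def)
    then show "Z = 0" using metric_positive[OF x, of Z] by force
  qed
  then show ?thesis using invertible_left_inverse matrix_left_invertible_injective by blast
qed

abbreviation "ginv x \<equiv> matrix_inv (g c x)"

lemma smooth_near_ginv: "x \<in> img_c c \<Longrightarrow> smooth_near (\<lambda>x. ginv x $ i $ j) x"
  using open_img invertible_metric
  by (intro smooth_near_inverse_matrix smooth_near_metric) (auto simp: eventually_nhds)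

lemma ginv_mult: "x \<in> img_c c \<Longrightarrow> (\<Sum>l\<in>UNIV. ginv x $ i $ l * g c x $ l $ j) = (if i = j then 1 else 0)"
proof -
  assume x: "x \<in> img_c c"
  have "(ginv x ** g c x) $ i $ j = mat 1 $ i $ j" by (simp only: matrix_inv_inverse(2)[OF invertible_metric[OF x]])
  then show ?thesis by (simp add: matrix_matrix_mult_def mat_def)
qed

lemma ginv_symmetric: "x \<in> img_c c \<Longrightarrow> ginv x $ i $ j = ginv x $ j $ i"
proof -
  assume x: "x \<in> img_c c"
  have sym: "transpose (g c x) = g c x" by (simp add: vec_eq_iff transpose_def metric_symmetric[OF x])
  note inv = matrix_inv_inverse[OF invertible_metric[OF x]]
  have "transpose (ginv x) ** g c x = transpose (g c x ** ginv x)"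
    by (simp only: matrix_transpose_mul sym)
  then have tg: "transpose (ginv x) ** g c x = mat 1" by (simp only: inv transpose_mat)
  have "transpose (ginv x) = transpose (ginv x) ** (g c x ** ginv x)" by (simp only: inv matrix_mul_rid)
  also have "\<dots> = ginv x" by (simp only: matrix_mul_assoc tg matrix_mul_lid)
  finally have "transpose (ginv x) $ j $ i = ginv x $ j $ i" by (rule arg_cong)
  then show ?thesis by (simp add: transpose_def)
qed

definition frame :: "real ^ 'n \<Rightarrow> 'n \<Rightarrow> real ^ 'd" where
  "frame x i = differential F c x (axis i 1)"

lemma frame_inner: "x \<in> img_c c \<Longrightarrow> frame x i \<bullet> frame x j = g c x $ i $ j"
  by (simp add: frame_def differential_inner metric_form_def inner_axis' matrix_vector_mult_basis column_def)

lemma differential_frame: "x \<in> img_c c \<Longrightarrow> differential F c x Z = (\<Sum>i\<in>UNIV. Z $ i *\<^sub>R frame x i)"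
proof -
  assume x: "x \<in> img_c c"
  note l = linear_differential[OF x]
  have "Z = (\<Sum>i\<in>UNIV. Z $ i *\<^sub>R axis i 1)"
    by (simp add: basis_expansion scalar_mult_eq_scaleR[symmetric])
  then have "differential F c x Z = differential F c x (\<Sum>i\<in>UNIV. Z $ i *\<^sub>R axis i 1)"
    by (rule arg_cong)
  also have "\<dots> = (\<Sum>i\<in>UNIV. Z $ i *\<^sub>R frame x i)"
    unfolding frame_def linear_sum[OF l] linear_scale[OF l] ..
  finally show ?thesis .
qed

lemma smooth_near_differential: "x \<in> img_c c \<Longrightarrow> smooth_near (\<lambda>x. differential F c x Z) x"
  unfolding differential_def by (intro smooth_near_frechet smooth_near_local_rep)

text \<open>Components in the chart of the tangential part of a vector of the ambient space.\<close>

definition tangent_components :: "real ^ 'd \<Rightarrow> real ^ 'n \<Rightarrow> real ^ 'n" where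
  "tangent_components v x = (\<chi> i. \<Sum>j\<in>UNIV. ginv x $ i $ j * (frame x j \<bullet> v))"

text \<open>This characterises the orthogonal projection to the tangent space.\<close>

lemma tangent_components_inner:
  assumes x: "x \<in> img_c c"
  shows "differential F c x (tangent_components v x) \<bullet> differential F c x Z = v \<bullet> differential F c x Z"
proof -
  have "differential F c x (tangent_components v x) \<bullet> frame x k = v \<bullet> frame x k" for k
  proof -
    have "differential F c x (tangent_components v x) \<bullet> frame x k
        = (\<Sum>i\<in>UNIV. \<Sum>j\<in>UNIV. ginv x $ i $ j * (frame x j \<bullet> v) * g c x $ i $ k)"
      by (simp add: differential_frame[OF x] tangent_components_def inner_sum_left frame_inner[OF x] sum_distrib_right)
    also have "\<dots> = (\<Sum>j\<in>UNIV. \<Sum>i\<in>UNIV. ginv x $ i $ j * (frame x j \<bullet> v) * g c x $ i $ k)"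
      by (rule sum.swap)
    also have "\<dots> = (\<Sum>j\<in>UNIV. (frame x j \<bullet> v) * (\<Sum>i\<in>UNIV. ginv x $ j $ i * g c x $ i $ k))"
      by (simp add: sum_distrib_left ginv_symmetric[OF x, of _ j for j] mult_ac)
    also have "\<dots> = v \<bullet> frame x k"
      by (simp add: ginv_mult[OF x] inner_commute if_distrib cong: if_cong)
    finally show ?thesis .
  qed
  then show ?thesis by (simp add: differential_frame[OF x, of Z] inner_sum_right)
qed

lemma smooth_near_tangent_components:
  assumes "x \<in> img_c c" "smooth_near Y x"
  shows "smooth_near (\<lambda>x. tangent_components (Y x) x) x"
  unfolding tangent_components_def frame_def
  by (intro smooth_near_vec_lambda smooth_near_sum smooth_near_mult smooth_near_inner
    smooth_near_ginv smooth_near_differential assms)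

end


text \<open>Smoothness is required in every chart at the point, so that it can be used in any of them. The lemma
  \<open>smooth_atI\<close> shows that one chart suffices.\<close>

definition smooth_at :: "(real \<Rightarrow> 'm \<Rightarrow> 'a::euclidean_space) \<Rightarrow> real \<Rightarrow> 'm \<Rightarrow> bool" where
  "smooth_at h s m \<longleftrightarrow> (\<forall>c\<in>A. m \<in> dom_c c \<longrightarrow>
     smooth_near (\<lambda>z. h (fst z) (param c (snd z))) (s, coord c m))"

lemma open_chart_preimage:
  assumes "c \<in> A" "open U"
  shows "open {z :: real \<times> (real ^ 'n). snd z \<in> img_c c \<and> (fst z, param c (snd z)) \<in> U}"
proof -
  have "continuous_on (UNIV \<times> img_c c) (\<lambda>z. (fst z :: real, param c (snd z)))"
    by (intro continuous_intros continuous_on_compose2[OF continuous_param[OF assms(1)]]) auto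
  then have "open ((UNIV \<times> img_c c) \<inter> (\<lambda>z. (fst z :: real, param c (snd z))) -` U)"
    by (rule continuous_open_preimage) (intro open_Times open_UNIV open_img assms)+
  moreover have "(UNIV \<times> img_c c) \<inter> (\<lambda>z. (fst z :: real, param c (snd z))) -` U
      = {z. snd z \<in> img_c c \<and> (fst z, param c (snd z)) \<in> U}" by auto
  ultimately show ?thesis by simp
qed

lemma smooth_atI:
  assumes c: "c \<in> A" "m \<in> dom_c c" and sm: "smooth_near (\<lambda>z. h (fst z) (param c (snd z))) (s, coord c m)"
  shows "smooth_at h s m"
  unfolding smooth_at_def
proof (intro ballI impI)
  fix d assume d: "d \<in> A" "m \<in> dom_c d"
  let ?f = "\<lambda>z. (fst z :: real, transition d c (snd z))"
  have fx: "?f (s, coord d m) = (s, coord c m)" using param_coord[OF d] by (simp add: transition_def)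
  have "smooth_near ?f (s, coord d m)"
    by (rule smooth_near_Pair[OF smooth_near_fst smooth_near_compose[OF _ smooth_near_snd]])
      (simp add: smooth_near_transition[OF d(1) c(1) d(2) c(2)])
  from smooth_near_compose[OF sm[folded fx] this]
  have "smooth_near (\<lambda>z. h (fst z) (param c (transition d c (snd z)))) (s, coord d m)" by simp
  then show "smooth_near (\<lambda>z. h (fst z) (param d (snd z))) (s, coord d m)"
  proof (rule smooth_near_cong_open[OF _ open_chart_preimage[OF d(1), of "UNIV \<times> dom_c c"]])
    show "open (UNIV \<times> dom_c c :: (real \<times> 'm) set)" by (intro open_Times open_UNIV open_dom c)
    show "(s, coord d m) \<in> {z. snd z \<in> img_c d \<and> (fst z, param d (snd z)) \<in> UNIV \<times> dom_c c}"
      using c d by (simp add: coord_in_img param_coord)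
  qed (auto simp: transition_def param_coord[OF c(1)])
qed

lemma smooth_at_cong_open:
  assumes "smooth_at h s m" "open U" "(s, m) \<in> U" "\<And>s m. (s, m) \<in> U \<Longrightarrow> h s m = h' s m"
  shows "smooth_at h' s m"
proof (rule smooth_atI[OF chart_at])
  let ?c = "chart_at A m"
  have "smooth_near (\<lambda>z. h (fst z) (param ?c (snd z))) (s, coord ?c m)"
    using assms(1) chart_at unfolding smooth_at_def by blast
  then show "smooth_near (\<lambda>z. h' (fst z) (param ?c (snd z))) (s, coord ?c m)"
    by (rule smooth_near_cong_open[OF _ open_chart_preimage[OF chart_at(1)[of m] assms(2)]])
      (use assms(3,4) in \<open>simp_all add: coord_in_img[OF chart_at] param_coord[OF chart_at]\<close>)
qed

text \<open>A smooth deformation of the identity of \<open>M\<close>, with parameter in \<open>(-\<epsilon>, \<epsilon>)\<close>.\<close>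

definition smooth_family :: "real \<Rightarrow> (real \<Rightarrow> 'm \<Rightarrow> 'm) \<Rightarrow> bool" where
  "smooth_family \<epsilon> \<psi> \<longleftrightarrow> 0 < \<epsilon> \<and> continuous_on ({-\<epsilon><..<\<epsilon>} \<times> UNIV) (\<lambda>z. \<psi> (fst z) (snd z)) \<and>
     (\<forall>m. \<psi> 0 m = m) \<and>
     (\<forall>s\<in>{-\<epsilon><..<\<epsilon>}. \<forall>m. \<forall>d\<in>A. \<psi> s m \<in> dom_c d \<longrightarrow> smooth_at (\<lambda>s m. coord d (\<psi> s m)) s m)"

lemma open_family_preimage:
  assumes "continuous_on ({-\<epsilon><..<\<epsilon>} \<times> UNIV) (\<lambda>z. \<psi> (fst z) (snd z) :: 'm)" "open V"
  shows "open {z :: real \<times> 'm. fst z \<in> {-\<epsilon><..<\<epsilon>} \<and> \<psi> (fst z) (snd z) \<in> V}"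
proof -
  have "open (({-\<epsilon><..<\<epsilon>} \<times> UNIV) \<inter> (\<lambda>z. \<psi> (fst z) (snd z)) -` V)"
    by (rule continuous_open_preimage[OF assms(1) _ assms(2)]) (intro open_Times open_UNIV open_greaterThanLessThan)
  moreover have "({-\<epsilon><..<\<epsilon>} \<times> UNIV) \<inter> (\<lambda>z. \<psi> (fst z) (snd z)) -` V
      = {z :: real \<times> 'm. fst z \<in> {-\<epsilon><..<\<epsilon>} \<and> \<psi> (fst z) (snd z) \<in> V}" by auto
  ultimately show ?thesis by simp
qed

text \<open>Composing with a smooth map is smooth as soon as one chart at the image point exhibits the inner
  map as smooth.\<close>

lemma smooth_at_compose:
  assumes cont: "continuous_on ({-\<epsilon><..<\<epsilon>} \<times> UNIV) (\<lambda>z. \<psi> (fst z) (snd z))" and s: "s \<in> {-\<epsilon><..<\<epsilon>}"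
    and d: "d \<in> A" "\<psi> s m \<in> dom_c d" "smooth_at (\<lambda>s m. coord d (\<psi> s m)) s m"
    and h: "smooth_at h s (\<psi> s m)"
  shows "smooth_at (\<lambda>s m. h s (\<psi> s m)) s m"
proof (rule smooth_atI[OF chart_at])
  let ?c = "chart_at A m"
  let ?K = "\<lambda>z. (fst z, coord d (\<psi> (fst z) (param ?c (snd z))))"
  have Kx: "?K (s, coord ?c m) = (s, coord d (\<psi> s m))" by (simp add: param_coord[OF chart_at])
  have "smooth_near (\<lambda>z. coord d (\<psi> (fst z) (param ?c (snd z)))) (s, coord ?c m)"
    using d(3) chart_at unfolding smooth_at_def by blast
  then have K: "smooth_near ?K (s, coord ?c m)" by (rule smooth_near_Pair[OF smooth_near_fst])
  have "smooth_near (\<lambda>z. h (fst z) (param d (snd z))) (s, coord d (\<psi> s m))"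
    using h d(1,2) unfolding smooth_at_def by blast
  from smooth_near_compose[OF this[folded Kx] K]
  have "smooth_near (\<lambda>z. h (fst z) (param d (coord d (\<psi> (fst z) (param ?c (snd z)))))) (s, coord ?c m)"
    by simp
  then show "smooth_near (\<lambda>z. h (fst z) (\<psi> (fst z) (param ?c (snd z)))) (s, coord ?c m)"
    by (rule smooth_near_cong_open[OF _ open_chart_preimage[OF chart_at(1)[of m] open_family_preimage[OF cont open_dom[OF d(1)]]]])
      (use s d(2) in \<open>auto simp: coord_in_img[OF chart_at] param_coord[OF chart_at] param_coord[OF d(1)]\<close>)
qed

lemma smooth_at_coord:
  assumes "d \<in> A" "m \<in> dom_c d" shows "smooth_at (\<lambda>s. coord d) s m"
proof (rule smooth_atI[OF assms])
  show "smooth_near (\<lambda>z. coord d (param d (snd z))) (s, coord d m)"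
    by (rule smooth_near_cong_open[OF smooth_near_snd open_chart_preimage[OF assms(1) open_UNIV]])
      (use assms in \<open>simp_all add: coord_in_img coord_param\<close>)
qed

lemma smooth_familyI:
  assumes "0 < \<epsilon>" and cont: "continuous_on ({-\<epsilon><..<\<epsilon>} \<times> UNIV) (\<lambda>z. \<psi> (fst z) (snd z))" and "\<And>m. \<psi> 0 m = m"
    and one: "\<And>s m. s \<in> {-\<epsilon><..<\<epsilon>} \<Longrightarrow> \<exists>d\<in>A. \<psi> s m \<in> dom_c d \<and> smooth_at (\<lambda>s m. coord d (\<psi> s m)) s m"
  shows "smooth_family \<epsilon> \<psi>"
  unfolding smooth_family_def
proof (intro conjI allI ballI impI assms(1-3))
  fix s m d assume s: "s \<in> {-\<epsilon><..<\<epsilon>}" and d: "d \<in> A" "\<psi> s m \<in> dom_c d"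
  obtain d' where d': "d' \<in> A" "\<psi> s m \<in> dom_c d'" "smooth_at (\<lambda>s m. coord d' (\<psi> s m)) s m"
    using one[OF s, of m] by (elim bexE conjE) (rule that)
  show "smooth_at (\<lambda>s m. coord d (\<psi> s m)) s m"
    by (rule smooth_at_compose[OF cont s d' smooth_at_coord[OF d]])
qed

lemma smooth_family_eps: "smooth_family \<epsilon> \<psi> \<Longrightarrow> 0 < \<epsilon>"
  and smooth_family_continuous: "smooth_family \<epsilon> \<psi> \<Longrightarrow> continuous_on ({-\<epsilon><..<\<epsilon>} \<times> UNIV) (\<lambda>z. \<psi> (fst z) (snd z))"
  and smooth_family_0: "smooth_family \<epsilon> \<psi> \<Longrightarrow> \<psi> 0 m = m"
  and smooth_family_smooth: "smooth_family \<epsilon> \<psi> \<Longrightarrow> s \<in> {-\<epsilon><..<\<epsilon>} \<Longrightarrow> d \<in> A \<Longrightarrow> \<psi> s m \<in> dom_c d \<Longrightarrow>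
    smooth_at (\<lambda>s m. coord d (\<psi> s m)) s m"
  unfolding smooth_family_def by blast+

lemma smooth_family_apply:
  assumes "smooth_family \<epsilon> \<psi>" "s \<in> {-\<epsilon><..<\<epsilon>}" "smooth_at h s (\<psi> s m)"
  shows "smooth_at (\<lambda>s m. h s (\<psi> s m)) s m"
  by (rule smooth_at_compose[OF smooth_family_continuous[OF assms(1)] assms(2) chart_at(1) chart_at(2)
    smooth_family_smooth[OF assms(1,2) chart_at(1) chart_at(2)] assms(3)])

lemma smooth_family_compose:
  assumes \<psi>: "smooth_family \<epsilon> \<psi>" and \<phi>: "smooth_family \<epsilon>' \<phi>"
  shows "smooth_family (min \<epsilon> \<epsilon>') (\<lambda>s m. \<phi> s (\<psi> s m))"
proof (rule smooth_familyI)
  let ?e = "min \<epsilon> \<epsilon>'"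
  show "0 < ?e" using smooth_family_eps[OF \<psi>] smooth_family_eps[OF \<phi>] by simp
  have c\<psi>: "continuous_on ({-?e<..<?e} \<times> UNIV) (\<lambda>z. \<psi> (fst z) (snd z))"
    by (rule continuous_on_subset[OF smooth_family_continuous[OF \<psi>]]) auto
  have pair: "continuous_on ({-?e<..<?e} \<times> UNIV) (\<lambda>z. (fst z, \<psi> (fst z) (snd z)))"
    by (rule continuous_on_Pair[OF continuous_on_fst[OF continuous_on_id] c\<psi>])
  have "(\<lambda>z. (fst z, \<psi> (fst z) (snd z))) ` ({-?e<..<?e} \<times> UNIV) \<subseteq> {-\<epsilon>'<..<\<epsilon>'} \<times> UNIV" by auto
  from continuous_on_compose2[OF smooth_family_continuous[OF \<phi>] pair this]
  show "continuous_on ({-?e<..<?e} \<times> UNIV) (\<lambda>z. \<phi> (fst z) (\<psi> (fst z) (snd z)))" by simp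
  show "\<phi> 0 (\<psi> 0 m) = m" for m by (simp add: smooth_family_0[OF \<psi>] smooth_family_0[OF \<phi>])
  fix s m assume s: "s \<in> {-?e<..<?e}"
  let ?d = "chart_at A (\<phi> s (\<psi> s m))"
  have "smooth_at (\<lambda>s m. coord ?d (\<phi> s (\<psi> s m))) s m"
    by (rule smooth_family_apply[OF \<psi> _ smooth_family_smooth[OF \<phi> _ chart_at(1) chart_at(2)]]) (use s in auto)
  then show "\<exists>d\<in>A. \<phi> s (\<psi> s m) \<in> dom_c d \<and> smooth_at (\<lambda>s m. coord d (\<phi> s (\<psi> s m))) s m"
    using chart_at[of "\<phi> s (\<psi> s m)"] by (intro bexI[of _ ?d] conjI)
qed

lemma smooth_at_F: "smooth_at (\<lambda>s. F) s m"
proof (rule smooth_atI[OF chart_at])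
  let ?c = "chart_at A m"
  have "smooth_near (\<lambda>z. local_rep F ?c (snd z)) (s, coord ?c m)"
    by (rule smooth_near_compose[OF _ smooth_near_snd])
      (simp add: smooth_near_local_rep[OF chart_at(1) coord_in_img[OF chart_at]])
  then show "smooth_near (\<lambda>z. F (param ?c (snd z))) (s, coord ?c m)" by (simp add: local_rep_def)
qed

lemma smooth_at_F_family:
  "smooth_family \<epsilon> \<psi> \<Longrightarrow> s \<in> {-\<epsilon><..<\<epsilon>} \<Longrightarrow> smooth_at (\<lambda>s m. F (\<psi> s m)) s m"
  by (rule smooth_family_apply[OF _ _ smooth_at_F])

lemma smooth_at_has_derivative:
  fixes h :: "real \<Rightarrow> 'm \<Rightarrow> 'a::euclidean_space"
  assumes "smooth_at h s m"
  shows "((\<lambda>s. h s m) has_vector_derivative vector_derivative (\<lambda>s. h s m) (at s)) (at s)"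
proof -
  let ?c = "chart_at A m"
  have "smooth_near (\<lambda>z. h (fst z) (param ?c (snd z))) (s, coord ?c m)"
    using assms chart_at unfolding smooth_at_def by blast
  from has_vector_derivative_par[OF smooth_near_differentiable[OF this]]
  show ?thesis by (simp add: param_coord[OF chart_at] vector_derivative_at)
qed

lemma smooth_at_par:
  fixes h :: "real \<Rightarrow> 'm \<Rightarrow> 'a::euclidean_space"
  assumes "smooth_at h s m"
  shows "smooth_at (\<lambda>s m. vector_derivative (\<lambda>s. h s m) (at s)) s m"
proof (rule smooth_atI[OF chart_at])
  let ?c = "chart_at A m"
  let ?H = "\<lambda>z. h (fst z) (param ?c (snd z))"
  have H: "smooth_near ?H (s, coord ?c m)" using assms chart_at unfolding smooth_at_def by blast
  show "smooth_near (\<lambda>z. vector_derivative (\<lambda>s. h s (param ?c (snd z))) (at (fst z))) (s, coord ?c m)"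
  proof (rule smooth_near_cong[OF smooth_near_frechet[OF H, of "(1, 0)"]])
    show "\<forall>\<^sub>F z in nhds (s, coord ?c m). d_par ?H z = vector_derivative (\<lambda>s. h s (param ?c (snd z))) (at (fst z))"
      using smooth_near_eventually[OF H]
    proof (rule eventually_mono)
      fix z assume "smooth_near ?H z"
      then have "?H differentiable (at (fst z, snd z))" by (simp add: smooth_near_differentiable)
      from has_vector_derivative_par[OF this]
      show "d_par ?H z = vector_derivative (\<lambda>s. h s (param ?c (snd z))) (at (fst z))"
        by (simp add: vector_derivative_at)
    qed
  qed
qed

definition smooth_fun :: "('m \<Rightarrow> 'a::euclidean_space) \<Rightarrow> bool" where
  "smooth_fun Y \<longleftrightarrow> (\<forall>c\<in>A. \<forall>x\<in>img_c c. smooth_near (\<lambda>x. Y (param c x)) x)"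

lemma smooth_at_imp_smooth_fun:
  assumes "\<And>m. smooth_at h s m" shows "smooth_fun (h s)"
  unfolding smooth_fun_def
proof (intro ballI)
  fix c x assume c: "c \<in> A" and x: "x \<in> img_c c"
  have "smooth_near (\<lambda>z. h (fst z) (param c (snd z))) (s, x)"
    using assms[unfolded smooth_at_def, rule_format, OF c param_in_dom[OF c x]]
    by (simp add: coord_param[OF c x])
  from smooth_near_compose[OF this smooth_near_Pair[OF smooth_near_const smooth_near_ident]]
  show "smooth_near (\<lambda>x. h s (param c x)) x" by simp
qed

lemma smooth_fun_chartI:
  assumes "\<And>m. \<exists>c\<in>A. m \<in> dom_c c \<and> smooth_near (\<lambda>x. Y (param c x)) (coord c m)"
  shows "smooth_fun Y"
proof (rule smooth_at_imp_smooth_fun[where s = 0])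
  fix m
  obtain c where c: "c \<in> A" "m \<in> dom_c c" "smooth_near (\<lambda>x. Y (param c x)) (coord c m)"
    using assms[of m] by (elim bexE conjE) (rule that)
  have "smooth_near (\<lambda>z. Y (param c (snd z))) (0, coord c m)"
    by (rule smooth_near_compose[OF _ smooth_near_snd]) (simp add: c(3))
  then show "smooth_at (\<lambda>_. Y) 0 m" by (rule smooth_atI[OF c(1,2)])
qed


section \<open>Tangent spaces and realisable vector fields\<close>

definition tangent_space :: "'m \<Rightarrow> (real ^ 'd) set" where
  "tangent_space m = range (differential F (chart_at A m) (coord (chart_at A m) m))"

text \<open>The image of the differential is the same subspace in all charts, by the chain rule for the transition
  map.\<close>

lemma differential_change_chart:
  assumes c: "c \<in> A" "m \<in> dom_c c" and d: "d \<in> A" "m \<in> dom_c d"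
  shows "range (differential F c (coord c m)) \<subseteq> range (differential F d (coord d m))"
proof -
  let ?T = "frechet_derivative (transition c d) (at (coord c m))"
  have t: "transition c d (coord c m) = coord d m" by (simp add: transition_def param_coord[OF c])
  have "(transition c d has_derivative ?T) (at (coord c m))"
    by (rule has_frechet_derivative[OF smooth_near_differentiable[OF smooth_near_transition[OF c(1) d(1) c(2) d(2)]]])
  moreover have "(local_rep F d has_derivative differential F d (coord d m)) (at (transition c d (coord c m)))"
    unfolding t by (rule differential_has_derivative[OF d(1) coord_in_img[OF d]])
  ultimately have "((\<lambda>x. local_rep F d (transition c d x)) has_derivative (\<lambda>v. differential F d (coord d m) (?T v)))
      (at (coord c m))" by (rule has_derivative_compose)
  then have "(local_rep F c has_derivative (\<lambda>v. differential F d (coord d m) (?T v))) (at (coord c m))"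
  proof (rule has_derivative_transform_within_open[OF _ open_coord_image[OF c(1) open_dom[OF d(1)]]])
    show "coord c m \<in> coord c ` (dom_c c \<inter> dom_c d)" using c d by blast
    fix x assume "x \<in> coord c ` (dom_c c \<inter> dom_c d)"
    then show "local_rep F d (transition c d x) = local_rep F c x"
      by (auto simp: local_rep_def transition_def param_coord[OF c(1)] param_coord[OF d(1)])
  qed
  then have "differential F c (coord c m) = (\<lambda>v. differential F d (coord d m) (?T v))"
    using differential_has_derivative[OF c(1) coord_in_img[OF c]] has_derivative_unique by blast
  then show ?thesis by auto
qed

lemma tangent_space_chart:
  assumes "c \<in> A" "m \<in> dom_c c" shows "tangent_space m = range (differential F c (coord c m))"
  unfolding tangent_space_def
  by (intro equalityI differential_change_chart assms chart_at)

lemma subspace_tangent_space: "subspace (tangent_space m)"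
  unfolding tangent_space_def
  by (rule linear_subspace_image[OF linear_differential[OF chart_at(1) coord_in_img[OF chart_at]] subspace_UNIV])

text \<open>A relation instead of a projection operator, because it can be checked in any chart.\<close>

definition is_tangential_part :: "'m \<Rightarrow> real ^ 'd \<Rightarrow> real ^ 'd \<Rightarrow> bool" where
  "is_tangential_part m v w \<longleftrightarrow> w \<in> tangent_space m \<and> (\<forall>u\<in>tangent_space m. w \<bullet> u = v \<bullet> u)"

lemma is_tangential_part_unique:
  assumes "is_tangential_part m v w" "is_tangential_part m v w'" shows "w = w'"
proof -
  have "w - w' \<in> tangent_space m"
    using assms subspace_diff[OF subspace_tangent_space] unfolding is_tangential_part_def by simp
  then have "(w - w') \<bullet> (w - w') = 0"
    using assms unfolding is_tangential_part_def by (simp add: inner_diff_left)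
  then show ?thesis by simp
qed

lemma is_tangential_part_add:
  "is_tangential_part m v w \<Longrightarrow> is_tangential_part m v' w' \<Longrightarrow> is_tangential_part m (v + v') (w + w')"
  unfolding is_tangential_part_def using subspace_add[OF subspace_tangent_space] by (simp add: inner_add_left)

lemma is_tangential_part_0: "is_tangential_part m 0 0"
  unfolding is_tangential_part_def using subspace_0[OF subspace_tangent_space] by simp

lemma is_tangential_part_components:
  assumes "c \<in> A" "m \<in> dom_c c"
  shows "is_tangential_part m v (differential F c (coord c m) (tangent_components c v (coord c m)))"
  unfolding is_tangential_part_def tangent_space_chart[OF assms]
  by (auto simp: tangent_components_inner[OF assms(1) coord_in_img[OF assms]])

lemma family_stays_in_chart:
  assumes \<psi>: "smooth_family \<epsilon> \<psi>" and c: "c \<in> A" "m \<in> dom_c c"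
  shows "\<forall>\<^sub>F s in nhds 0. s \<in> {-\<epsilon><..<\<epsilon>} \<and> \<psi> s m \<in> dom_c c"
proof -
  have pair: "continuous_on {-\<epsilon><..<\<epsilon>} (\<lambda>s. (s, m))"
    by (rule continuous_on_Pair[OF continuous_on_id continuous_on_const])
  have "(\<lambda>s. (s, m)) ` {-\<epsilon><..<\<epsilon>} \<subseteq> {-\<epsilon><..<\<epsilon>} \<times> UNIV" by auto
  from continuous_on_compose2[OF smooth_family_continuous[OF \<psi>] pair this]
  have "continuous_on {-\<epsilon><..<\<epsilon>} (\<lambda>s. \<psi> s m)" by simp
  then have "open ({-\<epsilon><..<\<epsilon>} \<inter> (\<lambda>s. \<psi> s m) -` dom_c c)"
    by (rule continuous_open_preimage[OF _ open_greaterThanLessThan open_dom[OF c(1)]])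
  moreover have "0 \<in> {-\<epsilon><..<\<epsilon>} \<inter> (\<lambda>s. \<psi> s m) -` dom_c c"
    using smooth_family_eps[OF \<psi>] smooth_family_0[OF \<psi>] c by simp
  ultimately show ?thesis unfolding eventually_nhds
    by (intro exI[of _ "{-\<epsilon><..<\<epsilon>} \<inter> (\<lambda>s. \<psi> s m) -` dom_c c"]) auto
qed

definition realises :: "(real \<Rightarrow> 'm \<Rightarrow> 'm) \<Rightarrow> 'm \<Rightarrow> real ^ 'd \<Rightarrow> bool" where
  "realises \<psi> m v \<longleftrightarrow> (\<exists>w. ((\<lambda>s. F (\<psi> s m)) has_vector_derivative w) (at 0) \<and> is_tangential_part m v w)"

text \<open>Both maps are the identity at \<open>s = 0\<close>, so by the chain rule the initial velocities of a composition add up.\<close>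

lemma realises_compose:
  assumes \<psi>: "smooth_family \<epsilon> \<psi>" "realises \<psi> m v" and \<phi>: "smooth_family \<epsilon>' \<phi>" "realises \<phi> m v'"
  shows "realises (\<lambda>s m. \<phi> s (\<psi> s m)) m (v + v')"
proof -
  let ?c = "chart_at A m"
  let ?x = "coord ?c m" and ?y = "\<lambda>s. coord ?c (\<psi> s m)" and ?H = "\<lambda>z. F (\<phi> (fst z) (param ?c (snd z)))"
  have e: "0 < \<epsilon>" "0 < \<epsilon>'" by (rule smooth_family_eps[OF \<psi>(1)], rule smooth_family_eps[OF \<phi>(1)])
  have m0: "\<psi> 0 m = m" "\<phi> 0 p = p" for p using smooth_family_0 \<psi> \<phi> by auto
  obtain w w' where w: "((\<lambda>s. F (\<psi> s m)) has_vector_derivative w) (at 0)" "is_tangential_part m v w"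
    and w': "((\<lambda>s. F (\<phi> s m)) has_vector_derivative w') (at 0)" "is_tangential_part m v' w'"
    using \<psi>(2) \<phi>(2) unfolding realises_def by blast
  have H: "smooth_near ?H (0, ?x)"
    using smooth_at_F_family[OF \<phi>(1), of 0 m] chart_at[of m] e unfolding smooth_at_def by simp
  have dH: "(?H has_derivative frechet_derivative ?H (at (0, ?x))) (at (0, ?x))"
    by (rule has_frechet_derivative[OF smooth_near_differentiable[OF H]])
  let ?D = "frechet_derivative ?H (at (0, ?x))"
  have l: "linear ?D" by (rule has_derivative_linear[OF dH])
  have "smooth_at (\<lambda>s m. coord ?c (\<psi> s m)) 0 m"
    by (rule smooth_family_smooth[OF \<psi>(1)]) (use e chart_at[of m] m0 in auto)
  from smooth_at_has_derivative[OF this]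
  obtain y' where y': "(?y has_vector_derivative y') (at 0)" by blast
  obtain S where S: "open S" "0 \<in> S" "\<And>s. s \<in> S \<Longrightarrow> \<psi> s m \<in> dom_c ?c"
    using family_stays_in_chart[OF \<psi>(1) chart_at[of m]] unfolding eventually_nhds by blast
  have dH0: "(?H has_derivative ?D) (at (0, ?y 0))" by (simp only: m0 dH)
  have 1: "((\<lambda>s. ?H (s, ?y s)) has_vector_derivative ?D (1, y')) (at 0)"
    by (rule has_vector_derivative_chain[where h = ?H and D = ?D,
      OF has_vector_derivative_Pair[OF has_vector_derivative_id y'] dH0])
  have 2: "((\<lambda>s. ?H (0, ?y s)) has_vector_derivative ?D (0, y')) (at 0)"
    by (rule has_vector_derivative_chain[where h = ?H and D = ?D,
      OF has_vector_derivative_Pair[OF has_vector_derivative_const y'] dH0])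
  have "((\<lambda>s. F (\<psi> s m)) has_vector_derivative ?D (0, y')) (at 0)"
    by (rule has_vector_derivative_transform_within_open[OF 2 S(1,2)]) (simp add: m0 param_coord[OF chart_at(1) S(3)])
  then have Dw: "?D (0, y') = w" using w(1) vector_derivative_unique_at by blast
  have "((\<lambda>s. F (\<phi> s m)) has_vector_derivative ?D (1, 0)) (at 0)"
    using has_vector_derivative_par[OF smooth_near_differentiable[OF H]] by (simp add: param_coord[OF chart_at])
  then have Dw': "?D (1, 0) = w'" using w'(1) vector_derivative_unique_at by blast
  have "?D (1, y') = ?D ((0, y') + (1, 0))" by simp
  then have D: "?D (1, y') = w + w'" unfolding linear_add[OF l] Dw Dw' .
  have "((\<lambda>s. F (\<phi> s (\<psi> s m))) has_vector_derivative w + w') (at 0)"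
    by (rule has_vector_derivative_transform_within_open[OF 1[unfolded D] S(1,2)]) (simp add: param_coord[OF chart_at(1) S(3)])
  then show ?thesis unfolding realises_def using is_tangential_part_add[OF w(2) w'(2)] by blast
qed

definition realisable :: "('m \<Rightarrow> real ^ 'd) \<Rightarrow> bool" where
  "realisable Y \<longleftrightarrow> (\<exists>\<epsilon> \<psi>. smooth_family \<epsilon> \<psi> \<and> (\<forall>m. realises \<psi> m (Y m)))"

lemma realisable_add:
  assumes "realisable Y" "realisable Z" shows "realisable (\<lambda>m. Y m + Z m)"
proof -
  obtain \<epsilon> \<psi> \<epsilon>' \<phi> where a: "smooth_family \<epsilon> \<psi>" "\<And>m. realises \<psi> m (Y m)"
    and b: "smooth_family \<epsilon>' \<phi>" "\<And>m. realises \<phi> m (Z m)"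
    using assms unfolding realisable_def by blast
  show ?thesis unfolding realisable_def
    using smooth_family_compose[OF a(1) b(1)] realises_compose[OF a b] by (intro exI conjI allI)
qed

lemma realisable_0: "realisable (\<lambda>m. 0)"
  unfolding realisable_def
proof (intro exI conjI allI)
  show "smooth_family 1 (\<lambda>s m. m)"
  proof (rule smooth_familyI)
    fix s m
    show "\<exists>d\<in>A. m \<in> dom_c d \<and> smooth_at (\<lambda>s m. coord d m) s m"
      using chart_at[of m] smooth_at_coord[of "chart_at A m" m s] by (intro bexI[of _ "chart_at A m"] conjI)
  qed (auto intro: continuous_on_snd continuous_on_id)
  show "realises (\<lambda>s m. m) m 0" for m
    unfolding realises_def using is_tangential_part_0 has_vector_derivative_const by blast
qed


lemma tangent_components_0: "c \<in> A \<Longrightarrow> tangent_components c 0 x = 0"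
  by (simp add: tangent_components_def vec_eq_iff)

lemma closed_param_image:
  assumes "c \<in> A" "compact C" "C \<subseteq> img_c c" shows "closed (param c ` C)"
  by (rule compact_imp_closed[OF compact_continuous_image[OF continuous_on_subset[OF continuous_param[OF assms(1)] assms(3)] assms(2)]])

text \<open>In the chart the deformation is \<open>x + s X x\<close>, where \<open>X\<close> is the tangential part of \<open>Y\<close> in components; elsewhere it is
  the identity. As \<open>X\<close> has compact support in the chart, \<open>x + s X x\<close> stays in the chart for small \<open>s\<close>.\<close>

lemma realisable_in_chart:
  assumes c: "c \<in> A" and Y: "smooth_fun Y" and C: "compact C" "C \<subseteq> img_c c"
    and supp: "\<And>m. m \<notin> param c ` C \<Longrightarrow> Y m = 0"
  shows "realisable Y"
proof -
  define X where "X x = tangent_components c (Y (param c x)) x" for x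
  have smX: "smooth_near X x" if "x \<in> img_c c" for x
  proof -
    have "smooth_near (\<lambda>x. Y (param c x)) x" using Y c that unfolding smooth_fun_def by blast
    from smooth_near_tangent_components[OF c that this] show ?thesis unfolding X_def[abs_def] .
  qed
  have X0: "X x = 0" if "x \<in> img_c c" "x \<notin> C" for x
  proof -
    have "param c x \<notin> param c ` C"
    proof
      assume "param c x \<in> param c ` C"
      then obtain y where y: "y \<in> C" "param c x = param c y" by blast
      then have "coord c (param c x) = coord c (param c y)" by simp
      then have "x = y" using coord_param[OF c] that(1) y(1) C(2) by auto
      then show False using y that by simp
    qed
    then show ?thesis by (simp add: X_def supp tangent_components_0[OF c])
  qed
  obtain \<delta> where \<delta>: "0 < \<delta>" "(\<Union>x\<in>C. ball x \<delta>) \<subseteq> img_c c"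
    by (rule compact_subset_open_imp_ball_epsilon_subset[OF C(1) open_img[OF c] C(2)])
  have contX: "continuous_on (img_c c) X"
    by (rule continuous_at_imp_continuous_on) (simp add: smX smooth_near_imp_continuous)
  obtain b where b: "0 < b" "\<And>x. x \<in> C \<Longrightarrow> norm (X x) \<le> b"
    using compact_imp_bounded[OF compact_continuous_image[OF continuous_on_subset[OF contX C(2)] C(1)]]
    unfolding bounded_pos by auto
  define \<epsilon> where "\<epsilon> = \<delta> / b"
  have \<epsilon>: "0 < \<epsilon>" using \<delta>(1) b(1) by (simp add: \<epsilon>_def)
  have stay: "x + s *\<^sub>R X x \<in> img_c c" if "x \<in> img_c c" "s \<in> {-\<epsilon><..<\<epsilon>}" for x s
  proof (cases "x \<in> C")
    case True
    have "norm (s *\<^sub>R X x) \<le> \<bar>s\<bar> * b" using b(2)[OF True] by (simp add: mult_left_mono)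
    also have "\<dots> < \<epsilon> * b" using that(2) b(1) by (intro mult_strict_right_mono) auto
    also have "\<dots> = \<delta>" using b(1) by (simp add: \<epsilon>_def)
    finally have "x + s *\<^sub>R X x \<in> ball x \<delta>" by (simp add: dist_norm)
    then show ?thesis using \<delta>(2) True by blast
  qed (use X0 that in auto)
  define \<psi> where "\<psi> s m = (if m \<in> dom_c c then param c (coord c m + s *\<^sub>R X (coord c m)) else m)" for s m
  have \<psi>_dom: "\<psi> s m \<in> dom_c c" if "m \<in> dom_c c" "s \<in> {-\<epsilon><..<\<epsilon>}" for s m
    using that by (simp add: \<psi>_def param_in_dom[OF c stay[OF coord_in_img[OF c that(1)]]])
  have \<psi>_id: "\<psi> s m = m" if "m \<notin> param c ` C" for s m
  proof (cases "m \<in> dom_c c")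
    case True
    have "coord c m \<notin> C"
    proof
      assume "coord c m \<in> C"
      then have "param c (coord c m) \<in> param c ` C" by blast
      then show False using that by (simp add: param_coord[OF c True])
    qed
    then show ?thesis using True by (simp add: \<psi>_def X0 coord_in_img[OF c True] param_coord[OF c True])
  qed (simp add: \<psi>_def)
  have KC: "closed (param c ` C)" by (rule closed_param_image[OF c C])
  have KD: "param c ` C \<subseteq> dom_c c" using C(2) param_in_dom[OF c] by blast
  have cont: "continuous_on ({-\<epsilon><..<\<epsilon>} \<times> UNIV) (\<lambda>z. \<psi> (fst z) (snd z))"
  proof -
    have "continuous_on ({-\<epsilon><..<\<epsilon>} \<times> dom_c c) (\<lambda>z. \<psi> (fst z) (snd z))"
    proof -
      have cc: "continuous_on ({-\<epsilon><..<\<epsilon>} \<times> dom_c c) (\<lambda>z. coord c (snd z))"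
        by (rule continuous_on_compose2[OF continuous_coord[OF c] continuous_on_snd[OF continuous_on_id]]) auto
      have "continuous_on ({-\<epsilon><..<\<epsilon>} \<times> dom_c c) (\<lambda>z. X (coord c (snd z)))"
        by (rule continuous_on_compose2[OF contX cc]) (auto simp: coord_in_img[OF c])
      then have "continuous_on ({-\<epsilon><..<\<epsilon>} \<times> dom_c c) (\<lambda>z. coord c (snd z) + fst z *\<^sub>R X (coord c (snd z)))"
        by (intro continuous_on_add continuous_on_scaleR cc continuous_on_fst continuous_on_id)
      then have "continuous_on ({-\<epsilon><..<\<epsilon>} \<times> dom_c c) (\<lambda>z. param c (coord c (snd z) + fst z *\<^sub>R X (coord c (snd z))))"
        by (rule continuous_on_compose2[OF continuous_param[OF c]])
          (auto intro: stay[OF coord_in_img[OF c]])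
      then show ?thesis by (rule continuous_on_eq) (auto simp: \<psi>_def)
    qed
    moreover have "continuous_on ({-\<epsilon><..<\<epsilon>} \<times> (- param c ` C)) (\<lambda>z. \<psi> (fst z) (snd z))"
      by (rule continuous_on_eq[OF continuous_on_snd[OF continuous_on_id]]) (auto simp: \<psi>_id)
    ultimately have "continuous_on (({-\<epsilon><..<\<epsilon>} \<times> dom_c c) \<union> ({-\<epsilon><..<\<epsilon>} \<times> (- param c ` C))) (\<lambda>z. \<psi> (fst z) (snd z))"
      by (intro continuous_on_open_Un open_Times open_greaterThanLessThan open_dom[OF c] open_Compl KC)
    moreover have "({-\<epsilon><..<\<epsilon>} \<times> dom_c c) \<union> ({-\<epsilon><..<\<epsilon>} \<times> (- param c ` C)) = {-\<epsilon><..<\<epsilon>} \<times> UNIV"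
      using KD by blast
    ultimately show ?thesis by simp
  qed
  have fam: "smooth_family \<epsilon> \<psi>"
  proof (rule smooth_familyI[OF \<epsilon> cont])
    show "\<psi> 0 m = m" for m by (simp add: \<psi>_def param_coord[OF c])
    fix s m assume s: "s \<in> {-\<epsilon><..<\<epsilon>}"
    show "\<exists>d\<in>A. \<psi> s m \<in> dom_c d \<and> smooth_at (\<lambda>s m. coord d (\<psi> s m)) s m"
    proof (cases "m \<in> dom_c c")
      case True
      have "smooth_near (\<lambda>z. snd z + fst z *\<^sub>R X (snd z)) (s, coord c m)"
        by (intro smooth_near_add smooth_near_snd smooth_near_scaleR smooth_near_fst
          smooth_near_compose[OF _ smooth_near_snd]) (simp add: smX coord_in_img[OF c True])
      then have "smooth_near (\<lambda>z. coord c (\<psi> (fst z) (param c (snd z)))) (s, coord c m)"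
      proof (rule smooth_near_cong_open)
        show "open ({-\<epsilon><..<\<epsilon>} \<times> img_c c)" by (intro open_Times open_greaterThanLessThan open_img[OF c])
        show "(s, coord c m) \<in> {-\<epsilon><..<\<epsilon>} \<times> img_c c" using s coord_in_img[OF c True] by simp
        fix z assume "z \<in> {-\<epsilon><..<\<epsilon>} \<times> img_c c"
        then have z: "fst z \<in> {-\<epsilon><..<\<epsilon>}" "snd z \<in> img_c c" by auto
        show "snd z + fst z *\<^sub>R X (snd z) = coord c (\<psi> (fst z) (param c (snd z)))"
          unfolding \<psi>_def by (simp add: param_in_dom[OF c z(2)] coord_param[OF c z(2)] coord_param[OF c stay[OF z(2,1)]])
      qed
      then have "smooth_at (\<lambda>s m. coord c (\<psi> s m)) s m" by (rule smooth_atI[OF c True])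
      then show ?thesis using \<psi>_dom[OF True s] c by (intro bexI[of _ c] conjI)
    next
      case False
      let ?d = "chart_at A m"
      have m: "m \<notin> param c ` C" using False KD by blast
      have "smooth_at (\<lambda>s m. coord ?d (\<psi> s m)) s m"
        by (rule smooth_at_cong_open[OF smooth_at_coord[OF chart_at], where U = "UNIV \<times> (- param c ` C)"])
          (use m in \<open>auto intro!: open_Times KC simp: \<psi>_id\<close>)
      then show ?thesis using chart_at[of m] by (intro bexI[of _ ?d] conjI) (simp_all add: \<psi>_id[OF m])
    qed
  qed
  have "realises \<psi> m (Y m)" for m
  proof (cases "m \<in> dom_c c")
    case True
    let ?x = "coord c m"
    note x = coord_in_img[OF c True]
    have "((\<lambda>s. ?x + s *\<^sub>R X ?x) has_vector_derivative X ?x) (at 0)"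
      unfolding has_vector_derivative_def by (auto intro!: derivative_eq_intros)
    then have "((\<lambda>s. local_rep F c (?x + s *\<^sub>R X ?x)) has_vector_derivative differential F c ?x (X ?x)) (at 0)"
      by (rule has_vector_derivative_chain) (simp add: differential_has_derivative[OF c x])
    then have "((\<lambda>s. F (\<psi> s m)) has_vector_derivative differential F c ?x (X ?x)) (at 0)"
      by (simp add: \<psi>_def True local_rep_def)
    moreover have "is_tangential_part m (Y m) (differential F c ?x (X ?x))"
      using is_tangential_part_components[OF c True, of "Y m"] by (simp add: X_def param_coord[OF c True])
    ultimately show ?thesis unfolding realises_def by blast
  next
    case False
    then have "m \<notin> param c ` C" using KD by blast
    then have "\<psi> s m = m" "Y m = 0" for s by (simp_all add: \<psi>_id supp)
    then show ?thesis unfolding realises_def using is_tangential_part_0[of m] has_vector_derivative_const[of "F m" "at 0"]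
      by (intro exI[of _ 0]) simp
  qed
  then show ?thesis unfolding realisable_def using fam by blast
qed

definition bump :: "('m, 'n) chart \<Rightarrow> real ^ 'n \<Rightarrow> real \<Rightarrow> 'm \<Rightarrow> real" where
  "bump c a \<delta> m = (if m \<in> dom_c c then cutoff a \<delta> (coord c m) else 0)"

lemma bump_support:
  assumes "c \<in> A" "0 < \<delta>" "m \<notin> param c ` cball a (2 * \<delta>)" shows "bump c a \<delta> m = 0"
proof (cases "m \<in> dom_c c")
  case True
  have "coord c m \<notin> cball a (2 * \<delta>)"
  proof
    assume "coord c m \<in> cball a (2 * \<delta>)"
    then have "param c (coord c m) \<in> param c ` cball a (2 * \<delta>)" by blast
    then show False using assms(3) by (simp add: param_coord[OF assms(1) True])
  qed
  then show ?thesis using True cutoff_eq_0[of \<delta> a "coord c m"] assms(2) by (simp add: bump_def)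
qed (simp add: bump_def)

lemma smooth_bump:
  assumes c: "c \<in> A" and \<delta>: "0 < \<delta>" "cball a (2 * \<delta>) \<subseteq> img_c c"
  shows "smooth_fun (bump c a \<delta>)"
proof (rule smooth_fun_chartI)
  fix m
  show "\<exists>d\<in>A. m \<in> dom_c d \<and> smooth_near (\<lambda>x. bump c a \<delta> (param d x)) (coord d m)"
  proof (cases "m \<in> dom_c c")
    case True
    have "smooth_near (\<lambda>x. bump c a \<delta> (param c x)) (coord c m)"
      by (rule smooth_near_cong_open[OF smooth_cutoff[OF \<delta>(1)] open_img[OF c] coord_in_img[OF c True]])
        (simp add: bump_def param_in_dom[OF c] coord_param[OF c])
    then show ?thesis using c True by (intro bexI[of _ c] conjI)
  next
    case False
    let ?d = "chart_at A m"
    let ?K = "param c ` cball a (2 * \<delta>)"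
    have m: "m \<notin> ?K" using False \<delta>(2) param_in_dom[OF c] by blast
    have o: "open (img_c ?d \<inter> param ?d -` (- ?K))"
      by (rule continuous_open_preimage[OF continuous_param[OF chart_at(1)] open_img[OF chart_at(1)]])
        (rule open_Compl[OF closed_param_image[OF c compact_cball \<delta>(2)]])
    have "smooth_near (\<lambda>x. bump c a \<delta> (param ?d x)) (coord ?d m)"
      by (rule smooth_near_cong_open[OF smooth_near_const[where c = 0] o])
        (use m in \<open>auto simp: bump_support[OF c \<delta>(1)] coord_in_img[OF chart_at] param_coord[OF chart_at]\<close>)
    then show ?thesis using chart_at[of m] by (intro bexI[of _ ?d] conjI)
  qed
qed

text \<open>The weight \<open>1 - \<Prod>(1 - b)\<close> is \<open>1\<close> as soon as one of the bump functions \<open>b\<close> is. Splitting off one factor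
  adds a vector field supported in a single chart.\<close>

lemma realisable_bumps:
  assumes "finite D" "\<And>c a \<delta>. (c, a, \<delta>) \<in> D \<Longrightarrow> c \<in> A \<and> 0 < \<delta> \<and> cball a (2 * \<delta>) \<subseteq> img_c c" "smooth_fun Y"
  shows "realisable (\<lambda>m. (1 - (\<Prod>(c, a, \<delta>)\<in>D. 1 - bump c a \<delta> m)) *\<^sub>R Y m)"
  using assms(1,2)
proof (induction D rule: finite_induct)
  case empty
  then show ?case by (simp add: realisable_0)
next
  case (insert q D)
  obtain c a \<delta> where q: "q = (c, a, \<delta>)" by (cases q)
  have c: "c \<in> A" "0 < \<delta>" "cball a (2 * \<delta>) \<subseteq> img_c c" using insert.prems[of c a \<delta>] q by auto
  let ?P = "\<lambda>m. \<Prod>(c, a, \<delta>)\<in>D. 1 - bump c a \<delta> m"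
  have P: "smooth_near (\<lambda>x. ?P (param d x)) x" if "d \<in> A" "x \<in> img_c d" for d x
  proof (rule smooth_near_prod)
    fix i assume i: "i \<in> D"
    obtain c a \<delta> where ieq: "i = (c, a, \<delta>)" by (cases i)
    have "smooth_fun (bump c a \<delta>)" using insert.prems[of c a \<delta>] i ieq by (intro smooth_bump) auto
    then have "smooth_near (\<lambda>x. bump c a \<delta> (param d x)) x" using that unfolding smooth_fun_def by blast
    then show "smooth_near (\<lambda>x. case i of (c, a, \<delta>) \<Rightarrow> 1 - bump c a \<delta> (param d x)) x"
      unfolding ieq by (simp add: smooth_near_diff smooth_near_const)
  qed
  have "smooth_fun (\<lambda>m. (bump c a \<delta> m * ?P m) *\<^sub>R Y m)"
    unfolding smooth_fun_def
  proof (intro ballI smooth_near_scaleR smooth_near_mult)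
    fix d x assume d: "d \<in> A" "x \<in> img_c d"
    show "smooth_near (\<lambda>x. bump c a \<delta> (param d x)) x" using smooth_bump[OF c] d unfolding smooth_fun_def by blast
    show "smooth_near (\<lambda>x. Y (param d x)) x" using assms(3) d unfolding smooth_fun_def by blast
  qed (rule P)
  then have "realisable (\<lambda>m. (bump c a \<delta> m * ?P m) *\<^sub>R Y m)"
    by (rule realisable_in_chart[OF c(1) _ compact_cball c(3)]) (simp add: bump_support[OF c(1,2)])
  moreover have "realisable (\<lambda>m. (1 - ?P m) *\<^sub>R Y m)"
    by (rule insert.IH) (use insert.prems in auto)
  ultimately have "realisable (\<lambda>m. (bump c a \<delta> m * ?P m) *\<^sub>R Y m + (1 - ?P m) *\<^sub>R Y m)"
    by (rule realisable_add)
  moreover have "(bump c a \<delta> m * ?P m) *\<^sub>R Y m + (1 - ?P m) *\<^sub>R Y m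
      = (1 - (\<Prod>(c, a, \<delta>)\<in>insert q D. 1 - bump c a \<delta> m)) *\<^sub>R Y m" for m
    using insert.hyps by (simp add: q algebra_simps)
  ultimately show ?case by simp
qed

text \<open>Finitely many bump functions suffice for every point of \<open>K\<close> to lie where one of them is \<open>1\<close>; there the weight
  of \<open>realisable_bumps\<close> is \<open>1\<close>.\<close>

lemma realisable_on_compact:
  assumes K: "compact K" and Y: "smooth_fun Y"
  obtains \<epsilon> \<psi> where "smooth_family \<epsilon> \<psi>" "\<And>m. m \<in> K \<Longrightarrow> realises \<psi> m (Y m)"
proof -
  have "\<exists>\<delta>>0. cball (coord (chart_at A m) m) (2 * \<delta>) \<subseteq> img_c (chart_at A m)" for m
  proof -
    obtain e where e: "e > 0" "cball (coord (chart_at A m) m) e \<subseteq> img_c (chart_at A m)"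
      using open_img[OF chart_at(1)[of m]] coord_in_img[OF chart_at[of m]] open_contains_cball by blast
    then show ?thesis by (intro exI[of _ "e / 2"]) simp
  qed
  then obtain \<delta> where \<delta>: "\<And>m. \<delta> m > 0" "\<And>m. cball (coord (chart_at A m) m) (2 * \<delta> m) \<subseteq> img_c (chart_at A m)"
    by metis
  define U where "U m = dom_c (chart_at A m) \<inter> coord (chart_at A m) -` ball (coord (chart_at A m) m) (\<delta> m)" for m
  have "open (U m)" for m unfolding U_def
    by (rule continuous_open_preimage[OF continuous_coord[OF chart_at(1)] open_dom[OF chart_at(1)] open_ball])
  moreover have "K \<subseteq> (\<Union>m\<in>K. U m)" using chart_at \<delta>(1) by (auto simp: U_def)
  ultimately obtain E where E: "E \<subseteq> K" "finite E" "K \<subseteq> (\<Union>m\<in>E. U m)"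
    using compactE_image[OF K, of K U] by metis
  define D where "D = (\<lambda>m. (chart_at A m, coord (chart_at A m) m, \<delta> m)) ` E"
  have "realisable (\<lambda>m. (1 - (\<Prod>(c, a, \<delta>)\<in>D. 1 - bump c a \<delta> m)) *\<^sub>R Y m)"
  proof (rule realisable_bumps[OF _ _ Y])
    show "finite D" using E(2) by (simp add: D_def)
    fix c a e assume "(c, a, e) \<in> D"
    then obtain m where "c = chart_at A m" "a = coord (chart_at A m) m" "e = \<delta> m" unfolding D_def by blast
    then show "c \<in> A \<and> 0 < e \<and> cball a (2 * e) \<subseteq> img_c c" using chart_at(1) \<delta> by simp
  qed
  then obtain \<epsilon> \<psi> where f: "smooth_family \<epsilon> \<psi>"
    "\<And>m. realises \<psi> m ((1 - (\<Prod>(c, a, \<delta>)\<in>D. 1 - bump c a \<delta> m)) *\<^sub>R Y m)"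
    unfolding realisable_def by blast
  have "(\<Prod>(c, a, \<delta>)\<in>D. 1 - bump c a \<delta> m) = 0" if mK: "m \<in> K" for m
  proof -
    obtain m' where m': "m' \<in> E" "m \<in> U m'" using E(3) mK by blast
    let ?q = "(chart_at A m', coord (chart_at A m') m', \<delta> m')"
    have "bump (chart_at A m') (coord (chart_at A m') m') (\<delta> m') m = 1"
    proof -
      have "m \<in> dom_c (chart_at A m')" "dist (coord (chart_at A m') m') (coord (chart_at A m') m) \<le> \<delta> m'"
        using m'(2) by (simp_all add: U_def)
      then show ?thesis using cutoff_eq_1[OF _ \<delta>(1)[of m']] unfolding bump_def by simp
    qed
    then have "(case ?q of (c, a, \<delta>) \<Rightarrow> 1 - bump c a \<delta> m) = 0" by simp
    moreover have "?q \<in> D" using m'(1) by (auto simp: D_def)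
    moreover have "finite D" using E(2) by (simp add: D_def)
    ultimately show ?thesis by (intro prod_zero bexI)
  qed
  then have "realises \<psi> m (Y m)" if "m \<in> K" for m using f(2)[of m] that by simp
  with f(1) show thesis by (rule that)
qed


section \<open>Deformations of discrete maps\<close>

lemma curve_Ck_chart:
  assumes "curve_Ck A k \<gamma>" "c \<in> A"
  obtains D where "\<And>t. t \<in> {0..1} \<Longrightarrow> \<gamma> t \<in> dom_c c \<Longrightarrow> D 0 t = coord c (\<gamma> t)"
    "curve_derivatives k D {t \<in> {0..1}. \<gamma> t \<in> dom_c c}"
proof -
  obtain D :: "nat \<Rightarrow> real \<Rightarrow> real ^ 'n" where D: "\<forall>t\<in>{t \<in> {0..1}. \<gamma> t \<in> dom_c c}. D 0 t = coord c (\<gamma> t)"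
    "\<forall>i\<le>k. continuous_on {t \<in> {0..1}. \<gamma> t \<in> dom_c c} (D i)"
    "\<forall>i<k. \<forall>t\<in>{t \<in> {0..1}. \<gamma> t \<in> dom_c c}. (D i has_vector_derivative D (Suc i) t) (at t within {0..1})"
    using bspec[OF conjunct2[OF assms(1)[unfolded curve_Ck_def Let_def]] assms(2)]
    by (elim exE conjE) (rule that)
  show thesis
  proof (rule that)
    show "curve_derivatives k D {t \<in> {0..1}. \<gamma> t \<in> dom_c c}"
      unfolding curve_derivatives_def by (intro conjI D)
  qed (use D(1) in simp)
qed

lemma curve_Ck_continuous: "curve_Ck A k \<gamma> \<Longrightarrow> continuous_on {0..1} \<gamma>"
  unfolding curve_Ck_def by (rule conjunct1)

text \<open>Near each parameter the curve lies in a chart, where the function has the form \<open>H (s, x t)\<close>.\<close>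

lemma mixed_regular_along_curve:
  fixes h :: "real \<Rightarrow> 'm \<Rightarrow> 'a::euclidean_space"
  assumes \<gamma>: "curve_Ck A k \<gamma>" and \<Omega>: "open \<Omega>" and h: "\<And>s m. (s, m) \<in> \<Omega> \<Longrightarrow> smooth_at h s m"
  shows "mixed_regular k (\<lambda>s t. h s (\<gamma> t)) {z. snd z \<in> {0..1} \<and> (fst z, \<gamma> (snd z)) \<in> \<Omega>}"
    (is "mixed_regular k _ ?W")
proof (rule mixed_regular_local)
  fix z assume z: "z \<in> ?W"
  let ?c = "chart_at A (\<gamma> (snd z))"
  let ?H = "\<lambda>z. h (fst z) (param ?c (snd z))"
  have "smooth_at h (fst z) (\<gamma> (snd z))" using h z by simp
  from this[unfolded smooth_at_def, rule_format, OF chart_at]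
  have "smooth_near ?H (fst z, coord ?c (\<gamma> (snd z)))" .
  then obtain N where N: "open N" "(fst z, coord ?c (\<gamma> (snd z))) \<in> N" "smooth_on N ?H"
    unfolding smooth_near_def by (elim exE conjE) (rule that)
  obtain D where D: "\<And>t. t \<in> {0..1} \<Longrightarrow> \<gamma> t \<in> dom_c ?c \<Longrightarrow> D 0 t = coord ?c (\<gamma> t)"
    "curve_derivatives k D {t \<in> {0..1}. \<gamma> t \<in> dom_c ?c}"
  proof (rule curve_Ck_chart[OF \<gamma> chart_at(1)[of "\<gamma> (snd z)"]])
    fix D assume "\<And>t. t \<in> {0..1} \<Longrightarrow> \<gamma> t \<in> dom_c ?c \<Longrightarrow> D 0 t = coord ?c (\<gamma> t)"
      "curve_derivatives k D {t \<in> {0..1}. \<gamma> t \<in> dom_c ?c}"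
    then show thesis by (rule that)
  qed
  let ?V1 = "strip \<inter> (\<lambda>z. (fst z, \<gamma> (snd z))) -` (\<Omega> \<inter> UNIV \<times> dom_c ?c)"
  let ?V = "?V1 \<inter> (\<lambda>z. (fst z, coord ?c (\<gamma> (snd z)))) -` N"
  have cont1: "continuous_on strip (\<lambda>z. (fst z, \<gamma> (snd z)))"
    by (intro continuous_on_Pair continuous_on_fst continuous_on_id
      continuous_on_compose2[OF curve_Ck_continuous[OF \<gamma>] continuous_on_snd[OF continuous_on_id]]) auto
  have o1: "openin (top_of_set strip) ?V1"
    by (rule continuous_openin_preimage_gen[OF cont1])
      (intro open_Int \<Omega> open_Times open_UNIV open_dom[OF chart_at(1)])
  have "continuous_on ?V1 (\<lambda>z. \<gamma> (snd z))"
    using continuous_on_snd[OF continuous_on_subset[OF cont1, of ?V1]] by simp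
  then have "continuous_on ?V1 (\<lambda>z. coord ?c (\<gamma> (snd z)))"
    by (rule continuous_on_compose2[OF continuous_coord[OF chart_at(1)]]) auto
  then have "continuous_on ?V1 (\<lambda>z. (fst z, coord ?c (\<gamma> (snd z))))"
    by (intro continuous_on_Pair continuous_on_fst continuous_on_id)
  then have "openin (top_of_set ?V1) ?V" by (rule continuous_openin_preimage_gen[OF _ N(1)])
  then have oV: "openin (top_of_set strip) ?V" using o1 by (rule openin_trans)
  have "mixed_regular k (\<lambda>s t. h s (\<gamma> t)) ?V"
  proof (rule mixed_regular_compose[OF N(1) N(3) _ D(2)])
    show "?V \<subseteq> UNIV \<times> {t \<in> {0..1}. \<gamma> t \<in> dom_c ?c}" by auto
    fix s t assume st: "(s, t) \<in> ?V"
    then have t: "t \<in> {0..1}" "\<gamma> t \<in> dom_c ?c" by auto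
    show "(s, D 0 t) \<in> N" using st D(1)[OF t] by simp
    show "h s (\<gamma> t) = ?H (s, D 0 t)" by (simp add: D(1)[OF t] param_coord[OF chart_at(1) t(2)])
  qed
  moreover have "z \<in> ?V" using z N(2) chart_at(2)[of "\<gamma> (snd z)"] by (simp add: mem_Times_iff)
  moreover have "?V \<subseteq> ?W" by auto
  ultimately show "\<exists>V. z \<in> V \<and> openin (top_of_set strip) V \<and> V \<subseteq> ?W \<and> mixed_regular k (\<lambda>s t. h s (\<gamma> t)) V"
    using oV by (intro exI[of _ ?V] conjI)
qed

lemma family_regular_along_curve:
  assumes \<psi>: "smooth_family \<epsilon> \<psi>" and \<gamma>: "curve_Ck A k \<gamma>"
  shows "family_regular A k \<epsilon> (\<lambda>s t. \<psi> s (\<gamma> t))"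
  unfolding family_regular_def Let_def
proof (intro conjI ballI)
  have "continuous_on ({-\<epsilon><..<\<epsilon>} \<times> {0..1}) (\<lambda>z. (fst z, \<gamma> (snd z)))"
    by (intro continuous_on_Pair continuous_on_fst continuous_on_id
      continuous_on_compose2[OF curve_Ck_continuous[OF \<gamma>] continuous_on_snd[OF continuous_on_id]]) auto
  from continuous_on_compose2[OF smooth_family_continuous[OF \<psi>] this]
  show "continuous_on ({-\<epsilon><..<\<epsilon>} \<times> {0..1}) (\<lambda>(s, t). \<psi> s (\<gamma> t))"
    by (simp add: case_prod_unfold image_subset_iff)
  fix c assume c: "c \<in> A"
  let ?\<Omega> = "{z. fst z \<in> {-\<epsilon><..<\<epsilon>} \<and> \<psi> (fst z) (snd z) \<in> dom_c c}"
  have "open ?\<Omega>" by (rule open_family_preimage[OF smooth_family_continuous[OF \<psi>] open_dom[OF c]])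
  from mixed_regular_along_curve[OF \<gamma> this, of "\<lambda>s m. coord c (\<psi> s m)"] smooth_family_smooth[OF \<psi> _ c]
  have "mixed_regular k (\<lambda>s t. coord c (\<psi> s (\<gamma> t))) {z. snd z \<in> {0..1} \<and> (fst z, \<gamma> (snd z)) \<in> ?\<Omega>}" by simp
  moreover have "{z. snd z \<in> {0..1} \<and> (fst z, \<gamma> (snd z)) \<in> ?\<Omega>}
      = {(s, t). s \<in> {-\<epsilon><..<\<epsilon>} \<and> t \<in> {0..1} \<and> \<psi> s (\<gamma> t) \<in> dom_c c}" (is "_ = ?W") by auto
  ultimately obtain D where D0: "\<And>s t. (s, t) \<in> ?W \<Longrightarrow> D 0 0 s t = coord c (\<psi> s (\<gamma> t))"
    and D: "mixed_partials k D ?W"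
    unfolding mixed_regular_def by auto
  show "\<exists>D :: nat \<Rightarrow> nat \<Rightarrow> real \<Rightarrow> real \<Rightarrow> real ^ 'n.
          (\<forall>(s, t)\<in>?W. D 0 0 s t = coord c (\<psi> s (\<gamma> t))) \<and>
          (\<forall>i. \<forall>l\<le>k. continuous_on ?W (\<lambda>(s, t). D i l s t)) \<and>
          (\<forall>i. \<forall>l\<le>k. \<forall>(s, t)\<in>?W.
             ((\<lambda>\<sigma>. D i l \<sigma> t) has_vector_derivative D (Suc i) l s t) (at s)) \<and>
          (\<forall>i. \<forall>l<k. \<forall>(s, t)\<in>?W.
             ((\<lambda>\<tau>. D i l s \<tau>) has_vector_derivative D i (Suc l) s t) (at t within {0..1}))"
  proof (intro exI[of _ D] conjI allI impI ballI)
    fix z assume z: "z \<in> ?W"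
    obtain s t where st: "z = (s, t)" by (cases z)
    have w: "(s, t) \<in> ?W" using z unfolding st .
    show "case z of (s, t) \<Rightarrow> D 0 0 s t = coord c (\<psi> s (\<gamma> t))" unfolding st using D0[OF w] by simp
    show "case z of (s, t) \<Rightarrow> ((\<lambda>\<sigma>. D i l \<sigma> t) has_vector_derivative D (Suc i) l s t) (at s)"
      if "l \<le> k" for i l unfolding st prod.case by (rule mixed_partials_s[OF D that w])
    show "case z of (s, t) \<Rightarrow> ((\<lambda>\<tau>. D i l s \<tau>) has_vector_derivative D i (Suc l) s t) (at t within {0..1})"
      if "l < k" for i l unfolding st prod.case by (rule mixed_partials_t[OF D that w])
  qed (rule mixed_partials_continuous[OF D])
qed

lemma curve_Ck_slice:
  assumes "family_regular A k \<epsilon> \<phi>" and s: "s \<in> {-\<epsilon><..<\<epsilon>}"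
  shows "curve_Ck A k (\<phi> s)"
  unfolding curve_Ck_def Let_def
proof (intro conjI ballI)
  show "continuous_on {0..1} (\<phi> s)"
    using assms(1) s unfolding family_regular_def by (intro continuous_on_slice[of "{-\<epsilon><..<\<epsilon>} \<times> {0..1}" \<phi>]) auto
  fix c assume c: "c \<in> A"
  let ?W = "{(s, t). s \<in> {-\<epsilon><..<\<epsilon>} \<and> t \<in> {0..1} \<and> \<phi> s t \<in> dom_c c}"
  let ?T = "{t \<in> {0..1}. \<phi> s t \<in> dom_c c}"
  obtain D :: "nat \<Rightarrow> nat \<Rightarrow> real \<Rightarrow> real \<Rightarrow> real ^ 'n" where
    D: "\<forall>(s, t)\<in>?W. D 0 0 s t = coord c (\<phi> s t)"
      "\<forall>i. \<forall>l\<le>k. continuous_on ?W (\<lambda>(s, t). D i l s t)"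
      "\<forall>i. \<forall>l<k. \<forall>(s, t)\<in>?W. ((\<lambda>\<tau>. D i l s \<tau>) has_vector_derivative D i (Suc l) s t) (at t within {0..1})"
    using bspec[OF conjunct2[OF assms(1)[unfolded family_regular_def Let_def]] c]
    by (elim exE conjE) (rule that)
  have W: "(s, t) \<in> ?W" if "t \<in> ?T" for t using that s by simp
  show "\<exists>D. (\<forall>t\<in>?T. D 0 t = coord c (\<phi> s t)) \<and> (\<forall>i\<le>k. continuous_on ?T (D i)) \<and>
    (\<forall>i<k. \<forall>t\<in>?T. (D i has_vector_derivative D (Suc i) t) (at t within {0..1}))"
  proof (intro exI[of _ "\<lambda>l t. D 0 l s t"] conjI allI impI ballI)
    fix t assume t: "t \<in> ?T"
    show "D 0 0 s t = coord c (\<phi> s t)" using bspec[OF D(1) W[OF t]] by simp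
    show "((\<lambda>t. D 0 i s t) has_vector_derivative D 0 (Suc i) s t) (at t within {0..1})" if "i < k" for i
      using D(3)[rule_format, OF that W[OF t], of 0] by simp
  next
    fix l assume "l \<le> k"
    with D(2) have "continuous_on ?W (\<lambda>(s, t). D 0 l s t)" by blast
    then show "continuous_on ?T (\<lambda>t. D 0 l s t)" using W by (rule continuous_on_slice)
  qed
qed

text \<open>All points of \<open>M\<close> are moved by the same maps, so edges stay attached to their vertices and reversed edges
  stay reversed.\<close>

lemma deformation_smooth_family:
  assumes \<psi>: "smooth_family \<epsilon> \<psi>" and f: "discrete_map A k X arev f"
  shows "deformation A k X arev f \<epsilon> (\<lambda>s e t. \<psi> s (f e t))"
  unfolding deformation_def
proof (intro conjI ballI allI impI)
  show "0 < \<epsilon>" by (rule smooth_family_eps[OF \<psi>])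
  show "\<psi> 0 (f e t) = f e t" for e t by (rule smooth_family_0[OF \<psi>])
  show "family_regular A j \<epsilon> (\<lambda>s t. \<psi> s (f e t))" if "curve_Ck A j (f e)" for e j
    by (rule family_regular_along_curve[OF \<psi> that])
  fix s assume s: "s \<in> {-\<epsilon><..<\<epsilon>}"
  obtain fv where fv: "\<forall>e\<in>arcs X. f e 0 = fv (tail X e) \<and> f e 1 = fv (head X e)"
    using f unfolding discrete_map_def by blast
  show "discrete_map A k X arev (\<lambda>e t. \<psi> s (f e t))"
    unfolding discrete_map_def
  proof (intro conjI ballI exI[of _ "\<lambda>v. \<psi> s (fv v)"])
    fix e assume e: "e \<in> arcs X"
    show "\<psi> s (f e 0) = \<psi> s (fv (tail X e))" "\<psi> s (f e 1) = \<psi> s (fv (head X e))" using fv e by simp_all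
    show "\<psi> s (f (arev e) t) = \<psi> s (f e (1 - t))" if "t \<in> {0..1}" for t
      using f e that unfolding discrete_map_def by simp
    have "curve_Ck A k (f e)" using f e unfolding discrete_map_def by blast
    from curve_Ck_slice[OF family_regular_along_curve[OF \<psi> this] s] show "curve_Ck A k (\<lambda>t. \<psi> s (f e t))" .
  qed
qed

text \<open>The last part, that a curve stays in the chart for nearby parameters, is what allows computing one-sided
  derivatives in the chart.\<close>

lemma has_vector_derivative_velocity:
  assumes \<gamma>: "curve_Ck A k \<gamma>" "1 \<le> k" and c: "c \<in> A" and t: "t \<in> {0..1}" "\<gamma> t \<in> dom_c c"
  shows "((coord c \<circ> \<gamma>) has_vector_derivative velocity c \<gamma> t) (at t within {0..1})"
    and "((\<lambda>t. F (\<gamma> t)) has_vector_derivative differential F c (coord c (\<gamma> t)) (velocity c \<gamma> t)) (at t within {0..1})"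
    and "\<exists>e>0. \<forall>\<tau>\<in>{0..1}. dist \<tau> t < e \<longrightarrow> \<gamma> \<tau> \<in> dom_c c"
proof -
  obtain D where D: "\<And>t. t \<in> {0..1} \<Longrightarrow> \<gamma> t \<in> dom_c c \<Longrightarrow> D 0 t = coord c (\<gamma> t)"
    "curve_derivatives k D {t \<in> {0..1}. \<gamma> t \<in> dom_c c}"
    using curve_Ck_chart[OF \<gamma>(1) c] by metis
  have "openin (top_of_set {0..1}) ({0..1} \<inter> \<gamma> -` dom_c c)"
    by (rule continuous_openin_preimage_gen[OF curve_Ck_continuous[OF \<gamma>(1)] open_dom[OF c]])
  then show near: "\<exists>e>0. \<forall>\<tau>\<in>{0..1}. dist \<tau> t < e \<longrightarrow> \<gamma> \<tau> \<in> dom_c c"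
    using t unfolding openin_euclidean_subtopology_iff by blast
  then obtain e where e: "e > 0" "\<And>\<tau>. \<tau> \<in> {0..1} \<Longrightarrow> dist \<tau> t < e \<Longrightarrow> \<gamma> \<tau> \<in> dom_c c" by blast
  have "(D 0 has_vector_derivative D 1 t) (at t within {0..1})"
    using D(2) \<gamma>(2) t unfolding curve_derivatives_def by simp
  then have "((coord c \<circ> \<gamma>) has_vector_derivative D 1 t) (at t within {0..1})"
    by (rule has_vector_derivative_transform_within[OF _ e(1) t(1)]) (simp add: D(1) e(2))
  moreover from this have "velocity c \<gamma> t = D 1 t"
    unfolding velocity_def
    by (intro vector_derivative_within) (use islimpt_Icc_unit[OF t(1)] in \<open>simp_all add: trivial_limit_within\<close>)
  ultimately show v: "((coord c \<circ> \<gamma>) has_vector_derivative velocity c \<gamma> t) (at t within {0..1})" by simp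
  note x = coord_in_img[OF c t(2)]
  have "((\<lambda>t. local_rep F c ((coord c \<circ> \<gamma>) t)) has_vector_derivative
      differential F c (coord c (\<gamma> t)) (velocity c \<gamma> t)) (at t within {0..1})"
    by (rule has_vector_derivative_chain[OF v]) (simp add: differential_has_derivative[OF c x])
  then show "((\<lambda>t. F (\<gamma> t)) has_vector_derivative differential F c (coord c (\<gamma> t)) (velocity c \<gamma> t)) (at t within {0..1})"
    by (rule has_vector_derivative_transform_within[OF _ e(1) t(1)]) (simp add: local_rep_def param_coord[OF c e(2)])
qed

lemma norm_differential: "c \<in> A \<Longrightarrow> x \<in> img_c c \<Longrightarrow> norm (differential F c x Z) = sqrt (metric_form g c x Z Z)"
  by (simp add: norm_eq_sqrt_inner differential_inner)

lemma speed_eq_norm: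
  assumes "curve_Ck A k \<gamma>" "1 \<le> k" "t \<in> {0..1}" "((\<lambda>t. F (\<gamma> t)) has_vector_derivative w) (at t within {0..1})"
  shows "speed A g \<gamma> t = norm w"
proof -
  let ?c = "chart_at A (\<gamma> t)"
  have "at t within {0..1} \<noteq> bot" using islimpt_Icc_unit[OF assms(3)] by (simp add: trivial_limit_within)
  from vector_derivative_unique_within[OF this assms(4) has_vector_derivative_velocity(2)[OF assms(1,2) chart_at(1) assms(3) chart_at(2)]]
  show ?thesis by (simp add: speed_def Let_def norm_differential[OF chart_at(1) coord_in_img[OF chart_at]])
qed

end

section \<open>The second variation of the energy integral\<close>

text \<open>Gradient and Hessian of \<open>norm w ^ p / p\<close>. At \<open>w = 0\<close> and for \<open>p \<ge> 2\<close> the conventions for powers of \<open>0\<close>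
  give the right values, since \<open>0 powi 0 = 1\<close> while the other powers of \<open>0\<close> vanish.\<close>

definition grad_pow :: "nat \<Rightarrow> 'a::real_inner \<Rightarrow> 'a" where
  "grad_pow p w = (norm w powi (int p - 2)) *\<^sub>R w"

definition hess_pow :: "nat \<Rightarrow> 'a::real_inner \<Rightarrow> 'a \<Rightarrow> 'a" where
  "hess_pow p w \<xi> = (norm w powi (int p - 2)) *\<^sub>R \<xi>
     + ((real p - 2) * norm w powi (int p - 4) * (w \<bullet> \<xi>)) *\<^sub>R w"

abbreviation regular_pow :: "nat \<Rightarrow> 'a::real_inner \<Rightarrow> bool" where
  "regular_pow p w \<equiv> 2 \<le> p \<or> p = 1 \<and> w \<noteq> 0"

lemma has_derivative_norm_powi:
  fixes w :: "'a::real_inner"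
  assumes "w \<noteq> 0"
  shows "((\<lambda>w. norm w powi n) has_derivative (\<lambda>\<xi>. (real_of_int n * norm w powi (n - 2) * (w \<bullet> \<xi>)))) (at w)"
proof -
  have "((\<lambda>r. r powi n) has_derivative (\<lambda>h. h * (real_of_int n * norm w powi (n - 1)))) (at (norm w))"
    using has_derivative_power_int'[of "norm w" n UNIV] assms by simp
  from has_derivative_compose[OF has_derivative_norm[OF assms] this]
  have "((\<lambda>w. norm w powi n) has_derivative (\<lambda>\<xi>. (\<xi> \<bullet> sgn w) * (real_of_int n * norm w powi (n - 1)))) (at w)"
    by (simp add: inner_commute)
  moreover have "(\<xi> \<bullet> sgn w) * (real_of_int n * norm w powi (n - 1)) = real_of_int n * norm w powi (n - 2) * (w \<bullet> \<xi>)" for \<xi>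
  proof -
    have "norm w powi (n - 1) = norm w * norm w powi (n - 2)"
      using power_int_add_1'[of "norm w" "n - 2"] assms by simp
    then show ?thesis using assms by (simp add: sgn_div_norm inner_commute)
  qed
  ultimately show ?thesis by simp
qed

lemma powi_nat_diff: "k \<le> p \<Longrightarrow> (r::real) powi (int p - int k) = r ^ (p - k)"
proof -
  assume "k \<le> p"
  then have "int p - int k = int (p - k)" by simp
  then show ?thesis by (simp only: power_int_of_nat)
qed

lemma has_derivative_0_at_0_power:
  fixes f :: "'a::real_inner \<Rightarrow> 'b::real_normed_vector"
  assumes "2 \<le> n" "\<And>w. norm (f w) = norm w ^ n"
  shows "(f has_derivative (\<lambda>\<xi>. 0)) (at 0)"
  unfolding has_derivative_at
proof (intro conjI bounded_linear_zero)
  have f0: "f 0 = 0" using assms(2)[of 0] assms(1) by (simp add: power_0_left)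
  show "((\<lambda>h. norm (f (0 + h) - f 0 - 0) / norm h) \<longlongrightarrow> 0) (at 0)"
  proof (rule Lim_transform_eventually)
    have "((\<lambda>h::'a. norm h ^ (n - 1)) \<longlongrightarrow> 0 ^ (n - 1)) (at 0)"
      by (intro tendsto_power tendsto_norm_zero tendsto_ident_at)
    then show "((\<lambda>h::'a. norm h ^ (n - 1)) \<longlongrightarrow> 0) (at 0)" using assms(1) by (simp add: power_0_left)
    have "norm h ^ (n - 1) = norm h ^ n / norm h" if "h \<noteq> 0" for h :: 'a
      using that assms(1) by (cases n) auto
    then show "\<forall>\<^sub>F h in at 0. norm h ^ (n - 1) = norm (f (0 + h) - f 0 - 0) / norm h"
      by (auto simp: eventually_at_filter f0 assms(2))
  qed
qed

lemma norm_grad_pow: "2 \<le> p \<Longrightarrow> norm (grad_pow p w) = norm w ^ (p - 1)"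
proof -
  assume p: "2 \<le> p"
  have "norm (grad_pow p w) = norm w ^ (p - 2) * norm w"
    using powi_nat_diff[OF p, of "norm w"] by (simp add: grad_pow_def power_abs)
  also have "\<dots> = norm w ^ (p - 1)" using p by (cases p) (auto simp: Suc_diff_le power_Suc2[symmetric] simp del: power_Suc)
  finally show ?thesis .
qed

lemma has_derivative_norm_pow:
  assumes "regular_pow p w"
  shows "((\<lambda>w. norm w ^ p) has_derivative (\<lambda>\<xi>. real p * (grad_pow p w \<bullet> \<xi>))) (at w)"
proof (cases "w = 0")
  case True
  then have "2 \<le> p" using assms by simp
  then show ?thesis using has_derivative_0_at_0_power[of p "\<lambda>w. norm w ^ p"] True by (simp add: grad_pow_def)
next
  case False
  from has_derivative_norm_powi[OF this, of "int p"] show ?thesis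
    by (simp add: grad_pow_def mult.assoc)
qed

lemma has_derivative_grad_pow:
  assumes "regular_pow p w"
  shows "(grad_pow p has_derivative hess_pow p w) (at w)"
proof (cases "w = 0")
  case True
  then have p: "2 \<le> p" using assms by simp
  show ?thesis
  proof (cases "p = 2")
    case p2: True
    have "grad_pow 2 = (\<lambda>w::'a. w)" "hess_pow 2 0 = (\<lambda>\<xi>::'a. \<xi>)" by (auto simp: grad_pow_def hess_pow_def)
    then show ?thesis using p2 True by simp
  next
    case False
    then have "3 \<le> p" using p by simp
    then have "(grad_pow p has_derivative (\<lambda>\<xi>. 0)) (at (0::'a))"
      by (intro has_derivative_0_at_0_power[of "p - 1"] norm_grad_pow) auto
    moreover have "hess_pow p 0 = (\<lambda>\<xi>::'a. 0)" using \<open>3 \<le> p\<close> by (auto simp: hess_pow_def power_int_0_left_if)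
    ultimately show ?thesis using True by simp
  qed
next
  case False
  from has_derivative_scaleR[OF has_derivative_norm_powi[OF this, of "int p - 2"] has_derivative_ident]
  show ?thesis unfolding grad_pow_def[abs_def] hess_pow_def[abs_def]
    by (simp add: mult.assoc)
qed

text \<open>For \<open>p = 3\<close> the Hessian contains a negative power of \<open>norm w\<close>. The factor \<open>w\<close> and the inner product with \<open>w\<close>
  compensate for it, so that the Hessian tends to \<open>0\<close> with \<open>w\<close>.\<close>

lemma norm_hess_pow_le:
  assumes p3: "3 \<le> p"
  shows "norm (hess_pow p v \<eta>) \<le> (real p - 1) * norm v ^ (p - 2) * norm \<eta>"
proof (cases "v = 0")
  case True
  then show ?thesis using p3 by (simp add: hess_pow_def power_int_0_left_if)
next
  case False
  have p: "2 \<le> p" using p3 by simp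
  have e: "norm v powi (int p - 2) = norm v ^ (p - 2)" using powi_nat_diff[OF p, of "norm v"] by simp
  have e2: "norm v powi (int p - 4) * (norm v * norm v) = norm v ^ (p - 2)"
  proof -
    have "norm v powi (int p - 2) = norm v powi (int p - 4) * norm v powi 2"
      using power_int_add[of "norm v" "int p - 4" 2] False by simp
    then show ?thesis using e by (simp add: power2_eq_square)
  qed
  have "norm (hess_pow p v \<eta>) \<le> norm (norm v ^ (p - 2) *\<^sub>R \<eta>)
      + norm (((real p - 2) * norm v powi (int p - 4) * (v \<bullet> \<eta>)) *\<^sub>R v)"
    unfolding hess_pow_def e by (rule norm_triangle_ineq)
  also have "\<dots> = norm v ^ (p - 2) * norm \<eta> + (real p - 2) * norm v powi (int p - 4) * \<bar>v \<bullet> \<eta>\<bar> * norm v"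
    using p by (simp add: abs_mult power_int_abs power_abs)
  also have "\<dots> \<le> norm v ^ (p - 2) * norm \<eta>
      + (real p - 2) * norm v powi (int p - 4) * (norm v * norm \<eta>) * norm v"
    using p by (intro add_left_mono mult_right_mono mult_left_mono Cauchy_Schwarz_ineq2) auto
  also have "\<dots> = norm v ^ (p - 2) * norm \<eta> + (real p - 2) * (norm v powi (int p - 4) * (norm v * norm v)) * norm \<eta>"
    by simp
  also have "\<dots> = (real p - 1) * norm v ^ (p - 2) * norm \<eta>" unfolding e2 by (simp add: algebra_simps)
  finally show ?thesis .
qed

lemma continuous_hess_pow:
  fixes S :: "'c::topological_space set"
  assumes "continuous_on S w" "continuous_on S \<xi>" "\<And>z. z \<in> S \<Longrightarrow> regular_pow p (w z)"
  shows "continuous_on S (\<lambda>z. hess_pow p (w z) (\<xi> z))"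
  unfolding continuous_on_def
proof
  fix z assume z: "z \<in> S"
  have w: "(w \<longlongrightarrow> w z) (at z within S)" and \<xi>: "(\<xi> \<longlongrightarrow> \<xi> z) (at z within S)"
    using assms(1,2) z unfolding continuous_on_def by auto
  show "((\<lambda>z. hess_pow p (w z) (\<xi> z)) \<longlongrightarrow> hess_pow p (w z) (\<xi> z)) (at z within S)"
  proof (cases "w z = 0")
    case False
    then show ?thesis unfolding hess_pow_def
      by (intro tendsto_intros w \<xi>) auto
  next
    case True
    then have p: "2 \<le> p" using assms(3)[OF z] by simp
    show ?thesis
    proof (cases "p = 2")
      case True
      then show ?thesis using \<xi> by (simp add: hess_pow_def)
    next
      case False
      then have p3: "3 \<le> p" using p by simp
      have "((\<lambda>z. (real p - 1) * norm (w z) ^ (p - 2) * norm (\<xi> z)) \<longlongrightarrow> (real p - 1) * norm (w z) ^ (p - 2) * norm (\<xi> z)) (at z within S)"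
        by (intro tendsto_intros w \<xi>)
      then have "((\<lambda>z. (real p - 1) * norm (w z) ^ (p - 2) * norm (\<xi> z)) \<longlongrightarrow> 0) (at z within S)"
        using True p3 by (simp add: power_0_left)
      then have "((\<lambda>z. hess_pow p (w z) (\<xi> z)) \<longlongrightarrow> 0) (at z within S)"
        by (rule Lim_null_comparison[rotated]) (simp add: norm_hess_pow_le[OF p3])
      moreover have "hess_pow p (w z) (\<xi> z) = 0" using True p3 by (simp add: hess_pow_def power_int_0_left_if)
      ultimately show ?thesis by simp
    qed
  qed
qed

lemma continuous_grad_pow:
  fixes S :: "'c::topological_space set"
  assumes "continuous_on S w" "\<And>z. z \<in> S \<Longrightarrow> regular_pow p (w z)"
  shows "continuous_on S (\<lambda>z. grad_pow p (w z))"
proof (cases "p = 1")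
  case True
  then show ?thesis unfolding grad_pow_def using assms by (intro continuous_intros) auto
next
  case False
  show ?thesis
  proof (cases "S = {}")
    case ne: False
    then have p: "2 \<le> p" using assms(2) False by blast
    have "(\<lambda>z. grad_pow p (w z)) = (\<lambda>z. norm (w z) ^ (p - 2) *\<^sub>R w z)"
      using powi_nat_diff[OF p] by (simp add: grad_pow_def)
    then show ?thesis
      by (simp only:) (intro continuous_on_scaleR continuous_on_power continuous_on_norm assms(1))
  qed simp
qed

lemma has_real_derivative_integral:
  fixes f :: "real \<Rightarrow> real \<Rightarrow> real"
  assumes "\<And>s t. s \<in> {-\<delta><..<\<delta>} \<Longrightarrow> t \<in> {0..1} \<Longrightarrow> ((\<lambda>s. f s t) has_real_derivative f' s t) (at s)"
    and "\<And>s. s \<in> {-\<delta><..<\<delta>} \<Longrightarrow> continuous_on {0..1} (f s)"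
    and "continuous_on ({-\<delta><..<\<delta>} \<times> {0..1}) (\<lambda>(s, t). f' s t)" "s \<in> {-\<delta><..<\<delta>}"
  shows "((\<lambda>s. integral {0..1} (f s)) has_real_derivative integral {0..1} (f' s)) (at s)"
proof -
  have "((\<lambda>s. integral (cbox 0 1) (f s)) has_field_derivative integral (cbox 0 1) (f' s)) (at s within {-\<delta><..<\<delta>})"
  proof (rule leibniz_rule_field_derivative)
    show "((\<lambda>s. f s t) has_real_derivative f' s t) (at s within {-\<delta><..<\<delta>})"
      if "s \<in> {-\<delta><..<\<delta>}" "t \<in> cbox 0 1" for s t
      using assms(1)[of s t] that by (auto intro: has_field_derivative_at_within)
    show "f s integrable_on cbox 0 1" if "s \<in> {-\<delta><..<\<delta>}" for s
      using assms(2)[OF that] by (simp add: integrable_continuous_real)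
  qed (use assms(3,4) in simp_all)
  then show ?thesis using assms(4) by (simp add: at_within_open[OF _ open_greaterThanLessThan])
qed

text \<open>If no \<open>w 0 t\<close> vanishes, then no \<open>w s t\<close> does for small \<open>s\<close>, by compactness of \<open>[0,1]\<close>.\<close>

lemma nonzero_tube:
  fixes w :: "real \<Rightarrow> real \<Rightarrow> 'a::real_normed_vector"
  assumes "0 < \<epsilon>" "continuous_on ({-\<epsilon><..<\<epsilon>} \<times> {0..1}) (\<lambda>(s, t). w s t)" "\<And>t. t \<in> {0..1} \<Longrightarrow> w 0 t \<noteq> 0"
  obtains \<delta> where "0 < \<delta>" "\<delta> \<le> \<epsilon>" "\<And>s t. s \<in> {-\<delta><..<\<delta>} \<Longrightarrow> t \<in> {0..1} \<Longrightarrow> w s t \<noteq> 0"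
proof -
  let ?K = "{-\<epsilon>/2..\<epsilon>/2} \<times> {0..1::real}"
  \<comment> \<open>the parameters \<open>s\<close> for which \<open>w\<close> has a zero form a compact set that does not contain \<open>0\<close>\<close>
  let ?Z = "?K \<inter> (\<lambda>(s, t). w s t) -` {0}"
  have K: "compact ?K" by (intro compact_Times compact_Icc)
  have "closed ?Z"
    by (rule continuous_closed_preimage[OF continuous_on_subset[OF assms(2)] compact_imp_closed[OF K]])
      (use assms(1) in auto)
  then have "compact (?K \<inter> ?Z)" by (rule compact_Int_closed[OF K])
  then have "compact (fst ` (?K \<inter> ?Z))" by (rule compact_continuous_image[OF continuous_on_fst[OF continuous_on_id]])
  then have "open (- (fst ` (?K \<inter> ?Z)))" by (rule open_Compl[OF compact_imp_closed])
  moreover have "0 \<in> - (fst ` (?K \<inter> ?Z))" using assms(3) by auto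
  ultimately obtain e where e: "0 < e" "ball 0 e \<subseteq> - (fst ` (?K \<inter> ?Z))" by (rule openE)
  show thesis
  proof (rule that[of "min e (\<epsilon> / 2)"])
    fix s t assume s: "s \<in> {- min e (\<epsilon> / 2)<..<min e (\<epsilon> / 2)}" and t: "t \<in> {0..1::real}"
    show "w s t \<noteq> 0"
    proof
      assume "w s t = 0"
      then have "(s, t) \<in> ?K \<inter> ?Z" using s t by auto
      then have "s \<in> fst ` (?K \<inter> ?Z)" by (rule image_eqI[rotated]) simp
      moreover have "s \<in> ball 0 e" using s by (auto simp: dist_real_def)
      ultimately show False using e(2) by blast
    qed
  qed (use assms(1) e(1) in auto)
qed

text \<open>Both derivatives are taken under the integral sign. For \<open>p = 1\<close> this is possible as long as \<open>w\<close> does not vanish.\<close>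

lemma energy_variation:
  fixes w w1 w2 :: "real \<Rightarrow> real \<Rightarrow> 'a::euclidean_space"
  assumes \<epsilon>: "0 < \<epsilon>"
    and cont: "continuous_on ({-\<epsilon><..<\<epsilon>} \<times> {0..1}) (\<lambda>(s, t). w s t)"
      "continuous_on ({-\<epsilon><..<\<epsilon>} \<times> {0..1}) (\<lambda>(s, t). w1 s t)"
      "continuous_on ({-\<epsilon><..<\<epsilon>} \<times> {0..1}) (\<lambda>(s, t). w2 s t)"
    and d: "\<And>s t. s \<in> {-\<epsilon><..<\<epsilon>} \<Longrightarrow> t \<in> {0..1} \<Longrightarrow> ((\<lambda>s. w s t) has_vector_derivative w1 s t) (at s)"
      "\<And>s t. s \<in> {-\<epsilon><..<\<epsilon>} \<Longrightarrow> t \<in> {0..1} \<Longrightarrow> ((\<lambda>s. w1 s t) has_vector_derivative w2 s t) (at s)"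
    and reg: "\<And>t. t \<in> {0..1} \<Longrightarrow> regular_pow p (w 0 t)"
  shows "\<forall>\<^sub>F s in nhds 0. ((\<lambda>s. integral {0..1} (\<lambda>t. norm (w s t) ^ p)) has_real_derivative
      real p * integral {0..1} (\<lambda>t. grad_pow p (w s t) \<bullet> w1 s t)) (at s)" (is ?first)
    and "((\<lambda>s. real p * integral {0..1} (\<lambda>t. grad_pow p (w s t) \<bullet> w1 s t)) has_real_derivative
      real p * integral {0..1} (\<lambda>t. hess_pow p (w 0 t) (w1 0 t) \<bullet> w1 0 t + grad_pow p (w 0 t) \<bullet> w2 0 t)) (at 0)"
      (is ?second)
proof -
  obtain \<delta> where \<delta>: "0 < \<delta>" "\<delta> \<le> \<epsilon>"
    and reg': "\<And>s t. s \<in> {-\<delta><..<\<delta>} \<Longrightarrow> t \<in> {0..1} \<Longrightarrow> regular_pow p (w s t)"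
  proof (cases "2 \<le> p")
    case True
    then show thesis using \<epsilon> that by blast
  next
    case False
    then have p: "p = 1" and nz: "\<And>t. t \<in> {0..1} \<Longrightarrow> w 0 t \<noteq> 0" using reg[of 0] reg by auto
    obtain \<delta> where "0 < \<delta>" "\<delta> \<le> \<epsilon>" "\<And>s t. s \<in> {-\<delta><..<\<delta>} \<Longrightarrow> t \<in> {0..1} \<Longrightarrow> w s t \<noteq> 0"
      using nonzero_tube[OF \<epsilon> cont(1) nz] by metis
    then show thesis using p by (intro that) auto
  qed
  let ?U = "{-\<delta><..<\<delta>} \<times> {0..1::real}"
  have sub: "?U \<subseteq> {-\<epsilon><..<\<epsilon>} \<times> {0..1}" using \<delta> by auto
  note contU = cont[THEN continuous_on_subset[OF _ sub], unfolded case_prod_unfold]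
  have regU: "regular_pow p (w (fst z) (snd z))" if "z \<in> ?U" for z using reg'[of "fst z" "snd z"] that by auto
  have cg: "continuous_on ?U (\<lambda>(s, t). grad_pow p (w s t) \<bullet> w1 s t)"
    unfolding case_prod_unfold by (intro continuous_on_inner continuous_grad_pow contU regU)
  have ch: "continuous_on ?U (\<lambda>(s, t). hess_pow p (w s t) (w1 s t) \<bullet> w1 s t + grad_pow p (w s t) \<bullet> w2 s t)"
    unfolding case_prod_unfold
    by (intro continuous_on_add continuous_on_inner continuous_grad_pow continuous_hess_pow contU regU)
  have slice: "continuous_on {0..1} (\<lambda>t. h s t)" if "continuous_on ?U (\<lambda>(s, t). h s t)" "s \<in> {-\<delta><..<\<delta>}"
    for h :: "real \<Rightarrow> real \<Rightarrow> real" and s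
    using that by (intro continuous_on_slice[OF that(1)]) auto
  have d1: "((\<lambda>s. norm (w s t) ^ p) has_real_derivative real p * (grad_pow p (w s t) \<bullet> w1 s t)) (at s)"
    if st: "s \<in> {-\<delta><..<\<delta>}" "t \<in> {0..1}" for s t
  proof -
    have "((\<lambda>s. w s t) has_derivative (\<lambda>r. r *\<^sub>R w1 s t)) (at s)"
      using d(1)[of s t] st \<delta>(2) by (simp add: has_vector_derivative_def)
    from has_derivative_compose[OF this has_derivative_norm_pow[OF reg'[OF st]]]
    show ?thesis unfolding has_field_derivative_def
      by (rule has_derivative_eq_rhs) (simp add: fun_eq_iff)
  qed
  have d2: "((\<lambda>s. grad_pow p (w s t) \<bullet> w1 s t) has_real_derivative
      hess_pow p (w s t) (w1 s t) \<bullet> w1 s t + grad_pow p (w s t) \<bullet> w2 s t) (at s)"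
    if st: "s \<in> {-\<delta><..<\<delta>}" "t \<in> {0..1}" for s t
  proof -
    have w: "((\<lambda>s. w s t) has_derivative (\<lambda>r. r *\<^sub>R w1 s t)) (at s)"
      and w1: "((\<lambda>s. w1 s t) has_derivative (\<lambda>r. r *\<^sub>R w2 s t)) (at s)"
      using d(1)[of s t] d(2)[of s t] st \<delta>(2) by (simp_all add: has_vector_derivative_def)
    have "hess_pow p (w s t) (r *\<^sub>R w1 s t) = r *\<^sub>R hess_pow p (w s t) (w1 s t)" for r
      by (simp add: hess_pow_def algebra_simps)
    note lin = this
    from has_derivative_inner[OF has_derivative_compose[OF w has_derivative_grad_pow[OF reg'[OF st]]] w1]
    show ?thesis unfolding has_field_derivative_def
      by (rule has_derivative_eq_rhs) (simp add: fun_eq_iff lin algebra_simps)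
  qed
  have "((\<lambda>s. integral {0..1} (\<lambda>t. norm (w s t) ^ p)) has_real_derivative
      real p * integral {0..1} (\<lambda>t. grad_pow p (w s t) \<bullet> w1 s t)) (at s)" if s: "s \<in> {-\<delta><..<\<delta>}" for s
  proof -
    have "continuous_on ?U (\<lambda>(s, t). norm (w s t) ^ p)"
      unfolding case_prod_unfold by (intro continuous_on_power continuous_on_norm contU)
    then have "continuous_on {0..1} (\<lambda>t. norm (w s t) ^ p)" if "s \<in> {-\<delta><..<\<delta>}" for s
      using that by (rule slice)
    moreover have "continuous_on ?U (\<lambda>(s, t). real p * (grad_pow p (w s t) \<bullet> w1 s t))"
      using continuous_on_mult_left[OF cg, of "real p"] by (simp add: case_prod_unfold)
    ultimately have "((\<lambda>s. integral {0..1} (\<lambda>t. norm (w s t) ^ p)) has_real_derivative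
        integral {0..1} (\<lambda>t. real p * (grad_pow p (w s t) \<bullet> w1 s t))) (at s)"
      by (intro has_real_derivative_integral[OF d1 _ _ s])
    then show ?thesis by simp
  qed
  then show ?first unfolding eventually_nhds
    using \<delta>(1) by (intro exI[of _ "{-\<delta><..<\<delta>}"]) auto
  have "((\<lambda>s. integral {0..1} (\<lambda>t. grad_pow p (w s t) \<bullet> w1 s t)) has_real_derivative
      integral {0..1} (\<lambda>t. hess_pow p (w 0 t) (w1 0 t) \<bullet> w1 0 t + grad_pow p (w 0 t) \<bullet> w2 0 t)) (at 0)"
    using \<delta>(1) by (intro has_real_derivative_integral[OF d2 slice[OF cg] ch]) auto
  then show ?second by (rule DERIV_cmult)
qed

section \<open>The Gauss equation\<close>

lemma sum_swap_pairs:
  fixes f :: "'a \<Rightarrow> 'b \<Rightarrow> 'c \<Rightarrow> 'd \<Rightarrow> 'e::comm_monoid_add"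
  shows "(\<Sum>j\<in>J. \<Sum>k\<in>K. \<Sum>i\<in>I. \<Sum>m\<in>M. f j k i m) = (\<Sum>i\<in>I. \<Sum>m\<in>M. \<Sum>j\<in>J. \<Sum>k\<in>K. f j k i m)"
proof -
  have "(\<Sum>j\<in>J. \<Sum>k\<in>K. \<Sum>i\<in>I. \<Sum>m\<in>M. f j k i m) = (\<Sum>j\<in>J. \<Sum>i\<in>I. \<Sum>k\<in>K. \<Sum>m\<in>M. f j k i m)"
    by (rule sum.cong[OF refl], rule sum.swap)
  also have "\<dots> = (\<Sum>i\<in>I. \<Sum>j\<in>J. \<Sum>k\<in>K. \<Sum>m\<in>M. f j k i m)" by (rule sum.swap)
  also have "\<dots> = (\<Sum>i\<in>I. \<Sum>j\<in>J. \<Sum>m\<in>M. \<Sum>k\<in>K. f j k i m)"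
    by (rule sum.cong[OF refl], rule sum.cong[OF refl], rule sum.swap)
  also have "\<dots> = (\<Sum>i\<in>I. \<Sum>m\<in>M. \<Sum>j\<in>J. \<Sum>k\<in>K. f j k i m)"
    by (rule sum.cong[OF refl], rule sum.swap)
  finally show ?thesis .
qed

context immersed_manifold
begin

abbreviation ddF :: "('m, 'n) chart \<Rightarrow> real ^ 'n \<Rightarrow> real ^ 'n \<Rightarrow> real ^ 'n \<Rightarrow> real ^ 'd" where
  "ddF c x Y Z \<equiv> frechet_derivative (\<lambda>y. differential F c y Z) (at x) Y"

abbreviation B :: "('m, 'n) chart \<Rightarrow> real ^ 'n \<Rightarrow> real ^ 'n \<Rightarrow> real ^ 'n \<Rightarrow> real ^ 'd" where
  "B \<equiv> second_ff F"

context
  fixes c assumes c: "c \<in> A"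
begin

lemma has_derivative_differential:
  "x \<in> img_c c \<Longrightarrow> ((\<lambda>y. differential F c y Z) has_derivative (\<lambda>Y. ddF c x Y Z)) (at x)"
  by (rule has_frechet_derivative[OF smooth_near_differentiable[OF smooth_near_differential[OF c]]])

lemma ddF_symmetric: "x \<in> img_c c \<Longrightarrow> ddF c x Y Z = ddF c x Z Y"
  unfolding differential_def
  by (rule smooth_on_symmetric_derivative[OF open_img[OF c]])
    (use isometric c in \<open>simp_all add: isometric_immersion_def\<close>)

lemma linear_ddF_left: "x \<in> img_c c \<Longrightarrow> linear (\<lambda>Y. ddF c x Y Z)"
  by (rule has_derivative_linear[OF has_derivative_differential])

lemma linear_ddF_right: "x \<in> img_c c \<Longrightarrow> linear (\<lambda>Z. ddF c x Y Z)"
  using linear_ddF_left[of x Y] ddF_symmetric[of x Y] by simp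

lemma second_ff_eq:
  assumes x: "x \<in> img_c c"
  shows "B c x Y Z = ddF c x Y Z - differential F c x (tangent_components c (ddF c x Y Z) x)"
    (is "_ = ?v - ?w")
  unfolding second_ff_def normal_part_def
proof (rule the_equality)
  have orth: "(?v - ?w) \<bullet> differential F c x U = 0" for U
    by (simp add: inner_diff_left tangent_components_inner[OF c x])
  then show "?v - ?w \<in> orthogonal_comp (range (differential F c x)) \<and> ?v - (?v - ?w) \<in> range (differential F c x)"
    by (auto simp: orthogonal_comp_def orthogonal_def inner_commute)
  fix u assume u: "u \<in> orthogonal_comp (range (differential F c x)) \<and> ?v - u \<in> range (differential F c x)"
  then obtain U where U: "?v - u = differential F c x U" by blast
  have ou: "u \<bullet> differential F c x U' = 0" for U'
    using u by (auto simp: orthogonal_comp_def orthogonal_def inner_commute)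
  have eq: "?v - ?w - u = differential F c x (U - tangent_components c ?v x)"
    using U by (simp add: linear_diff[OF linear_differential[OF c x]] algebra_simps)
  have "(?v - ?w - u) \<bullet> differential F c x U' = 0" for U'
    unfolding inner_diff_left[of "?v - ?w" u] orth ou by simp
  from this[of "U - tangent_components c ?v x"] have "?v - ?w - u = 0"
    unfolding eq[symmetric] by (simp only: inner_eq_zero_iff)
  then show "u = ?v - ?w" by simp
qed

lemma second_ff_orthogonal: "x \<in> img_c c \<Longrightarrow> B c x Y Z \<bullet> differential F c x U = 0"
  by (simp add: second_ff_eq inner_diff_left tangent_components_inner[OF c])

lemma second_ff_inner:
  assumes x: "x \<in> img_c c" and n: "\<And>U. n \<bullet> differential F c x U = 0"
  shows "n \<bullet> ddF c x Y Z = n \<bullet> B c x Y Z"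
  by (simp add: second_ff_eq[OF x] inner_diff_right n)

lemma second_ff_symmetric: "x \<in> img_c c \<Longrightarrow> B c x Y Z = B c x Z Y"
  by (simp add: second_ff_eq ddF_symmetric[of x Y Z])

lemma linear_tangent_components: "x \<in> img_c c \<Longrightarrow> linear (\<lambda>v. tangent_components c v x)"
  by (rule linearI) (simp_all add: tangent_components_def[OF c] vec_eq_iff inner_add_right
    distrib_left sum.distrib sum_distrib_left mult_ac)

lemma linear_second_ff: "x \<in> img_c c \<Longrightarrow> linear (B c x Y)"
proof -
  assume x: "x \<in> img_c c"
  show ?thesis
    unfolding second_ff_eq[OF x, abs_def]
    by (rule linear_compose_sub[OF linear_ddF_right[OF x]])
      (use linear_compose[OF linear_compose[OF linear_ddF_right[OF x] linear_tangent_components[OF x]] linear_differential[OF c x]]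
       in \<open>simp add: o_def\<close>)
qed

lemma second_ff_sum_right: "x \<in> img_c c \<Longrightarrow> B c x Y Z = (\<Sum>j\<in>UNIV. Z $ j *\<^sub>R B c x Y (axis j 1))"
proof -
  assume x: "x \<in> img_c c"
  note l = linear_second_ff[OF x]
  have "B c x Y Z = B c x Y (\<Sum>j\<in>UNIV. Z $ j *\<^sub>R axis j 1)"
    by (simp add: basis_expansion scalar_mult_eq_scaleR[symmetric])
  also have "\<dots> = (\<Sum>j\<in>UNIV. Z $ j *\<^sub>R B c x Y (axis j 1))"
    unfolding linear_sum[OF l] linear_scale[OF l] ..
  finally show ?thesis .
qed

lemma second_ff_sum_left: "x \<in> img_c c \<Longrightarrow> B c x Y Z = (\<Sum>i\<in>UNIV. Y $ i *\<^sub>R B c x (axis i 1) Z)"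
  using second_ff_sum_right[of x Z Y] second_ff_symmetric by simp

lemma second_ff_0: "x \<in> img_c c \<Longrightarrow> B c x 0 0 = 0"
  using linear_0[OF linear_second_ff] .

abbreviation "\<F> x i j \<equiv> ddF c x (axis i 1) (axis j 1)"
abbreviation "\<B> x i j \<equiv> B c x (axis i 1) (axis j 1)"

lemma pderivative_metric:
  assumes x: "x \<in> img_c c"
  shows "pderivative i (\<lambda>y. g c y $ j $ q) x = \<F> x i j \<bullet> frame c x q + frame c x j \<bullet> \<F> x i q"
proof -
  have "((\<lambda>y. frame c y j \<bullet> frame c y q) has_derivative
      (\<lambda>Y. frame c x j \<bullet> ddF c x Y (axis q 1) + ddF c x Y (axis j 1) \<bullet> frame c x q)) (at x)"
    unfolding frame_def[OF c] by (rule has_derivative_inner[OF has_derivative_differential[OF x] has_derivative_differential[OF x]])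
  then have "((\<lambda>y. g c y $ j $ q) has_derivative
      (\<lambda>Y. frame c x j \<bullet> ddF c x Y (axis q 1) + ddF c x Y (axis j 1) \<bullet> frame c x q)) (at x)"
    by (rule has_derivative_transform_within_open[OF _ open_img[OF c] x]) (simp add: frame_inner[OF c])
  from frechet_derivative_eqI[OF this] show ?thesis by (simp add: pderivative_def)
qed

text \<open>As \<open>g\<close> is the Gram matrix of the frame \<open>F\<^sub>i\<close>, the derivatives of \<open>g\<close> in the definition of the Christoffel symbols
  combine to twice the inner product of the second derivative \<open>F\<^sub>i\<^sub>j\<close> with \<open>F\<^sub>q\<close>.\<close>

lemma christoffel_eq:
  assumes x: "x \<in> img_c c"
  shows "christoffel g c l i j x = tangent_components c (\<F> x i j) x $ l"
proof -
  have "pderivative i (\<lambda>y. g c y $ j $ q) x + pderivative j (\<lambda>y. g c y $ i $ q) x - pderivative q (\<lambda>y. g c y $ i $ j) x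
      = 2 * (frame c x q \<bullet> \<F> x i j)" for q
    unfolding pderivative_metric[OF x]
    by (simp add: ddF_symmetric[OF x, of "axis j 1" "axis i 1"] ddF_symmetric[OF x, of "axis q 1"] inner_commute)
  then have "christoffel g c l i j x = 1 / 2 * (\<Sum>q\<in>UNIV. ginv c x $ l $ q * (2 * (frame c x q \<bullet> \<F> x i j)))"
    unfolding christoffel_def by simp
  also have "\<dots> = tangent_components c (\<F> x i j) x $ l"
    by (simp add: tangent_components_def[OF c] sum_distrib_left mult_ac)
  finally show ?thesis .
qed

lemma gauss_formula:
  assumes x: "x \<in> img_c c"
  shows "\<F> x i j = (\<Sum>l\<in>UNIV. christoffel g c l i j x *\<^sub>R frame c x l) + \<B> x i j"
  by (simp add: second_ff_eq[OF x] christoffel_eq[OF x] differential_frame[OF c x])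

lemma smooth_near_ddF: "x \<in> img_c c \<Longrightarrow> smooth_near (\<lambda>x. ddF c x Y Z) x"
  by (rule smooth_near_frechet[OF smooth_near_differential[OF c]])

text \<open>The Riemann tensor contains derivatives of the Christoffel symbols, so these have to exist.\<close>

lemma smooth_near_christoffel: "x \<in> img_c c \<Longrightarrow> smooth_near (christoffel g c l i j) x"
proof -
  assume x: "x \<in> img_c c"
  have "smooth_near (\<lambda>x. axis l 1 \<bullet> tangent_components c (\<F> x i j) x) x"
    by (intro smooth_near_inner smooth_near_const smooth_near_tangent_components[OF c x] smooth_near_ddF[OF x])
  then show ?thesis
    by (rule smooth_near_cong_open[OF _ open_img[OF c] x]) (simp add: christoffel_eq inner_axis')
qed

lemma smooth_near_second_ff: "x \<in> img_c c \<Longrightarrow> smooth_near (\<lambda>x. \<B> x i j) x"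
proof -
  assume x: "x \<in> img_c c"
  have "smooth_near (\<lambda>x. \<F> x i j - (\<Sum>l\<in>UNIV. christoffel g c l i j x *\<^sub>R frame c x l)) x"
    unfolding frame_def[OF c]
    by (intro smooth_near_diff smooth_near_sum smooth_near_scaleR smooth_near_ddF[OF x] smooth_near_christoffel[OF x]
      smooth_near_differential[OF c x])
  then show ?thesis
    by (rule smooth_near_cong_open[OF _ open_img[OF c] x]) (simp add: gauss_formula)
qed

text \<open>Differentiating the Gauss formula along the \<open>i\<close>-th coordinate field and projecting to the tangent
  space. The normal part contributes because \<open>B\<close> stays orthogonal to the frame.\<close>

lemma third_derivative_tangential:
  assumes x: "x \<in> img_c c"
  shows "frechet_derivative (\<lambda>y. \<F> y j k) (at x) (axis i 1) \<bullet> frame c x m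
    = (\<Sum>l\<in>UNIV. (pderivative i (christoffel g c l j k) x
        + (\<Sum>q\<in>UNIV. christoffel g c l i q x * christoffel g c q j k x)) * g c x $ l $ m)
      - \<B> x j k \<bullet> \<B> x i m"
proof -
  let ?\<Gamma> = "\<lambda>l j k. christoffel g c l j k"
  let ?e = "axis i 1 :: real ^ 'n"
  let ?dB = "frechet_derivative (\<lambda>y. \<B> y j k) (at x)"
  have d\<Gamma>: "(?\<Gamma> l j k has_derivative frechet_derivative (?\<Gamma> l j k) (at x)) (at x)" for l
    by (rule has_frechet_derivative[OF smooth_near_differentiable[OF smooth_near_christoffel[OF x]]])
  have dB: "((\<lambda>y. \<B> y j k) has_derivative ?dB) (at x)"
    by (rule has_frechet_derivative[OF smooth_near_differentiable[OF smooth_near_second_ff[OF x]]])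
  have "((\<lambda>y. (\<Sum>l\<in>UNIV. ?\<Gamma> l j k y *\<^sub>R frame c y l) + \<B> y j k) has_derivative
      (\<lambda>Y. (\<Sum>l\<in>UNIV. ?\<Gamma> l j k x *\<^sub>R ddF c x Y (axis l 1) + frechet_derivative (?\<Gamma> l j k) (at x) Y *\<^sub>R frame c x l) + ?dB Y)) (at x)"
    unfolding frame_def[OF c]
    by (intro has_derivative_add has_derivative_sum has_derivative_scaleR d\<Gamma> dB has_derivative_differential[OF x])
  then have "((\<lambda>y. \<F> y j k) has_derivative
      (\<lambda>Y. (\<Sum>l\<in>UNIV. ?\<Gamma> l j k x *\<^sub>R ddF c x Y (axis l 1) + frechet_derivative (?\<Gamma> l j k) (at x) Y *\<^sub>R frame c x l) + ?dB Y)) (at x)"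
    by (rule has_derivative_transform_within_open[OF _ open_img[OF c] x]) (simp add: gauss_formula)
  then have 1: "frechet_derivative (\<lambda>y. \<F> y j k) (at x) ?e
      = (\<Sum>l\<in>UNIV. ?\<Gamma> l j k x *\<^sub>R \<F> x i l + pderivative i (?\<Gamma> l j k) x *\<^sub>R frame c x l) + ?dB ?e"
    by (simp add: frechet_derivative_eqI pderivative_def)
  have "((\<lambda>y. \<B> y j k \<bullet> frame c y m) has_derivative (\<lambda>Y. \<B> x j k \<bullet> ddF c x Y (axis m 1) + ?dB Y \<bullet> frame c x m)) (at x)"
    unfolding frame_def[OF c] by (rule has_derivative_inner[OF dB has_derivative_differential[OF x]])
  then have "((\<lambda>y. 0 :: real) has_derivative (\<lambda>Y. \<B> x j k \<bullet> ddF c x Y (axis m 1) + ?dB Y \<bullet> frame c x m)) (at x)"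
    by (rule has_derivative_transform_within_open[OF _ open_img[OF c] x]) (simp add: frame_def[OF c] second_ff_orthogonal)
  then have "(\<lambda>Y. \<B> x j k \<bullet> ddF c x Y (axis m 1) + ?dB Y \<bullet> frame c x m) = (\<lambda>Y. 0)"
    using has_derivative_unique[OF _ has_derivative_const] by blast
  from fun_cong[OF this, of ?e] have 2: "?dB ?e \<bullet> frame c x m = - (\<B> x j k \<bullet> \<B> x i m)"
    using second_ff_inner[OF x second_ff_orthogonal[OF x], of "axis j 1" "axis k 1" "axis m 1" ?e]
    by (simp add: second_ff_symmetric[OF x, of "axis m 1" ?e] ddF_symmetric[OF x, of "axis m 1" ?e])
  have 3: "\<F> x i l \<bullet> frame c x m = (\<Sum>q\<in>UNIV. ?\<Gamma> q i l x * g c x $ q $ m)" for l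
  proof -
    have "\<F> x i l = (\<Sum>q\<in>UNIV. ?\<Gamma> q i l x *\<^sub>R frame c x q) + \<B> x i l" by (rule gauss_formula[OF x])
    moreover have "\<B> x i l \<bullet> frame c x m = 0" by (simp add: frame_def[OF c] second_ff_orthogonal[OF x])
    ultimately show ?thesis by (simp add: inner_add_left inner_sum_left frame_inner[OF c x])
  qed
  have "(\<Sum>l\<in>UNIV. ?\<Gamma> l j k x * (\<Sum>q\<in>UNIV. ?\<Gamma> q i l x * g c x $ q $ m))
      = (\<Sum>l\<in>UNIV. (\<Sum>q\<in>UNIV. ?\<Gamma> l i q x * ?\<Gamma> q j k x) * g c x $ l $ m)"
    unfolding sum_distrib_left sum_distrib_right by (subst sum.swap) (simp add: mult_ac)
  then show ?thesis
    unfolding 1 by (simp add: inner_add_left inner_sum_left 2 3 frame_inner[OF c x] sum.distrib distrib_right)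
qed

text \<open>The third derivatives of \<open>F\<close> are symmetric. Antisymmetrising \<open>third_derivative_tangential\<close> in \<open>i\<close> and \<open>j\<close>
  therefore removes its left-hand side and leaves the curvature.\<close>

theorem gauss_equation:
  assumes x: "x \<in> img_c c"
  shows "(\<Sum>l\<in>UNIV. riemann g c l i j k x * g c x $ l $ m)
    = \<B> x j k \<bullet> \<B> x i m - \<B> x i k \<bullet> \<B> x j m"
proof -
  have "frechet_derivative (\<lambda>y. \<F> y j k) (at x) (axis i 1) = frechet_derivative (\<lambda>y. \<F> y i k) (at x) (axis j 1)"
    by (rule smooth_on_symmetric_derivative[OF open_img[OF c] smooth_near_imp_on x])
      (rule smooth_near_differential[OF c])
  with third_derivative_tangential[OF x, where i = i and j = j and k = k and m = m]
    third_derivative_tangential[OF x, where i = j and j = i and k = k and m = m]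
  show ?thesis
    unfolding riemann_def
    by (simp add: sum_subtractf left_diff_distrib distrib_right sum.distrib algebra_simps)
qed

text \<open>The trace of the Gauss equation.\<close>

lemma ricci_eq:
  assumes x: "x \<in> img_c c"
  shows "ricci g c x Y Y = mean_curvature g F c x \<bullet> B c x Y Y
    - (\<Sum>i\<in>UNIV. \<Sum>m\<in>UNIV. ginv c x $ i $ m * (B c x (axis i 1) Y \<bullet> B c x (axis m 1) Y))"
proof -
  have R: "riemann g c i i j k x = (\<Sum>m\<in>UNIV. ginv c x $ i $ m * (\<B> x j k \<bullet> \<B> x i m - \<B> x i k \<bullet> \<B> x j m))" for i j k
  proof -
    have "(\<Sum>m\<in>UNIV. ginv c x $ i $ m * (\<Sum>l\<in>UNIV. riemann g c l i j k x * g c x $ l $ m))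
        = (\<Sum>l\<in>UNIV. riemann g c l i j k x * (\<Sum>m\<in>UNIV. ginv c x $ i $ m * g c x $ m $ l))"
      unfolding sum_distrib_left by (subst sum.swap) (simp add: metric_symmetric[OF c x] mult_ac)
    also have "\<dots> = riemann g c i i j k x" by (simp add: ginv_mult[OF c x] if_distrib cong: if_cong)
    finally show ?thesis unfolding gauss_equation[OF x] by simp
  qed
  have "(\<Sum>i\<in>UNIV. riemann g c i i j k x) = mean_curvature g F c x \<bullet> \<B> x j k
      - (\<Sum>i\<in>UNIV. \<Sum>m\<in>UNIV. ginv c x $ i $ m * (\<B> x i k \<bullet> \<B> x m j))" for j k
  proof -
    have "mean_curvature g F c x \<bullet> \<B> x j k = (\<Sum>i\<in>UNIV. \<Sum>m\<in>UNIV. ginv c x $ i $ m * (\<B> x j k \<bullet> \<B> x i m))"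
      by (simp add: mean_curvature_def inner_sum_left inner_commute[of "\<B> x j k"])
    moreover have "\<B> x m j = \<B> x j m" for m by (rule second_ff_symmetric[OF x])
    ultimately show ?thesis unfolding R by (simp add: right_diff_distrib sum_subtractf)
  qed
  then have "ricci g c x Y Y = (\<Sum>j\<in>UNIV. \<Sum>k\<in>UNIV. Y $ j * Y $ k * (mean_curvature g F c x \<bullet> \<B> x j k))
      - (\<Sum>j\<in>UNIV. \<Sum>k\<in>UNIV. Y $ j * Y $ k * (\<Sum>i\<in>UNIV. \<Sum>m\<in>UNIV. ginv c x $ i $ m * (\<B> x i k \<bullet> \<B> x m j)))"
    unfolding ricci_def by (simp add: right_diff_distrib sum_subtractf)
  also have "(\<Sum>j\<in>UNIV. \<Sum>k\<in>UNIV. Y $ j * Y $ k * (mean_curvature g F c x \<bullet> \<B> x j k)) = mean_curvature g F c x \<bullet> B c x Y Y"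
    unfolding second_ff_sum_left[OF x, of Y Y]
    by (simp add: second_ff_sum_right[OF x, of _ Y] inner_sum_right sum_distrib_left mult_ac)
  also have "(\<Sum>j\<in>UNIV. \<Sum>k\<in>UNIV. Y $ j * Y $ k * (\<Sum>i\<in>UNIV. \<Sum>m\<in>UNIV. ginv c x $ i $ m * (\<B> x i k \<bullet> \<B> x m j)))
      = (\<Sum>i\<in>UNIV. \<Sum>m\<in>UNIV. \<Sum>j\<in>UNIV. \<Sum>k\<in>UNIV. ginv c x $ i $ m * (Y $ j * Y $ k * (\<B> x i k \<bullet> \<B> x m j)))"
    unfolding sum_distrib_left by (subst sum_swap_pairs) (simp only: mult_ac)
  also have "\<dots> = (\<Sum>i\<in>UNIV. \<Sum>m\<in>UNIV. ginv c x $ i $ m * (B c x (axis i 1) Y \<bullet> B c x (axis m 1) Y))"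
    by (simp add: second_ff_sum_right[OF x, of _ Y] inner_sum_left inner_sum_right sum_distrib_left mult_ac)
  finally show ?thesis .
qed

end

definition velocity_field :: "(real \<Rightarrow> 'm \<Rightarrow> 'm) \<Rightarrow> 'm \<Rightarrow> real ^ 'd" where
  "velocity_field \<psi> m = vector_derivative (\<lambda>s. F (\<psi> s m)) (at 0)"

definition acceleration_field :: "(real \<Rightarrow> 'm \<Rightarrow> 'm) \<Rightarrow> 'm \<Rightarrow> real ^ 'd" where
  "acceleration_field \<psi> m = vector_derivative (\<lambda>s. vector_derivative (\<lambda>s. F (\<psi> s m)) (at s)) (at 0)"

lemma smooth_acceleration_field: "smooth_family \<epsilon> \<psi> \<Longrightarrow> smooth_fun (acceleration_field \<psi>)"
proof -
  assume \<psi>: "smooth_family \<epsilon> \<psi>"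
  have "smooth_at (\<lambda>s m. vector_derivative (\<lambda>s. vector_derivative (\<lambda>s. F (\<psi> s m)) (at s)) (at s)) 0 m" for m
    by (intro smooth_at_par smooth_at_F_family[OF \<psi>]) (use smooth_family_eps[OF \<psi>] in simp)
  from smooth_at_imp_smooth_fun[OF this] show ?thesis unfolding acceleration_field_def[abs_def] .
qed

context
  fixes c assumes c: "c \<in> A"
begin

text \<open>Product rule. The point may leave the chart image for distant parameters, where \<open>differential\<close> has no
  meaning; by continuity it stays inside for nearby ones.\<close>

lemma has_vector_derivative_differential_apply:
  fixes x z :: "real \<Rightarrow> real ^ 'n"
  assumes x: "(x has_vector_derivative x') (at t within S)" "x t \<in> img_c c"
    and z: "(z has_vector_derivative z') (at t within S)" and t: "t \<in> S"
  shows "((\<lambda>t. differential F c (x t) (z t)) has_vector_derivative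
    ddF c (x t) x' (z t) + differential F c (x t) z') (at t within S)"
proof -
  have xd: "(x has_derivative (\<lambda>r. r *\<^sub>R x')) (at t within S)"
    using x(1) unfolding has_vector_derivative_def .
  have zi: "((\<lambda>t. z t $ i) has_derivative (\<lambda>r. r * z' $ i)) (at t within S)" for i
    using bounded_linear.has_derivative[OF bounded_linear_vec_nth z[unfolded has_vector_derivative_def], of i] by simp
  have fi: "((\<lambda>t. frame c (x t) i) has_derivative (\<lambda>r. r *\<^sub>R ddF c (x t) x' (axis i 1))) (at t within S)" for i
    using has_derivative_compose[OF xd has_derivative_differential[OF c x(2), of "axis i 1"]]
    by (simp add: frame_def[OF c] linear_scale[OF linear_ddF_left[OF c x(2)]])
  have "((\<lambda>t. \<Sum>i\<in>UNIV. z t $ i *\<^sub>R frame c (x t) i) has_derivative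
      (\<lambda>r. \<Sum>i\<in>UNIV. z t $ i *\<^sub>R (r *\<^sub>R ddF c (x t) x' (axis i 1)) + (r * z' $ i) *\<^sub>R frame c (x t) i)) (at t within S)"
    by (intro has_derivative_sum has_derivative_scaleR zi fi)
  moreover have "(\<Sum>i\<in>UNIV. z t $ i *\<^sub>R (r *\<^sub>R ddF c (x t) x' (axis i 1)) + (r * z' $ i) *\<^sub>R frame c (x t) i)
      = r *\<^sub>R (ddF c (x t) x' (z t) + differential F c (x t) z')" for r
  proof -
    have "ddF c (x t) x' (z t) = ddF c (x t) x' (\<Sum>i\<in>UNIV. z t $ i *\<^sub>R axis i 1)"
      by (simp add: basis_expansion scalar_mult_eq_scaleR[symmetric])
    also have "\<dots> = (\<Sum>i\<in>UNIV. z t $ i *\<^sub>R ddF c (x t) x' (axis i 1))"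
      unfolding linear_sum[OF linear_ddF_right[OF c x(2)]] linear_scale[OF linear_ddF_right[OF c x(2)]] ..
    finally show ?thesis
      unfolding differential_frame[OF c x(2)]
      by (simp add: sum.distrib scaleR_right_distrib scaleR_sum_right mult_ac)
  qed
  ultimately have "((\<lambda>t. \<Sum>i\<in>UNIV. z t $ i *\<^sub>R frame c (x t) i) has_derivative
      (\<lambda>r. r *\<^sub>R (ddF c (x t) x' (z t) + differential F c (x t) z'))) (at t within S)" by simp
  then have "((\<lambda>t. differential F c (x t) (z t)) has_derivative
      (\<lambda>r. r *\<^sub>R (ddF c (x t) x' (z t) + differential F c (x t) z'))) (at t within S)"
  proof (rule has_derivative_transform_eventually)
    have "continuous (at t within S) x" by (rule has_vector_derivative_continuous[OF x(1)])
    then have "\<forall>\<^sub>F \<tau> in at t within S. x \<tau> \<in> img_c c"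
      using topological_tendstoD[OF _ open_img[OF c] x(2)] unfolding continuous_within by blast
    then show "\<forall>\<^sub>F \<tau> in at t within S. (\<Sum>i\<in>UNIV. z \<tau> $ i *\<^sub>R frame c (x \<tau>) i) = differential F c (x \<tau>) (z \<tau>)"
      by (rule eventually_mono) (simp add: differential_frame[OF c])
  qed (use t in \<open>simp_all add: differential_frame[OF c x(2)]\<close>)
  then show ?thesis unfolding has_vector_derivative_def .
qed

lemma family_in_chart:
  assumes \<psi>: "smooth_family \<epsilon> \<psi>" and m: "m \<in> dom_c c"
  obtains y1 y2 where "((\<lambda>s. F (\<psi> s m)) has_vector_derivative differential F c (coord c m) y1) (at 0)"
    "acceleration_field \<psi> m = ddF c (coord c m) y1 y1 + differential F c (coord c m) y2"
proof -
  define y where "y s = coord c (\<psi> s m)" for s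
  define y' where "y' s = vector_derivative y (at s)" for s
  have y0: "y 0 = coord c m" by (simp add: y_def smooth_family_0[OF \<psi>])
  note stay = family_stays_in_chart[OF \<psi> c m]
  have sm: "smooth_at (\<lambda>s m. coord c (\<psi> s m)) s m" if "s \<in> {-\<epsilon><..<\<epsilon>}" "\<psi> s m \<in> dom_c c" for s
    by (rule smooth_family_smooth[OF \<psi> that(1) c that(2)])
  have dy: "(y has_vector_derivative y' s) (at s)" if "s \<in> {-\<epsilon><..<\<epsilon>}" "\<psi> s m \<in> dom_c c" for s
    using smooth_at_has_derivative[OF sm[OF that]] unfolding y'_def y_def .
  have z: "(0::real) \<in> {-\<epsilon><..<\<epsilon>}" "\<psi> 0 m \<in> dom_c c"
    using smooth_family_eps[OF \<psi>] smooth_family_0[OF \<psi>] m by simp_all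
  obtain y2 where dy2: "(y' has_vector_derivative y2) (at 0)"
    using smooth_at_has_derivative[OF smooth_at_par[OF sm[OF z]]] unfolding y'_def y_def by blast
  obtain S where S: "open S" "0 \<in> S" "\<And>s. s \<in> S \<Longrightarrow> s \<in> {-\<epsilon><..<\<epsilon>}" "\<And>s. s \<in> S \<Longrightarrow> \<psi> s m \<in> dom_c c"
    using stay unfolding eventually_nhds by blast
  have u: "((\<lambda>s. F (\<psi> s m)) has_vector_derivative differential F c (y s) (y' s)) (at s)" if s: "s \<in> S" for s
  proof -
    have ys: "y s \<in> img_c c" using coord_in_img[OF c S(4)[OF s]] by (simp add: y_def)
    have "((\<lambda>s. local_rep F c (y s)) has_vector_derivative differential F c (y s) (y' s)) (at s)"
      by (rule has_vector_derivative_chain[OF dy[OF S(3)[OF s] S(4)[OF s]] differential_has_derivative[OF c ys]])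
    then show ?thesis
      by (rule has_vector_derivative_transform_within_open[OF _ S(1) s]) (simp add: local_rep_def y_def param_coord[OF c S(4)])
  qed
  have "((\<lambda>s. differential F c (y s) (y' s)) has_vector_derivative
      ddF c (y 0) (y' 0) (y' 0) + differential F c (y 0) y2) (at 0)"
    by (rule has_vector_derivative_differential_apply[OF dy[OF z] _ dy2]) (simp_all add: y0 coord_in_img[OF c m])
  then have "((\<lambda>s. vector_derivative (\<lambda>s. F (\<psi> s m)) (at s)) has_vector_derivative
      ddF c (y 0) (y' 0) (y' 0) + differential F c (y 0) y2) (at 0)"
    by (rule has_vector_derivative_transform_within_open[OF _ S(1,2)]) (simp add: vector_derivative_at[OF u])
  then have "acceleration_field \<psi> m = ddF c (y 0) (y' 0) (y' 0) + differential F c (y 0) y2"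
    unfolding acceleration_field_def by (rule vector_derivative_at)
  with u[OF S(2)] show thesis unfolding y0 by (rule that)
qed

lemma tangent_components_unique:
  assumes m: "m \<in> dom_c c" and "is_tangential_part m v (differential F c (coord c m) y)"
  shows "y = tangent_components c v (coord c m)"
  using is_tangential_part_unique[OF assms(2) is_tangential_part_components[OF c m]]
    inj_differential[OF c coord_in_img[OF c m]] by (simp add: inj_eq)

text \<open>In a chart the deformation of \<open>m\<close> is a curve \<open>y\<close> with \<open>y' 0\<close> the tangential part of \<open>v\<close>, and the acceleration is
  \<open>ddF (y', y') + dF y''\<close>. The second term is tangential, hence the normal part is \<open>B (y', y')\<close>.\<close>

lemma normal_acceleration:
  assumes \<psi>: "smooth_family \<epsilon> \<psi>" and m: "m \<in> dom_c c" and r: "realises \<psi> m v"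
    and w: "is_tangential_part m (acceleration_field \<psi> m) w"
  shows "acceleration_field \<psi> m - w = B c (coord c m) (tangent_components c v (coord c m)) (tangent_components c v (coord c m))"
proof -
  let ?x = "coord c m"
  note x = coord_in_img[OF c m]
  obtain y1 y2 where y: "((\<lambda>s. F (\<psi> s m)) has_vector_derivative differential F c ?x y1) (at 0)"
    "acceleration_field \<psi> m = ddF c ?x y1 y1 + differential F c ?x y2"
    using family_in_chart[OF \<psi> m] by metis
  obtain w1 where w1: "((\<lambda>s. F (\<psi> s m)) has_vector_derivative w1) (at 0)" "is_tangential_part m v w1"
    using r unfolding realises_def by blast
  have "w1 = differential F c ?x y1" by (rule vector_derivative_unique_at[OF w1(1) y(1)])
  then have y1: "y1 = tangent_components c v ?x" using tangent_components_unique[OF m] w1(2) by blast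
  let ?N = "acceleration_field \<psi> m - w"
  obtain Z where Z: "w = differential F c ?x Z"
    using w unfolding is_tangential_part_def tangent_space_chart[OF c m] by blast
  have orth: "?N \<bullet> differential F c ?x U = 0" for U
    using w unfolding is_tangential_part_def tangent_space_chart[OF c m] by (simp add: inner_diff_left)
  have "?N - B c ?x y1 y1 = differential F c ?x (y2 - Z + tangent_components c (ddF c ?x y1 y1) ?x)"
    unfolding y(2) Z second_ff_eq[OF c x]
    by (simp add: linear_add[OF linear_differential[OF c x]] linear_diff[OF linear_differential[OF c x]])
  moreover have "(?N - B c ?x y1 y1) \<bullet> differential F c ?x U = 0" for U
    unfolding inner_diff_left[of ?N] orth second_ff_orthogonal[OF c x] by simp
  ultimately have "(?N - B c ?x y1 y1) \<bullet> (?N - B c ?x y1 y1) = 0" by metis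
  then have "?N - B c ?x y1 y1 = 0" by (simp only: inner_eq_zero_iff)
  then show ?thesis unfolding y1 by simp
qed

context
  fixes k :: nat and \<gamma> :: "real \<Rightarrow> 'm" and t :: real
  assumes \<gamma>: "curve_Ck A k \<gamma>" "1 \<le> k" and t: "t \<in> {0..1}" "\<gamma> t \<in> dom_c c"
begin

abbreviation (input) "\<xi>\<^sub>t \<equiv> velocity c \<gamma> t"
abbreviation (input) "x\<^sub>t \<equiv> coord c (\<gamma> t)"

lemma derivative_differential_along_curve:
  assumes "(z has_vector_derivative z') (at t within {0..1})"
  shows "((\<lambda>\<tau>. differential F c (coord c (\<gamma> \<tau>)) (z \<tau>)) has_vector_derivative
    ddF c x\<^sub>t \<xi>\<^sub>t (z t) + differential F c x\<^sub>t z') (at t within {0..1})"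
  using has_vector_derivative_differential_apply[OF has_vector_derivative_velocity(1)[OF \<gamma> c t] _ assms t(1)]
  by (simp add: coord_in_img[OF c t(2)])

text \<open>Differentiate the relation \<open>u \<bullet> dF Z = v \<bullet> dF Z\<close> along the curve, for a constant \<open>Z\<close>. Since \<open>v - u\<close> is normal, only
  the normal part of the derivative of \<open>dF Z\<close> matters.\<close>

lemma derivative_of_inner_relation:
  assumes u: "(u has_vector_derivative u') (at t within {0..1})"
    and rel: "\<And>\<tau> y. \<tau> \<in> {0..1} \<Longrightarrow> y \<in> tangent_space (\<gamma> \<tau>) \<Longrightarrow> u \<tau> \<bullet> y = v \<bullet> y"
  shows "u' \<bullet> differential F c x\<^sub>t Z = (v - u t) \<bullet> B c x\<^sub>t \<xi>\<^sub>t Z"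
proof -
  note x = coord_in_img[OF c t(2)]
  have dZ: "((\<lambda>\<tau>. differential F c (coord c (\<gamma> \<tau>)) Z) has_vector_derivative ddF c x\<^sub>t \<xi>\<^sub>t Z) (at t within {0..1})"
    using derivative_differential_along_curve[OF has_vector_derivative_const, of Z]
    by (simp add: linear_0[OF linear_differential[OF c x]])
  have d: "((\<lambda>\<tau>. (u \<tau> - v) \<bullet> differential F c (coord c (\<gamma> \<tau>)) Z) has_derivative
      (\<lambda>r. (u t - v) \<bullet> (r *\<^sub>R ddF c x\<^sub>t \<xi>\<^sub>t Z) + (r *\<^sub>R u' - 0) \<bullet> differential F c x\<^sub>t Z)) (at t within {0..1})"
    using u dZ unfolding has_vector_derivative_def
    by (intro has_derivative_inner has_derivative_diff has_derivative_const)
  obtain e where e: "e > 0" "\<And>\<tau>. \<tau> \<in> {0..1} \<Longrightarrow> dist \<tau> t < e \<Longrightarrow> \<gamma> \<tau> \<in> dom_c c"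
    using has_vector_derivative_velocity(3)[OF \<gamma> c t] by blast
  have "((\<lambda>\<tau>. 0) has_derivative (\<lambda>r. (u t - v) \<bullet> (r *\<^sub>R ddF c x\<^sub>t \<xi>\<^sub>t Z) + (r *\<^sub>R u' - 0) \<bullet> differential F c x\<^sub>t Z)) (at t within {0..1})"
  proof (rule has_derivative_transform_within[OF d e(1) t(1)])
    fix \<tau> assume \<tau>: "\<tau> \<in> {0..1}" "dist \<tau> t < e"
    have "differential F c (coord c (\<gamma> \<tau>)) Z \<in> tangent_space (\<gamma> \<tau>)"
      unfolding tangent_space_chart[OF c e(2)[OF \<tau>]] by blast
    then show "(u \<tau> - v) \<bullet> differential F c (coord c (\<gamma> \<tau>)) Z = 0" using rel[OF \<tau>(1)] by (simp add: inner_diff_left)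
  qed
  then have "((\<lambda>\<tau>. 0) has_vector_derivative (u t - v) \<bullet> ddF c x\<^sub>t \<xi>\<^sub>t Z + u' \<bullet> differential F c x\<^sub>t Z) (at t within {0..1})"
    unfolding has_vector_derivative_def by (rule has_derivative_eq_rhs) (simp add: fun_eq_iff algebra_simps)
  moreover have "at t within {0..1} \<noteq> bot" using islimpt_Icc_unit[OF t(1)] by (simp add: trivial_limit_within)
  ultimately have "(u t - v) \<bullet> ddF c x\<^sub>t \<xi>\<^sub>t Z + u' \<bullet> differential F c x\<^sub>t Z = 0"
    using vector_derivative_unique_within[OF _ _ has_vector_derivative_const] by blast
  moreover have "(u t - v) \<bullet> ddF c x\<^sub>t \<xi>\<^sub>t Z = (u t - v) \<bullet> B c x\<^sub>t \<xi>\<^sub>t Z"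
  proof (rule second_ff_inner[OF c x])
    fix U
    have "differential F c x\<^sub>t U \<in> tangent_space (\<gamma> t)" unfolding tangent_space_chart[OF c t(2)] by blast
    then show "(u t - v) \<bullet> differential F c x\<^sub>t U = 0" using rel[OF t(1)] by (simp add: inner_diff_left)
  qed
  ultimately show ?thesis by (simp add: inner_diff_left)
qed

text \<open>The first part gives the tangential component of \<open>V'\<close>. The normal one comes from writing \<open>V\<close> as \<open>dF\<close> of its
  components and using the product rule.\<close>

lemma derivative_tangential_field:
  assumes V: "(V has_vector_derivative V') (at t within {0..1})"
    and tang: "\<And>\<tau>. \<tau> \<in> {0..1} \<Longrightarrow> is_tangential_part (\<gamma> \<tau>) v (V \<tau>)"
  shows "V' \<bullet> differential F c x\<^sub>t Z = v \<bullet> B c x\<^sub>t \<xi>\<^sub>t Z"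
    and "\<exists>Y. V' = differential F c x\<^sub>t Y + B c x\<^sub>t \<xi>\<^sub>t (tangent_components c v x\<^sub>t)"
proof -
  note x = coord_in_img[OF c t(2)]
  have Vt: "V \<tau> = differential F c (coord c (\<gamma> \<tau>)) (tangent_components c v (coord c (\<gamma> \<tau>)))"
    if "\<tau> \<in> {0..1}" "\<gamma> \<tau> \<in> dom_c c" for \<tau>
    by (rule is_tangential_part_unique[OF tang[OF that(1)] is_tangential_part_components[OF c that(2)]])
  have "V' \<bullet> differential F c x\<^sub>t Z = (v - V t) \<bullet> B c x\<^sub>t \<xi>\<^sub>t Z"
    by (rule derivative_of_inner_relation[OF V]) (use tang in \<open>simp add: is_tangential_part_def\<close>)
  moreover have "V t \<bullet> B c x\<^sub>t \<xi>\<^sub>t Z = 0"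
    unfolding Vt[OF t] by (subst inner_commute) (rule second_ff_orthogonal[OF c x])
  ultimately show "V' \<bullet> differential F c x\<^sub>t Z = v \<bullet> B c x\<^sub>t \<xi>\<^sub>t Z" by (simp add: inner_diff_left)
  let ?tc = "\<lambda>y. tangent_components c v y"
  have "(?tc has_derivative frechet_derivative ?tc (at x\<^sub>t)) (at x\<^sub>t)"
    by (rule has_frechet_derivative[OF smooth_near_differentiable[OF smooth_near_tangent_components[OF c x smooth_near_const]]])
  then obtain T where T: "(?tc has_derivative T) (at x\<^sub>t)" by blast
  have "((\<lambda>\<tau>. ?tc (coord c (\<gamma> \<tau>))) has_vector_derivative T \<xi>\<^sub>t) (at t within {0..1})"
    using has_vector_derivative_chain[OF has_vector_derivative_velocity(1)[OF \<gamma> c t]] T by simp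
  from derivative_differential_along_curve[OF this]
  have d: "((\<lambda>\<tau>. differential F c (coord c (\<gamma> \<tau>)) (?tc (coord c (\<gamma> \<tau>)))) has_vector_derivative
    ddF c x\<^sub>t \<xi>\<^sub>t (?tc x\<^sub>t) + differential F c x\<^sub>t (T \<xi>\<^sub>t)) (at t within {0..1})" .
  obtain e where e: "e > 0" "\<And>\<tau>. \<tau> \<in> {0..1} \<Longrightarrow> dist \<tau> t < e \<Longrightarrow> \<gamma> \<tau> \<in> dom_c c"
    using has_vector_derivative_velocity(3)[OF \<gamma> c t] by blast
  have "(V has_vector_derivative ddF c x\<^sub>t \<xi>\<^sub>t (?tc x\<^sub>t) + differential F c x\<^sub>t (T \<xi>\<^sub>t)) (at t within {0..1})"
    by (rule has_vector_derivative_transform_within[OF d e(1) t(1)]) (simp add: Vt e(2))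
  moreover have "at t within {0..1} \<noteq> bot" using islimpt_Icc_unit[OF t(1)] by (simp add: trivial_limit_within)
  ultimately have "V' = ddF c x\<^sub>t \<xi>\<^sub>t (?tc x\<^sub>t) + differential F c x\<^sub>t (T \<xi>\<^sub>t)"
    using vector_derivative_unique_within[OF _ V] by blast
  also have "\<dots> = differential F c x\<^sub>t (tangent_components c (ddF c x\<^sub>t \<xi>\<^sub>t (?tc x\<^sub>t)) x\<^sub>t + T \<xi>\<^sub>t) + B c x\<^sub>t \<xi>\<^sub>t (?tc x\<^sub>t)"
    by (simp add: second_ff_eq[OF c x] linear_add[OF linear_differential[OF c x]])
  finally show "\<exists>Y. V' = differential F c x\<^sub>t Y + B c x\<^sub>t \<xi>\<^sub>t (?tc x\<^sub>t)" by blast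
qed

lemma derivative_normal_field:
  assumes N: "(N has_vector_derivative N') (at t within {0..1})"
    and orth: "\<And>\<tau> y. \<tau> \<in> {0..1} \<Longrightarrow> y \<in> tangent_space (\<gamma> \<tau>) \<Longrightarrow> N \<tau> \<bullet> y = 0"
  shows "N' \<bullet> differential F c x\<^sub>t \<xi>\<^sub>t = - (N t \<bullet> B c x\<^sub>t \<xi>\<^sub>t \<xi>\<^sub>t)"
  using derivative_of_inner_relation[OF N, of 0 \<xi>\<^sub>t] orth by simp

end

subsection \<open>The trace over parallel vector fields\<close>

lemma sum_Basis_inner: "(\<Sum>v\<in>Basis. (v \<bullet> a) * (v \<bullet> b)) = a \<bullet> (b :: real ^ 'd)"
  by (simp add: euclidean_inner[of a b] inner_commute)

text \<open>For an orthonormal basis of the ambient space, the sum of \<open>v v\<^sup>T\<close> is the identity. Its image under the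
  projection to the tangent space is the inverse metric.\<close>

lemma trace_components:
  assumes x: "x \<in> img_c c"
  shows "(\<Sum>v\<in>Basis. tangent_components c v x $ i * tangent_components c v x $ j) = ginv c x $ i $ j"
proof -
  have "(\<Sum>v\<in>Basis. tangent_components c v x $ i * tangent_components c v x $ j)
      = (\<Sum>v\<in>Basis. \<Sum>k\<in>UNIV. \<Sum>l\<in>UNIV. ginv c x $ i $ k * ginv c x $ j $ l * ((v \<bullet> frame c x k) * (v \<bullet> frame c x l)))"
    by (simp add: tangent_components_def[OF c] sum_product inner_commute mult_ac)
  also have "\<dots> = (\<Sum>k\<in>UNIV. \<Sum>l\<in>UNIV. \<Sum>v\<in>Basis. ginv c x $ i $ k * ginv c x $ j $ l * ((v \<bullet> frame c x k) * (v \<bullet> frame c x l)))"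
    by (subst sum.swap, rule sum.cong[OF refl], rule sum.swap)
  also have "\<dots> = (\<Sum>k\<in>UNIV. \<Sum>l\<in>UNIV. ginv c x $ i $ k * ginv c x $ j $ l * g c x $ k $ l)"
    by (simp only: sum_distrib_left[symmetric] sum_Basis_inner frame_inner[OF c x])
  also have "\<dots> = (\<Sum>k\<in>UNIV. ginv c x $ i $ k * (\<Sum>l\<in>UNIV. ginv c x $ j $ l * g c x $ l $ k))"
    by (simp add: sum_distrib_left metric_symmetric[OF c x] mult_ac)
  also have "\<dots> = ginv c x $ i $ j" by (simp add: ginv_mult[OF c x] if_distrib cong: if_cong)
  finally show ?thesis .
qed

lemma trace_bilinear:
  assumes x: "x \<in> img_c c"
  shows "(\<Sum>v\<in>Basis. \<Sum>i\<in>UNIV. \<Sum>j\<in>UNIV. tangent_components c v x $ i * tangent_components c v x $ j * b i j)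
    = (\<Sum>i\<in>UNIV. \<Sum>j\<in>UNIV. ginv c x $ i $ j * b i j)"
proof -
  have "(\<Sum>v\<in>Basis. \<Sum>i\<in>UNIV. \<Sum>j\<in>UNIV. tangent_components c v x $ i * tangent_components c v x $ j * b i j)
    = (\<Sum>i\<in>UNIV. \<Sum>j\<in>UNIV. \<Sum>v\<in>Basis. tangent_components c v x $ i * tangent_components c v x $ j * b i j)"
    by (subst sum.swap, rule sum.cong[OF refl], rule sum.swap)
  then show ?thesis by (simp only: sum_distrib_right[symmetric] trace_components[OF x])
qed

text \<open>In the sum of \<open>V' \<bullet> V'\<close> over the basis, the tangential and the normal parts of \<open>V'\<close> contribute the same trace \<open>K\<close>
  of the square of the shape operators, while \<open>N'\<close> contributes minus the inner product of the mean curvature with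
  \<open>B (\<eta>, \<eta>)\<close>. By the Gauss equation these terms add up to \<open>Q\<close>. The last term comes from \<open>w \<bullet> V' = v \<bullet> B (\<eta>, \<eta>)\<close>.\<close>

lemma variation_trace:
  assumes x: "x \<in> img_c c" and p: "1 \<le> p" "p = 1 \<Longrightarrow> \<eta> \<noteq> 0"
    and V1: "\<And>v Z. v \<in> Basis \<Longrightarrow> V' v \<bullet> differential F c x Z = v \<bullet> B c x \<eta> Z"
    and V2: "\<And>v. v \<in> Basis \<Longrightarrow> \<exists>Y. V' v = differential F c x Y + B c x \<eta> (tangent_components c v x)"
    and N': "\<And>v. v \<in> Basis \<Longrightarrow> N' v \<bullet> differential F c x \<eta>
        = - (B c x (tangent_components c v x) (tangent_components c v x) \<bullet> B c x \<eta> \<eta>)"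
    and w: "w = differential F c x \<eta>"
  shows "(\<Sum>v\<in>Basis. hess_pow p w (V' v) \<bullet> V' v + grad_pow p w \<bullet> N' v)
    = norm w powi (int p - 2) * Q_tensor g F c x \<eta> \<eta>
      + (real p - 2) * norm w powi (int p - 4) * (norm (B c x \<eta> \<eta>))\<^sup>2"
proof -
  let ?tc = "\<lambda>v. tangent_components c v x"
  define K where "K = (\<Sum>i\<in>UNIV. \<Sum>m\<in>UNIV. ginv c x $ i $ m * (B c x (axis i 1) \<eta> \<bullet> B c x (axis m 1) \<eta>))"
  have sq: "V' v \<bullet> V' v = (\<Sum>i\<in>UNIV. \<Sum>m\<in>UNIV. ginv c x $ i $ m * ((v \<bullet> B c x (axis i 1) \<eta>) * (v \<bullet> B c x (axis m 1) \<eta>)))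
      + B c x \<eta> (?tc v) \<bullet> B c x \<eta> (?tc v)" if v: "v \<in> Basis" for v
  proof -
    obtain Y where Y: "V' v = differential F c x Y + B c x \<eta> (?tc v)" using V2[OF v] by blast
    have YZ: "differential F c x Y \<bullet> differential F c x Z = v \<bullet> B c x \<eta> Z" for Z
      using V1[OF v, of Z] unfolding Y by (simp add: inner_add_left second_ff_orthogonal[OF c x])
    have "is_tangential_part (param c x) (V' v) (differential F c (coord c (param c x)) Y)"
      unfolding is_tangential_part_def tangent_space_chart[OF c param_in_dom[OF c x]] coord_param[OF c x]
      by (auto simp: Y inner_add_left second_ff_orthogonal[OF c x])
    from tangent_components_unique[OF param_in_dom[OF c x] this]
    have "Y $ i = (\<Sum>m\<in>UNIV. ginv c x $ i $ m * (v \<bullet> B c x (axis m 1) \<eta>))" for i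
      unfolding coord_param[OF c x]
      by (simp add: tangent_components_def[OF c] frame_def[OF c] inner_commute[of _ "V' v"] V1[OF v]
        second_ff_symmetric[OF c x, of \<eta>])
    moreover have "differential F c x Y \<bullet> differential F c x Y = (\<Sum>i\<in>UNIV. Y $ i * (v \<bullet> B c x (axis i 1) \<eta>))"
      unfolding YZ second_ff_sum_right[OF c x, of \<eta> Y]
      by (simp add: inner_sum_right second_ff_symmetric[OF c x, of \<eta>])
    ultimately have "differential F c x Y \<bullet> differential F c x Y
        = (\<Sum>i\<in>UNIV. \<Sum>m\<in>UNIV. ginv c x $ i $ m * ((v \<bullet> B c x (axis i 1) \<eta>) * (v \<bullet> B c x (axis m 1) \<eta>)))"
      by (simp add: sum_distrib_left mult_ac)
    moreover have "B c x \<eta> (?tc v) \<bullet> differential F c x Y = 0" by (rule second_ff_orthogonal[OF c x])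
    ultimately show ?thesis
      unfolding Y by (simp add: inner_add_left inner_add_right inner_commute)
  qed
  have "(\<Sum>v\<in>Basis. V' v \<bullet> V' v) = K + K"
  proof -
    have "(\<Sum>v\<in>Basis. \<Sum>i\<in>UNIV. \<Sum>m\<in>UNIV. ginv c x $ i $ m * ((v \<bullet> B c x (axis i 1) \<eta>) * (v \<bullet> B c x (axis m 1) \<eta>)))
        = (\<Sum>i\<in>UNIV. \<Sum>m\<in>UNIV. \<Sum>v\<in>Basis. ginv c x $ i $ m * ((v \<bullet> B c x (axis i 1) \<eta>) * (v \<bullet> B c x (axis m 1) \<eta>)))"
      by (subst sum.swap, rule sum.cong[OF refl], rule sum.swap)
    also have "\<dots> = K" unfolding K_def by (simp only: sum_distrib_left[symmetric] sum_Basis_inner)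
    finally have 1: "(\<Sum>v\<in>Basis. \<Sum>i\<in>UNIV. \<Sum>m\<in>UNIV. ginv c x $ i $ m * ((v \<bullet> B c x (axis i 1) \<eta>) * (v \<bullet> B c x (axis m 1) \<eta>))) = K" .
    have "B c x \<eta> (?tc v) \<bullet> B c x \<eta> (?tc v)
        = (\<Sum>i\<in>UNIV. \<Sum>j\<in>UNIV. ?tc v $ i * ?tc v $ j * (B c x (axis i 1) \<eta> \<bullet> B c x (axis j 1) \<eta>))" for v
      unfolding second_ff_sum_right[OF c x, of \<eta> "?tc v"]
      by (simp add: inner_sum_left inner_sum_right sum_distrib_left second_ff_symmetric[OF c x, of \<eta>] mult_ac)
        (subst sum.swap, simp add: mult_ac)
    then have 2: "(\<Sum>v\<in>Basis. B c x \<eta> (?tc v) \<bullet> B c x \<eta> (?tc v)) = K"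
      by (simp only: trace_bilinear[OF x] K_def)
    show ?thesis using 1 2 by (simp add: sq sum.distrib)
  qed
  moreover have "(\<Sum>v\<in>Basis. N' v \<bullet> w) = - (mean_curvature g F c x \<bullet> B c x \<eta> \<eta>)"
  proof -
    have "B c x (?tc v) (?tc v) \<bullet> B c x \<eta> \<eta>
        = (\<Sum>i\<in>UNIV. \<Sum>j\<in>UNIV. ?tc v $ i * ?tc v $ j * (\<B> c x i j \<bullet> B c x \<eta> \<eta>))" for v
      unfolding second_ff_sum_left[OF c x, of "?tc v" "?tc v"]
      by (simp add: second_ff_sum_right[OF c x, of _ "?tc v"] inner_sum_left sum_distrib_left mult_ac)
    then have "(\<Sum>v\<in>Basis. B c x (?tc v) (?tc v) \<bullet> B c x \<eta> \<eta>) = mean_curvature g F c x \<bullet> B c x \<eta> \<eta>"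
      by (simp only: trace_bilinear[OF x]) (simp add: mean_curvature_def inner_sum_left)
    then show ?thesis by (simp add: w N' sum_negf)
  qed
  moreover have "(\<Sum>v\<in>Basis. (w \<bullet> V' v)\<^sup>2) = (norm (B c x \<eta> \<eta>))\<^sup>2"
  proof -
    have "(\<Sum>v\<in>Basis. (w \<bullet> V' v)\<^sup>2) = (\<Sum>v\<in>Basis. (v \<bullet> B c x \<eta> \<eta>) * (v \<bullet> B c x \<eta> \<eta>))"
      by (simp add: w inner_commute[of "differential F c x \<eta>"] V1 power2_eq_square)
    then show ?thesis by (simp only: sum_Basis_inner power2_norm_eq_inner)
  qed
  moreover have "Q_tensor g F c x \<eta> \<eta> = K + K - mean_curvature g F c x \<bullet> B c x \<eta> \<eta>"
    unfolding Q_tensor_def ricci_eq[OF c x] K_def by simp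
  moreover have "(\<Sum>v\<in>Basis. hess_pow p w (V' v) \<bullet> V' v + grad_pow p w \<bullet> N' v)
      = norm w powi (int p - 2) * ((\<Sum>v\<in>Basis. V' v \<bullet> V' v) + (\<Sum>v\<in>Basis. N' v \<bullet> w))
        + (real p - 2) * norm w powi (int p - 4) * (\<Sum>v\<in>Basis. (w \<bullet> V' v)\<^sup>2)"
    by (simp add: hess_pow_def grad_pow_def inner_add_left inner_commute[of w] sum.distrib sum_distrib_left sum_distrib_right
      distrib_left power2_eq_square mult_ac)
  ultimately show ?thesis by simp
qed

end

section \<open>Stable maps\<close>

definition curve_velocity :: "(real \<Rightarrow> 'm) \<Rightarrow> real \<Rightarrow> real ^ 'd" where
  "curve_velocity \<gamma> t = vector_derivative (\<lambda>t. F (\<gamma> t)) (at t within {0..1})"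

lemma not_bot_unit: "t \<in> {0..1} \<Longrightarrow> at t within {0..1::real} \<noteq> bot"
  using islimpt_Icc_unit[of t] by (simp add: trivial_limit_within)

lemma curve_velocity_eq: "t \<in> {0..1} \<Longrightarrow> ((\<lambda>t. F (\<gamma> t)) has_vector_derivative w) (at t within {0..1}) \<Longrightarrow> curve_velocity \<gamma> t = w"
  unfolding curve_velocity_def by (rule vector_derivative_within[OF not_bot_unit])

lemma curve_velocity_chart:
  assumes "curve_Ck A k \<gamma>" "1 \<le> k" "c \<in> A" "t \<in> {0..1}" "\<gamma> t \<in> dom_c c"
  shows "curve_velocity \<gamma> t = differential F c (coord c (\<gamma> t)) (velocity c \<gamma> t)"
  by (rule curve_velocity_eq[OF assms(4) has_vector_derivative_velocity(2)[OF assms]])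

lemma partials_of_family:
  assumes \<psi>: "smooth_family \<epsilon> \<psi>" and \<gamma>: "curve_Ck A k \<gamma>"
  obtains D where "\<And>s t. s \<in> {-\<epsilon><..<\<epsilon>} \<Longrightarrow> t \<in> {0..1} \<Longrightarrow> D 0 0 s t = F (\<psi> s (\<gamma> t))"
    "mixed_partials k D ({-\<epsilon><..<\<epsilon>} \<times> {0..1})"
proof -
  have "open ({-\<epsilon><..<\<epsilon>} \<times> (UNIV :: 'm set))" by (intro open_Times open_greaterThanLessThan open_UNIV)
  from mixed_regular_along_curve[OF \<gamma> this, of "\<lambda>s m. F (\<psi> s m)"] smooth_at_F_family[OF \<psi>]
  have "mixed_regular k (\<lambda>s t. F (\<psi> s (\<gamma> t))) {z. snd z \<in> {0..1} \<and> (fst z, \<gamma> (snd z)) \<in> {-\<epsilon><..<\<epsilon>} \<times> UNIV}" by simp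
  moreover have "{z. snd z \<in> {0..1} \<and> (fst z, \<gamma> (snd z)) \<in> {-\<epsilon><..<\<epsilon>} \<times> UNIV} = {-\<epsilon><..<\<epsilon>} \<times> {0..1}" by auto
  ultimately have "mixed_regular k (\<lambda>s t. F (\<psi> s (\<gamma> t))) ({-\<epsilon><..<\<epsilon>} \<times> {0..1})" by simp
  then obtain D where D: "\<forall>s t. (s, t) \<in> {-\<epsilon><..<\<epsilon>} \<times> {0..1} \<longrightarrow> D 0 0 s t = F (\<psi> s (\<gamma> t))"
    "mixed_partials k D ({-\<epsilon><..<\<epsilon>} \<times> {0..1})"
    unfolding mixed_regular_def by (elim exE conjE) (rule that)
  show thesis by (rule that[OF _ D(2)]) (use D(1) in simp)
qed

lemma partials_at_0:
  assumes \<psi>: "smooth_family \<epsilon> \<psi>" and t: "t \<in> {0..1}" and k: "1 \<le> k"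
    and D0: "\<And>s t. s \<in> {-\<epsilon><..<\<epsilon>} \<Longrightarrow> t \<in> {0..1} \<Longrightarrow> D 0 0 s t = F (\<psi> s (\<gamma> t))"
    and D: "mixed_partials k D ({-\<epsilon><..<\<epsilon>} \<times> {0..1})"
  shows "D 0 1 0 t = curve_velocity \<gamma> t" and "D 1 0 0 t = velocity_field \<psi> (\<gamma> t)"
    and "D 2 0 0 t = acceleration_field \<psi> (\<gamma> t)"
proof -
  have e: "0 \<in> {-\<epsilon><..<\<epsilon>}" using smooth_family_eps[OF \<psi>] by simp
  have "((\<lambda>t. D 0 0 0 t) has_vector_derivative D 0 1 0 t) (at t within {0..1})"
    using mixed_partials_t[OF D, of 0 0 t 0] e t k by simp
  then have "((\<lambda>t. F (\<gamma> t)) has_vector_derivative D 0 1 0 t) (at t within {0..1})"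
    by (rule has_vector_derivative_transform_within[OF _ zero_less_one t]) (simp add: D0[OF e] smooth_family_0[OF \<psi>])
  then show "D 0 1 0 t = curve_velocity \<gamma> t" using curve_velocity_eq[OF t] by simp
  have d1: "((\<lambda>s. F (\<psi> s (\<gamma> t))) has_vector_derivative D 1 0 s t) (at s)" if s: "s \<in> {-\<epsilon><..<\<epsilon>}" for s
  proof -
    have "((\<lambda>s. D 0 0 s t) has_vector_derivative D 1 0 s t) (at s)"
      using mixed_partials_s[OF D, of 0 s t 0] s t by simp
    then show ?thesis
      by (rule has_vector_derivative_transform_within_open[OF _ open_greaterThanLessThan s]) (simp add: D0[OF _ t])
  qed
  show "D 1 0 0 t = velocity_field \<psi> (\<gamma> t)"
    unfolding velocity_field_def by (rule vector_derivative_at[OF d1[OF e], symmetric])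
  have "((\<lambda>s. D 1 0 s t) has_vector_derivative D 2 0 0 t) (at 0)"
    using mixed_partials_s[OF D, of 0 0 t 1] e t by (simp add: numeral_2_eq_2)
  then have "((\<lambda>s. vector_derivative (\<lambda>s. F (\<psi> s (\<gamma> t))) (at s)) has_vector_derivative D 2 0 0 t) (at 0)"
    by (rule has_vector_derivative_transform_within_open[OF _ open_greaterThanLessThan e]) (simp add: vector_derivative_at[OF d1])
  then show "D 2 0 0 t = acceleration_field \<psi> (\<gamma> t)"
    unfolding acceleration_field_def by (rule vector_derivative_at[symmetric])
qed

lemma discrete_map_curve: "discrete_map A k X arev f \<Longrightarrow> e \<in> arcs X \<Longrightarrow> curve_Ck A k (f e)"
  unfolding discrete_map_def by blast

lemma realises_velocity: "realises \<psi> m v \<Longrightarrow> is_tangential_part m v (velocity_field \<psi> m)"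
  unfolding realises_def velocity_field_def by (auto simp: vector_derivative_at)

context
  fixes X :: "('v, 'e) pre_digraph" and arev :: "'e \<Rightarrow> 'e" and wt :: "'e \<Rightarrow> real"
    and f :: "'e \<Rightarrow> real \<Rightarrow> 'm" and r p :: nat
  assumes fin: "finite (arcs X)" and f: "discrete_map A r X arev f" and r: "2 \<le> r" and p: "1 \<le> p"
    and reg: "\<And>e t. e \<in> arcs X \<Longrightarrow> t \<in> {0..1} \<Longrightarrow> regular_pow p (curve_velocity (f e) t)"
begin

lemma energy_of_family:
  assumes \<psi>: "smooth_family \<epsilon> \<psi>" and s: "s \<in> {-\<epsilon><..<\<epsilon>}"
    and D0: "\<And>e s t. e \<in> arcs X \<Longrightarrow> s \<in> {-\<epsilon><..<\<epsilon>} \<Longrightarrow> t \<in> {0..1} \<Longrightarrow> D e 0 0 s t = F (\<psi> s (f e t))"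
    and D: "\<And>e. e \<in> arcs X \<Longrightarrow> mixed_partials r (D e) ({-\<epsilon><..<\<epsilon>} \<times> {0..1})"
  shows "energy A g X wt p (\<lambda>e t. \<psi> s (f e t))
    = 1 / real p * (\<Sum>e\<in>arcs X. wt e * integral {0..1} (\<lambda>t. norm (D e 0 1 s t) ^ p))"
proof -
  have "speed A g (\<lambda>t. \<psi> s (f e t)) t = norm (D e 0 1 s t)" if e: "e \<in> arcs X" and t: "t \<in> {0..1}" for e t
  proof (rule speed_eq_norm[OF curve_Ck_slice[OF family_regular_along_curve[OF \<psi> discrete_map_curve[OF f e]] s] _ t])
    show "1 \<le> r" using r by simp
    have "((\<lambda>t. D e 0 0 s t) has_vector_derivative D e 0 1 s t) (at t within {0..1})"
      using mixed_partials_t[OF D[OF e], of 0 s t 0] s t r by simp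
    then show "((\<lambda>t. F (\<psi> s (f e t))) has_vector_derivative D e 0 1 s t) (at t within {0..1})"
      by (rule has_vector_derivative_transform_within[OF _ zero_less_one t]) (simp add: D0[OF e s])
  qed
  then show ?thesis unfolding energy_def
    by (intro arg_cong2[of _ _ _ _ "(*)"] sum.cong refl integral_cong) simp_all
qed

lemma variation_of_family:
  assumes \<psi>: "smooth_family \<epsilon> \<psi>"
    and D0: "\<And>e s t. e \<in> arcs X \<Longrightarrow> s \<in> {-\<epsilon><..<\<epsilon>} \<Longrightarrow> t \<in> {0..1} \<Longrightarrow> D e 0 0 s t = F (\<psi> s (f e t))"
    and D: "\<And>e. e \<in> arcs X \<Longrightarrow> mixed_partials r (D e) ({-\<epsilon><..<\<epsilon>} \<times> {0..1})"
  shows "deriv (\<lambda>s. energy A g X wt p (\<lambda>e t. \<psi> s (f e t))) 0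
      = (\<Sum>e\<in>arcs X. wt e * integral {0..1} (\<lambda>t. grad_pow p (D e 0 1 0 t) \<bullet> D e 1 1 0 t))" (is "deriv ?E 0 = ?E1 0")
    and "(deriv ^^ 2) (\<lambda>s. energy A g X wt p (\<lambda>e t. \<psi> s (f e t))) 0
      = (\<Sum>e\<in>arcs X. wt e * integral {0..1} (\<lambda>t. hess_pow p (D e 0 1 0 t) (D e 1 1 0 t) \<bullet> D e 1 1 0 t
          + grad_pow p (D e 0 1 0 t) \<bullet> D e 2 1 0 t))"
proof -
  let ?U = "{-\<epsilon><..<\<epsilon>}"
  note \<epsilon> = smooth_family_eps[OF \<psi>]
  have cont: "continuous_on (?U \<times> {0..1}) (\<lambda>(s, t). D e i 1 s t)" if "e \<in> arcs X" for e i
    using mixed_partials_continuous[OF D[OF that], of 1 i] r by simp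
  have ds: "((\<lambda>s. D e i 1 s t) has_vector_derivative D e (Suc i) 1 s t) (at s)"
    if "e \<in> arcs X" "s \<in> ?U" "t \<in> {0..1}" for e i s t
    using mixed_partials_s[OF D[OF that(1)], of 1 s t i] r that by simp
  have regD: "regular_pow p (D e 0 1 0 t)" if e: "e \<in> arcs X" and t: "t \<in> {0..1}" for e t
    using reg[OF e t] partials_at_0(1)[OF \<psi> t _ D0[OF e] D[OF e]] r by simp
  let ?I = "\<lambda>e s. integral {0..1} (\<lambda>t. norm (D e 0 1 s t) ^ p)"
  let ?I1 = "\<lambda>e s. real p * integral {0..1} (\<lambda>t. grad_pow p (D e 0 1 s t) \<bullet> D e 1 1 s t)"
  let ?I2 = "\<lambda>e. real p * integral {0..1} (\<lambda>t. hess_pow p (D e 0 1 0 t) (D e 1 1 0 t) \<bullet> D e 1 1 0 t + grad_pow p (D e 0 1 0 t) \<bullet> D e 2 1 0 t)"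
  have v1: "\<forall>\<^sub>F s in nhds 0. (?I e has_real_derivative ?I1 e s) (at s)" if e: "e \<in> arcs X" for e
    by (rule energy_variation(1)[OF \<epsilon> cont[OF e] cont[OF e] cont[OF e, of 2]])
      (use ds[OF e] regD[OF e] in \<open>simp_all add: numeral_2_eq_2\<close>)
  have v2: "(?I1 e has_real_derivative ?I2 e) (at 0)" if e: "e \<in> arcs X" for e
    by (rule energy_variation(2)[OF \<epsilon> cont[OF e] cont[OF e] cont[OF e, of 2]])
      (use ds[OF e] regD[OF e] in \<open>simp_all add: numeral_2_eq_2\<close>)
  let ?E1 = "\<lambda>s. (\<Sum>e\<in>arcs X. wt e * integral {0..1} (\<lambda>t. grad_pow p (D e 0 1 s t) \<bullet> D e 1 1 s t))"
  have p0: "real p \<noteq> 0" using p by simp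
  have E: "\<forall>\<^sub>F s in nhds 0. ?E s = 1 / real p * (\<Sum>e\<in>arcs X. wt e * ?I e s)"
    unfolding eventually_nhds
    by (intro exI[of _ ?U] conjI ballI energy_of_family[OF \<psi> _ D0 D]) (use \<epsilon> in auto)
  have "\<forall>\<^sub>F s in nhds 0. \<forall>e\<in>arcs X. (?I e has_real_derivative ?I1 e s) (at s)"
    using fin v1 by (intro eventually_ball_finite) auto
  moreover have "\<forall>\<^sub>F s in nhds 0. \<forall>\<^sub>F s' in nhds s. ?E s' = 1 / real p * (\<Sum>e\<in>arcs X. wt e * ?I e s')"
    by (subst eventually_eventually) (rule E)
  ultimately have dE: "\<forall>\<^sub>F s in nhds 0. deriv ?E s = ?E1 s"
  proof eventually_elim
    case (elim s)
    have "((\<lambda>s. 1 / real p * (\<Sum>e\<in>arcs X. wt e * ?I e s)) has_real_derivative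
        1 / real p * (\<Sum>e\<in>arcs X. wt e * ?I1 e s)) (at s)"
      using elim(1) by (intro DERIV_cmult DERIV_sum) auto
    moreover have "1 / real p * (\<Sum>e\<in>arcs X. wt e * ?I1 e s) = ?E1 s"
      using p0 by (simp add: sum_distrib_left)
    ultimately show ?case
      using elim(2) by (simp add: DERIV_imp_deriv deriv_cong_ev[OF elim(2) refl])
  qed
  show "deriv ?E 0 = ?E1 0" using eventually_nhds_x_imp_x[OF dE] .
  have "(?E1 has_real_derivative (\<Sum>e\<in>arcs X. wt e * (1 / real p * ?I2 e))) (at 0)"
  proof (intro DERIV_sum DERIV_cmult)
    fix e assume "e \<in> arcs X"
    from DERIV_cmult[OF v2[OF this], of "1 / real p"]
    show "((\<lambda>s. integral {0..1} (\<lambda>t. grad_pow p (D e 0 1 s t) \<bullet> D e 1 1 s t)) has_real_derivative 1 / real p * ?I2 e) (at 0)"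
      using p0 by simp
  qed
  then have "deriv ?E1 0 = (\<Sum>e\<in>arcs X. wt e * (1 / real p * ?I2 e))" by (rule DERIV_imp_deriv)
  moreover have "(deriv ^^ 2) ?E 0 = deriv ?E1 0"
    using deriv_cong_ev[OF dE refl] by (simp add: numeral_2_eq_2)
  ultimately show "(deriv ^^ 2) ?E 0 = (\<Sum>e\<in>arcs X. wt e * integral {0..1} (\<lambda>t. hess_pow p (D e 0 1 0 t) (D e 1 1 0 t) \<bullet> D e 1 1 0 t
          + grad_pow p (D e 0 1 0 t) \<bullet> D e 2 1 0 t))"
    using p0 by simp
qed

end

text \<open>To be thought of: \<open>V'\<close> is the derivative along the edges of the tangential part of the constant field \<open>v\<close>, and
  \<open>N'\<close> that of the normal part of the acceleration of a deformation in its direction. Only the relations that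
  enter \<open>variation_trace\<close> are recorded.\<close>

definition parallel_variation ::
    "('v, 'e) pre_digraph \<Rightarrow> ('e \<Rightarrow> real \<Rightarrow> 'm) \<Rightarrow> real ^ 'd \<Rightarrow> ('e \<Rightarrow> real \<Rightarrow> real ^ 'd) \<Rightarrow> ('e \<Rightarrow> real \<Rightarrow> real ^ 'd) \<Rightarrow> bool" where
  "parallel_variation X f v V' N' \<longleftrightarrow>
    (\<forall>e\<in>arcs X. \<forall>t\<in>{0..1}. \<forall>c\<in>A. f e t \<in> dom_c c \<longrightarrow>
      (let x = coord c (f e t); \<xi> = velocity c (f e) t; y = tangent_components c v x in
        (\<forall>Z. V' e t \<bullet> differential F c x Z = v \<bullet> B c x \<xi> Z) \<and>
        (\<exists>Y. V' e t = differential F c x Y + B c x \<xi> y) \<and>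
        N' e t \<bullet> differential F c x \<xi> = - (B c x y y \<bullet> B c x \<xi> \<xi>)))"

definition variation_density :: "nat \<Rightarrow> (real \<Rightarrow> 'm) \<Rightarrow> (real \<Rightarrow> real ^ 'd) \<Rightarrow> (real \<Rightarrow> real ^ 'd) \<Rightarrow> real \<Rightarrow> real" where
  "variation_density p \<gamma> V' N' t =
    hess_pow p (curve_velocity \<gamma> t) (V' t) \<bullet> V' t + grad_pow p (curve_velocity \<gamma> t) \<bullet> N' t"

context
  fixes X :: "('v, 'e) pre_digraph" and arev :: "'e \<Rightarrow> 'e" and wt :: "'e \<Rightarrow> real"
    and f :: "'e \<Rightarrow> real \<Rightarrow> 'm" and r p :: nat
  assumes fin: "finite (arcs X)" and f: "discrete_map A r X arev f" and r: "2 \<le> r" and p: "1 \<le> p"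
    and reg: "\<And>e t. e \<in> arcs X \<Longrightarrow> t \<in> {0..1} \<Longrightarrow> regular_pow p (curve_velocity (f e) t)"
    and stab: "stable A g r X arev wt p f"
begin

lemma compact_edges: "compact (\<Union>e\<in>arcs X. f e ` {0..1})"
  by (intro compact_UN fin compact_continuous_image curve_Ck_continuous[OF discrete_map_curve[OF f]] compact_Icc)

lemma partials_of_edges:
  assumes "smooth_family \<epsilon> \<psi>"
  obtains D where "\<And>e s t. e \<in> arcs X \<Longrightarrow> s \<in> {-\<epsilon><..<\<epsilon>} \<Longrightarrow> t \<in> {0..1} \<Longrightarrow> D e 0 0 s t = F (\<psi> s (f e t))"
    "\<And>e. e \<in> arcs X \<Longrightarrow> mixed_partials r (D e) ({-\<epsilon><..<\<epsilon>} \<times> {0..1})"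
proof -
  have "\<forall>e\<in>arcs X. \<exists>D. (\<forall>s\<in>{-\<epsilon><..<\<epsilon>}. \<forall>t\<in>{0..1}. D 0 0 s t = F (\<psi> s (f e t))) \<and>
      mixed_partials r D ({-\<epsilon><..<\<epsilon>} \<times> {0..1})"
  proof
    fix e assume e: "e \<in> arcs X"
    show "\<exists>D. (\<forall>s\<in>{-\<epsilon><..<\<epsilon>}. \<forall>t\<in>{0..1}. D 0 0 s t = F (\<psi> s (f e t))) \<and>
      mixed_partials r D ({-\<epsilon><..<\<epsilon>} \<times> {0..1})"
    proof (rule partials_of_family[OF assms discrete_map_curve[OF f e]])
      fix D assume "\<And>s t. s \<in> {-\<epsilon><..<\<epsilon>} \<Longrightarrow> t \<in> {0..1} \<Longrightarrow> D 0 0 s t = F (\<psi> s (f e t))"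
        "mixed_partials r D ({-\<epsilon><..<\<epsilon>} \<times> {0..1})"
      then show ?thesis by (intro exI[of _ D] conjI ballI)
    qed
  qed
  then obtain D where D: "\<forall>e\<in>arcs X. (\<forall>s\<in>{-\<epsilon><..<\<epsilon>}. \<forall>t\<in>{0..1}. D e 0 0 s t = F (\<psi> s (f e t))) \<and>
      mixed_partials r (D e) ({-\<epsilon><..<\<epsilon>} \<times> {0..1})"
    unfolding bchoice_iff by (elim exE) (rule that)
  show thesis by (rule that[of D]) (use D in \<open>simp_all\<close>)
qed

text \<open>A first family \<open>\<psi>\<close> moves \<open>f\<close> in the direction of the tangential part of \<open>v\<close>. Its acceleration contributes to the
  second variation through the first variation in the direction of the acceleration. The tangential part of the
  acceleration is realised by a second family \<open>\<phi>\<close>; as \<open>f\<close> is critical, that part contributes nothing, and only the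
  normal part remains.\<close>

lemma stability_inequality:
  "\<exists>V' N'. parallel_variation X f v V' N' \<and>
    (\<forall>e\<in>arcs X. continuous_on {0..1} (variation_density p (f e) (V' e) (N' e))) \<and>
    0 \<le> (\<Sum>e\<in>arcs X. wt e * integral {0..1} (variation_density p (f e) (V' e) (N' e)))"
proof -
  let ?K = "\<Union>e\<in>arcs X. f e ` {0..1}"
  have K: "f e t \<in> ?K" if "e \<in> arcs X" "t \<in> {0..1}" for e t using that by blast
  have "smooth_fun (\<lambda>m. v)" unfolding smooth_fun_def by (intro ballI smooth_near_const)
  from realisable_on_compact[OF compact_edges this]
  obtain \<epsilon> \<psi> where \<psi>: "smooth_family \<epsilon> \<psi>" "\<And>m. m \<in> ?K \<Longrightarrow> realises \<psi> m v" by metis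
  from realisable_on_compact[OF compact_edges smooth_acceleration_field[OF \<psi>(1)]]
  obtain \<epsilon>' \<phi> where \<phi>: "smooth_family \<epsilon>' \<phi>" "\<And>m. m \<in> ?K \<Longrightarrow> realises \<phi> m (acceleration_field \<psi> m)" by metis
  obtain D where D0: "\<And>e s t. e \<in> arcs X \<Longrightarrow> s \<in> {-\<epsilon><..<\<epsilon>} \<Longrightarrow> t \<in> {0..1} \<Longrightarrow> D e 0 0 s t = F (\<psi> s (f e t))"
    and D: "\<And>e. e \<in> arcs X \<Longrightarrow> mixed_partials r (D e) ({-\<epsilon><..<\<epsilon>} \<times> {0..1})"
    using partials_of_edges[OF \<psi>(1)] by metis
  obtain D' where D'0: "\<And>e s t. e \<in> arcs X \<Longrightarrow> s \<in> {-\<epsilon>'<..<\<epsilon>'} \<Longrightarrow> t \<in> {0..1} \<Longrightarrow> D' e 0 0 s t = F (\<phi> s (f e t))"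
    and D': "\<And>e. e \<in> arcs X \<Longrightarrow> mixed_partials r (D' e) ({-\<epsilon>'<..<\<epsilon>'} \<times> {0..1})"
    using partials_of_edges[OF \<phi>(1)] by metis
  have r1: "1 \<le> r" using r by simp
  have z: "0 \<in> {-\<epsilon><..<\<epsilon>}" "0 \<in> {-\<epsilon>'<..<\<epsilon>'}" using smooth_family_eps[OF \<psi>(1)] smooth_family_eps[OF \<phi>(1)] by simp_all
  have at0: "D e 0 1 0 t = curve_velocity (f e) t" "D e 1 0 0 t = velocity_field \<psi> (f e t)"
      "D e 2 0 0 t = acceleration_field \<psi> (f e t)" if e: "e \<in> arcs X" and t: "t \<in> {0..1}" for e t
    using partials_at_0[OF \<psi>(1) t r1 D0[OF e] D[OF e]] by simp_all
  have at0': "D' e 0 1 0 t = curve_velocity (f e) t" "D' e 1 0 0 t = velocity_field \<phi> (f e t)"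
      if e: "e \<in> arcs X" and t: "t \<in> {0..1}" for e t
    using partials_at_0[OF \<phi>(1) t r1 D'0[OF e] D'[OF e]] by simp_all
  let ?h = "\<lambda>e t. hess_pow p (curve_velocity (f e) t) (D e 1 1 0 t) \<bullet> D e 1 1 0 t
    + grad_pow p (curve_velocity (f e) t) \<bullet> D e 2 1 0 t"
  let ?k = "\<lambda>e t. grad_pow p (curve_velocity (f e) t) \<bullet> D' e 1 1 0 t"
  let ?V' = "\<lambda>e t. D e 1 1 0 t" and ?N' = "\<lambda>e t. D e 2 1 0 t - D' e 1 1 0 t"
  have "parallel_variation X f v ?V' ?N'"
    unfolding parallel_variation_def Let_def
  proof (intro ballI impI)
    fix e t c assume e: "e \<in> arcs X" and t: "t \<in> {0..1}" and c: "c \<in> A" "f e t \<in> dom_c c"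
    have tang: "is_tangential_part (f e \<tau>) v (D e 1 0 0 \<tau>)" if "\<tau> \<in> {0..1}" for \<tau>
      using realises_velocity[OF \<psi>(2)[OF K[OF e that]]] by (simp only: at0(2)[OF e that])
    have tang': "is_tangential_part (f e \<tau>) (D e 2 0 0 \<tau>) (D' e 1 0 0 \<tau>)" if "\<tau> \<in> {0..1}" for \<tau>
      using realises_velocity[OF \<phi>(2)[OF K[OF e that]]] by (simp only: at0(3)[OF e that] at0'(2)[OF e that])
    have V: "((\<lambda>t. D e 1 0 0 t) has_vector_derivative D e 1 1 0 t) (at t within {0..1})"
      using mixed_partials_t[OF D[OF e], of 0 0 t 1] z t r by simp
    have N: "((\<lambda>t. D e 2 0 0 t - D' e 1 0 0 t) has_vector_derivative ?N' e t) (at t within {0..1})"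
      using mixed_partials_t[OF D[OF e], of 0 0 t 2] mixed_partials_t[OF D'[OF e], of 0 0 t 1] z t r
      by (intro has_vector_derivative_diff) simp_all
    have orth: "(D e 2 0 0 \<tau> - D' e 1 0 0 \<tau>) \<bullet> y = 0" if "\<tau> \<in> {0..1}" "y \<in> tangent_space (f e \<tau>)" for \<tau> y
      using tang'[OF that(1)] that(2) unfolding is_tangential_part_def by (simp add: inner_diff_left)
    have normal: "D e 2 0 0 t - D' e 1 0 0 t = B c (coord c (f e t))
        (tangent_components c v (coord c (f e t))) (tangent_components c v (coord c (f e t)))"
      using normal_acceleration[OF c(1) \<psi>(1) c(2) \<psi>(2)[OF K[OF e t]]] tang'[OF t] by (simp add: at0(3)[OF e t])
    show "(\<forall>Z. ?V' e t \<bullet> differential F c (coord c (f e t)) Z = v \<bullet> B c (coord c (f e t)) (velocity c (f e) t) Z) \<and>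
      (\<exists>Y. ?V' e t = differential F c (coord c (f e t)) Y
        + B c (coord c (f e t)) (velocity c (f e) t) (tangent_components c v (coord c (f e t)))) \<and>
      ?N' e t \<bullet> differential F c (coord c (f e t)) (velocity c (f e) t)
        = - (B c (coord c (f e t)) (tangent_components c v (coord c (f e t))) (tangent_components c v (coord c (f e t)))
          \<bullet> B c (coord c (f e t)) (velocity c (f e) t) (velocity c (f e) t))"
      using derivative_tangential_field[OF c(1) discrete_map_curve[OF f e] r1 t c(2) V tang]
        derivative_normal_field[OF c(1) discrete_map_curve[OF f e] r1 t c(2) N orth] unfolding normal
      by (intro conjI allI)
  qed
  moreover have slice: "continuous_on {0..1} (\<lambda>t. h 0 t)"
    if "continuous_on ({-\<delta><..<\<delta>} \<times> {0..1}) (\<lambda>(s, t). h s t)" "0 \<in> {-\<delta><..<\<delta>}"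
    for h :: "real \<Rightarrow> real \<Rightarrow> real ^ 'd" and \<delta> :: real
    using that by (intro continuous_on_slice[OF that(1)]) auto
  have cD: "continuous_on {0..1} (\<lambda>t. D e i 1 0 t)" if "e \<in> arcs X" for e i
    by (rule slice[OF mixed_partials_continuous[OF D[OF that] r1] z(1)])
  have cD': "continuous_on {0..1} (\<lambda>t. D' e i 1 0 t)" if "e \<in> arcs X" for e i
    by (rule slice[OF mixed_partials_continuous[OF D'[OF that] r1] z(2)])
  have cw: "continuous_on {0..1} (curve_velocity (f e))" if e: "e \<in> arcs X" for e
    by (rule continuous_on_eq[OF cD[OF e, of 0]]) (rule at0(1)[OF e])
  have chess: "continuous_on {0..1} (?h e)" if e: "e \<in> arcs X" for e
    by (intro continuous_on_add continuous_on_inner continuous_hess_pow continuous_grad_pow cw cD e reg[OF e])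
  have cgrad: "continuous_on {0..1} (?k e)" if e: "e \<in> arcs X" for e
    by (intro continuous_on_inner continuous_grad_pow cw cD' e reg[OF e])
  have split: "variation_density p (f e) (?V' e) (?N' e) = (\<lambda>t. ?h e t - ?k e t)" for e
    by (rule ext) (simp add: variation_density_def inner_diff_right)
  have "continuous_on {0..1} (variation_density p (f e) (?V' e) (?N' e))" if e: "e \<in> arcs X" for e
    unfolding split by (intro continuous_on_diff chess cgrad e)
  moreover have "0 \<le> (\<Sum>e\<in>arcs X. wt e * integral {0..1} (variation_density p (f e) (?V' e) (?N' e)))"
  proof -
    have "0 \<le> (deriv ^^ 2) (\<lambda>s. energy A g X wt p (\<lambda>e t. \<psi> s (f e t))) 0"
      using stab deformation_smooth_family[OF \<psi>(1) f] unfolding stable_def by blast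
    also have "\<dots> = (\<Sum>e\<in>arcs X. wt e * integral {0..1} (?h e))"
    proof -
      have "(deriv ^^ 2) (\<lambda>s. energy A g X wt p (\<lambda>e t. \<psi> s (f e t))) 0
        = (\<Sum>e\<in>arcs X. wt e * integral {0..1} (\<lambda>t. hess_pow p (D e 0 1 0 t) (D e 1 1 0 t) \<bullet> D e 1 1 0 t
          + grad_pow p (D e 0 1 0 t) \<bullet> D e 2 1 0 t))"
        by (rule variation_of_family(2)[OF fin f r p]) (fact reg \<psi>(1) D0 D)+
      also have "\<dots> = (\<Sum>e\<in>arcs X. wt e * integral {0..1} (?h e))"
        by (intro sum.cong refl arg_cong2[of _ _ _ _ "(*)"] integral_cong) (simp only: at0(1))
      finally show ?thesis .
    qed
    finally have second: "0 \<le> (\<Sum>e\<in>arcs X. wt e * integral {0..1} (?h e))" .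
    have "((\<lambda>s. energy A g X wt p (\<lambda>e t. \<phi> s (f e t))) has_real_derivative 0) (at 0)"
      using stab deformation_smooth_family[OF \<phi>(1) f] unfolding stable_def critical_def by blast
    then have "0 = deriv (\<lambda>s. energy A g X wt p (\<lambda>e t. \<phi> s (f e t))) 0" by (rule DERIV_imp_deriv[symmetric])
    also have "\<dots> = (\<Sum>e\<in>arcs X. wt e * integral {0..1} (?k e))"
    proof -
      have "deriv (\<lambda>s. energy A g X wt p (\<lambda>e t. \<phi> s (f e t))) 0
        = (\<Sum>e\<in>arcs X. wt e * integral {0..1} (\<lambda>t. grad_pow p (D' e 0 1 0 t) \<bullet> D' e 1 1 0 t))"
        by (rule variation_of_family(1)[OF fin f r p]) (fact reg \<phi>(1) D'0 D')+
      also have "\<dots> = (\<Sum>e\<in>arcs X. wt e * integral {0..1} (?k e))"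
        by (intro sum.cong refl arg_cong2[of _ _ _ _ "(*)"] integral_cong) (simp only: at0'(1))
      finally show ?thesis .
    qed
    finally have first: "0 = (\<Sum>e\<in>arcs X. wt e * integral {0..1} (?k e))" .
    have "(\<Sum>e\<in>arcs X. wt e * integral {0..1} (variation_density p (f e) (?V' e) (?N' e)))
      = (\<Sum>e\<in>arcs X. wt e * integral {0..1} (?h e)
        - wt e * integral {0..1} (?k e))"
    proof (rule sum.cong[OF refl])
      fix e assume e: "e \<in> arcs X"
      show "wt e * integral {0..1} (variation_density p (f e) (?V' e) (?N' e))
        = wt e * integral {0..1} (?h e)
        - wt e * integral {0..1} (?k e)"
        unfolding split integral_diff[OF integrable_continuous_real[OF chess[OF e]] integrable_continuous_real[OF cgrad[OF e]]]
        by (rule right_diff_distrib)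
    qed
    then show ?thesis using first second by (simp add: sum_subtractf)
  qed
  ultimately show ?thesis by (intro exI[of _ ?V'] exI[of _ ?N'] conjI ballI)
qed

text \<open>Summing the stability inequality over an orthonormal basis gives a sum of integrals of functions that are
  negative wherever \<open>f\<close> moves and vanish elsewhere.\<close>

theorem not_stable:
  assumes wt: "\<And>e. e \<in> arcs X \<Longrightarrow> 0 < wt e"
    and neg: "\<And>c x \<xi>. c \<in> A \<Longrightarrow> x \<in> img_c c \<Longrightarrow> \<xi> \<noteq> 0 \<Longrightarrow>
      Q_tensor g F c x \<xi> \<xi> + (real p - 2) * (norm (B c x \<xi> \<xi>))\<^sup>2 / metric_form g c x \<xi> \<xi> < 0"
    and e0: "e0 \<in> arcs X" "t0 \<in> {0..1}" "curve_velocity (f e0) t0 \<noteq> 0"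
  shows False
proof -
  have "\<forall>v. \<exists>V' N'. parallel_variation X f v V' N' \<and>
    (\<forall>e\<in>arcs X. continuous_on {0..1} (variation_density p (f e) (V' e) (N' e))) \<and>
    0 \<le> (\<Sum>e\<in>arcs X. wt e * integral {0..1} (variation_density p (f e) (V' e) (N' e)))"
    using stability_inequality by (rule allI)
  then obtain V' N' where *: "\<forall>v. parallel_variation X f v (V' v) (N' v) \<and>
    (\<forall>e\<in>arcs X. continuous_on {0..1} (variation_density p (f e) (V' v e) (N' v e))) \<and>
    0 \<le> (\<Sum>e\<in>arcs X. wt e * integral {0..1} (variation_density p (f e) (V' v e) (N' v e)))"
    unfolding choice_iff by (elim exE) (rule that)
  then have par: "parallel_variation X f v (V' v) (N' v)"
    and cont: "e \<in> arcs X \<Longrightarrow> continuous_on {0..1} (variation_density p (f e) (V' v e) (N' v e))"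
    and nonneg: "0 \<le> (\<Sum>e\<in>arcs X. wt e * integral {0..1} (variation_density p (f e) (V' v e) (N' v e)))" for v e
    by blast+
  define G where "G e t = (\<Sum>v\<in>Basis. variation_density p (f e) (V' v e) (N' v e) t)" for e t
  have contG: "continuous_on {0..1} (G e)" if "e \<in> arcs X" for e
    unfolding G_def[abs_def] by (intro continuous_on_sum cont that)
  have "0 \<le> (\<Sum>v\<in>Basis. \<Sum>e\<in>arcs X. wt e * integral {0..1} (variation_density p (f e) (V' v e) (N' v e)))"
    by (intro sum_nonneg nonneg)
  also have "\<dots> = (\<Sum>e\<in>arcs X. wt e * (\<Sum>v\<in>Basis. integral {0..1} (variation_density p (f e) (V' v e) (N' v e))))"
    unfolding sum_distrib_left by (rule sum.swap)
  also have "\<dots> = (\<Sum>e\<in>arcs X. wt e * integral {0..1} (G e))"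
    unfolding G_def[abs_def]
    by (intro sum.cong refl arg_cong2[of _ _ _ _ "(*)"] integral_sum[symmetric] integrable_continuous_real cont finite_Basis)
  finally have total: "0 \<le> (\<Sum>e\<in>arcs X. wt e * integral {0..1} (G e))" .
  have G: "G e t \<le> 0 \<and> (curve_velocity (f e) t \<noteq> 0 \<longrightarrow> G e t < 0)" if e: "e \<in> arcs X" and t: "t \<in> {0..1}" for e t
  proof -
    let ?c = "chart_at A (f e t)"
    let ?x = "coord ?c (f e t)" and ?\<xi> = "velocity ?c (f e) t"
    let ?w = "curve_velocity (f e) t"
    note c = chart_at[of "f e t"]
    note x = coord_in_img[OF c]
    have w: "?w = differential F ?c ?x ?\<xi>"
      by (rule curve_velocity_chart[OF discrete_map_curve[OF f e] _ c(1) t c(2)]) (use r in simp)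
    have w0: "?w = 0 \<longleftrightarrow> ?\<xi> = 0"
      unfolding w using inj_differential[OF c(1) x] linear_0[OF linear_differential[OF c(1) x]] by (metis injD)
    note pv = par[unfolded parallel_variation_def Let_def, rule_format, OF e t c]
    have "G e t = norm ?w powi (int p - 2) * Q_tensor g F ?c ?x ?\<xi> ?\<xi>
      + (real p - 2) * norm ?w powi (int p - 4) * (norm (B ?c ?x ?\<xi> ?\<xi>))\<^sup>2"
      unfolding G_def variation_density_def
      using pv reg[OF e t] w0 by (intro variation_trace[OF c(1) x p _ _ _ _ w]) auto
    note Gt = this
    show ?thesis
    proof (cases "?\<xi> = 0")
      case True
      have "Q_tensor g F ?c ?x 0 0 = 0"
        by (simp add: Q_tensor_def second_ff_0[OF c(1) x] ricci_def)
      then show ?thesis using True w0 by (simp add: Gt second_ff_0[OF c(1) x])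
    next
      case False
      then have pos: "0 < norm ?w" using w0 by simp
      have m: "metric_form g ?c ?x ?\<xi> ?\<xi> = (norm ?w)\<^sup>2"
        unfolding w power2_norm_eq_inner by (rule differential_inner[OF c(1) x, symmetric])
      \<comment> \<open>factoring out a power of the speed leaves the expression in the hypothesis\<close>
      have "norm ?w powi (int p - 2) = norm ?w powi (int p - 4) * (norm ?w)\<^sup>2"
        using power_int_add[of "norm ?w" "int p - 4" 2] pos by simp
      then have "G e t = norm ?w powi (int p - 2) *
        (Q_tensor g F ?c ?x ?\<xi> ?\<xi> + (real p - 2) * (norm (B ?c ?x ?\<xi> ?\<xi>))\<^sup>2 / metric_form g ?c ?x ?\<xi> ?\<xi>)"
        unfolding Gt m using pos by (simp add: field_simps)
      also have "\<dots> < 0" using neg[OF c(1) x False] pos by (intro mult_pos_neg) simp_all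
      finally show ?thesis by simp
    qed
  qed
  have "integral {0..1} (G e) \<le> 0" if e: "e \<in> arcs X" for e
  proof -
    have "integral {0..1} (G e) \<le> integral {0..1} (\<lambda>t::real. 0)"
      by (rule integral_le[OF integrable_continuous_real[OF contG[OF e]]]) (use G[OF e] in auto)
    then show ?thesis by simp
  qed
  then have nonpos: "wt e * integral {0..1} (G e) \<le> 0" if e: "e \<in> arcs X" for e
    using wt[OF e] e by (simp add: mult_nonneg_nonpos)
  have "integral {0..1} (G e0) < 0"
  proof -
    have "integral {0..1} (\<lambda>t. - G e0 t) \<noteq> 0"
      using integral_eq_0_iff[of 0 1 "\<lambda>t. - G e0 t"] contG[OF e0(1)] G[OF e0(1)] e0(2,3)
      by (force intro: continuous_on_minus)
    then show ?thesis using \<open>\<And>e. e \<in> arcs X \<Longrightarrow> integral {0..1} (G e) \<le> 0\<close>[OF e0(1)] by simp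
  qed
  then have "wt e0 * integral {0..1} (G e0) < 0" using wt[OF e0(1)] by (simp add: mult_pos_neg)
  then have "(\<Sum>e\<in>arcs X. wt e * integral {0..1} (G e)) < (\<Sum>e\<in>arcs X. 0)"
    using fin nonpos e0(1) by (intro sum_strict_mono_ex1) auto
  then show False using total by simp
qed

end

text \<open>If all velocities vanish, each edge is locally constant in charts, hence constant because \<open>[0,1]\<close> is connected.
  The common value is then passed from vertex to vertex, as the graph is connected.\<close>

lemma moving_point:
  fixes X :: "('v, 'e) pre_digraph"
  assumes f: "discrete_map A k X arev f" "1 \<le> k" and X: "Digraph_Component.connected X" "wf_digraph X"
    and nc: "non_constant X f"
  obtains e t where "e \<in> arcs X" "t \<in> {0..1}" "curve_velocity (f e) t \<noteq> 0"
proof (rule ccontr)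
  note moving = that
  assume not_moving: "\<not> thesis"
  have v0: "curve_velocity (f e) t = 0" if "e \<in> arcs X" "t \<in> {0..1}" for e t
    using moving[OF that] not_moving by blast
  have edge: "f e t = f e 0" if e: "e \<in> arcs X" and t: "t \<in> {0..1}" for e t
  proof -
    have ck: "curve_Ck A k (f e)" using f e unfolding discrete_map_def by blast
    \<comment> \<open>this set is closed because \<open>M\<close> is Hausdorff, and open because the velocity vanishes\<close>
    let ?T = "{0..1} \<inter> f e -` {f e 0}"
    have "closedin (top_of_set {0..1}) ?T"
      by (rule continuous_closedin_preimage[OF curve_Ck_continuous[OF ck] closed_singleton])
    moreover have "openin (top_of_set {0..1}) ?T"
      unfolding openin_euclidean_subtopology_iff
    proof (intro conjI ballI)
      show "?T \<subseteq> {0..1}" by blast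
      fix t assume "t \<in> ?T"
      then have t: "t \<in> {0..1}" "f e t = f e 0" by auto
      let ?c = "chart_at A (f e t)"
      obtain \<delta> where \<delta>: "\<delta> > 0" "\<And>\<tau>. \<tau> \<in> {0..1} \<Longrightarrow> dist \<tau> t < \<delta> \<Longrightarrow> f e \<tau> \<in> dom_c ?c"
        using has_vector_derivative_velocity(3)[OF ck f(2) chart_at(1) t(1) chart_at(2)] by blast
      let ?S = "{0..1} \<inter> ball t \<delta>"
      have S: "\<tau> \<in> {0..1}" "f e \<tau> \<in> dom_c ?c" if "\<tau> \<in> ?S" for \<tau> using that \<delta>(2) by (auto simp: dist_commute)
      have "((coord ?c \<circ> f e) has_vector_derivative 0) (at \<tau> within ?S)" if \<tau>: "\<tau> \<in> ?S" for \<tau>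
      proof -
        note c = chart_at(1)[of "f e t"]
        note x = coord_in_img[OF c S(2)[OF \<tau>]]
        have "differential F ?c (coord ?c (f e \<tau>)) (velocity ?c (f e) \<tau>) = 0"
          using curve_velocity_chart[OF ck f(2) c S[OF \<tau>]] v0[OF e S(1)[OF \<tau>]] by simp
        then have "velocity ?c (f e) \<tau> = 0"
          using inj_differential[OF c x] linear_0[OF linear_differential[OF c x]] by (metis injD)
        then have "((coord ?c \<circ> f e) has_vector_derivative 0) (at \<tau> within {0..1})"
          using has_vector_derivative_velocity(1)[OF ck f(2) c S[OF \<tau>]] by simp
        then show ?thesis by (rule has_vector_derivative_within_subset) simp
      qed
      then obtain q where q: "\<And>\<tau>. \<tau> \<in> ?S \<Longrightarrow> (coord ?c \<circ> f e) \<tau> = q"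
        using has_vector_derivative_zero_constant[of ?S "coord ?c \<circ> f e",
            OF convex_Int[OF is_interval_convex[OF is_interval_cc] convex_ball]] by metis
      have tS: "t \<in> ?S" using t \<delta>(1) by simp
      have "f e \<tau> = f e 0" if "\<tau> \<in> ?S" for \<tau>
        using q[OF that] q[OF tS] param_coord[OF chart_at(1) S(2)[OF that]] param_coord[OF chart_at(1) S(2)[OF tS]] t(2)
        by (metis comp_apply)
      then show "\<exists>d>0. \<forall>\<tau>\<in>{0..1}. dist \<tau> t < d \<longrightarrow> \<tau> \<in> ?T"
        using \<delta>(1) by (intro exI[of _ \<delta>]) (auto simp: dist_commute)
    qed
    moreover have "Topological_Spaces.connected {0..1::real}" by simp
    ultimately have "?T = {} \<or> ?T = {0..1}" unfolding connected_clopen by blast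
    moreover have "0 \<in> ?T" by simp
    ultimately have "t \<in> ?T" using t by blast
    then show ?thesis by simp
  qed
  obtain fv where fv: "\<And>e. e \<in> arcs X \<Longrightarrow> f e 0 = fv (tail X e)" "\<And>e. e \<in> arcs X \<Longrightarrow> f e 1 = fv (head X e)"
    using f unfolding discrete_map_def by blast
  have edge_step: "fv (tail X e) = fv (head X e)" if e: "e \<in> arcs X" for e
    using edge[OF e, of 1] fv[OF e] by simp
  have const: "fv u = fv v" if "u \<in> verts X" "v \<in> verts X" for u v
  proof -
    have "u \<rightarrow>\<^sup>*\<^bsub>with_proj (mk_symmetric X)\<^esub> v"
      using X(1) that unfolding Digraph_Component.connected_def strongly_connected_def by simp
    then have "(u, v) \<in> (parcs (mk_symmetric X))\<^sup>*" using reachable_rtranclI by fastforce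
    then show ?thesis
    proof (induction rule: rtrancl_induct)
      case (step x y)
      obtain e where "e \<in> arcs X" "(x, y) = (tail X e, head X e) \<or> (x, y) = (head X e, tail X e)"
        using step.hyps(2) unfolding parcs_mk_symmetric by blast
      with edge_step[of e] step.IH show ?case by auto
    qed simp
  qed
  obtain e e' t t' where "e \<in> arcs X" "e' \<in> arcs X" "t \<in> {0..1}" "t' \<in> {0..1}" "f e t \<noteq> f e' t'"
    using nc unfolding non_constant_def by blast
  then show False
    using edge[of e t] edge[of e' t'] fv const[of "tail X e" "tail X e'"] wf_digraph.tail_in_verts[OF X(2)] by simp
qed

text \<open>Rescale \<open>\<xi>\<close> to unit length; \<open>B\<close> is quadratic.\<close>

lemma norm_second_ff_in_S_set:
  assumes c: "c \<in> A" and x: "x \<in> img_c c" and \<xi>: "\<xi> \<noteq> 0"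
  shows "(norm (B c x \<xi> \<xi>))\<^sup>2 / (metric_form g c x \<xi> \<xi>)\<^sup>2 \<in> S_set A g F"
proof -
  let ?\<rho> = "sqrt (metric_form g c x \<xi> \<xi>)"
  let ?Z = "(1 / ?\<rho>) *\<^sub>R \<xi>"
  have pos: "0 < metric_form g c x \<xi> \<xi>" by (rule metric_positive[OF c x \<xi>])
  have "metric_form g c x ?Z ?Z = 1"
    using pos by (simp add: metric_form_def matrix_vector_mult_scaleR)
  moreover have "B c x ?Z ?Z = (1 / metric_form g c x \<xi> \<xi>) *\<^sub>R B c x \<xi> \<xi>"
  proof -
    have "B c x ?Z ?Z = (1 / ?\<rho>) *\<^sub>R B c x ?Z \<xi>" by (rule linear_scale[OF linear_second_ff[OF c x]])
    also have "B c x ?Z \<xi> = B c x \<xi> ?Z" by (rule second_ff_symmetric[OF c x])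
    also have "\<dots> = (1 / ?\<rho>) *\<^sub>R B c x \<xi> \<xi>" by (rule linear_scale[OF linear_second_ff[OF c x]])
    finally show ?thesis using pos by simp
  qed
  then have "(norm (B c x ?Z ?Z))\<^sup>2 = (norm (B c x \<xi> \<xi>))\<^sup>2 / (metric_form g c x \<xi> \<xi>)\<^sup>2"
    using pos by (simp add: power_divide)
  ultimately show ?thesis unfolding S_set_def using c x
    by (intro CollectI exI[of _ c] exI[of _ x] exI[of _ ?Z]) simp
qed

end

theorem corollary4p4:
  fixes A :: "('m::{second_countable_topology, t2_space}, 'n::finite) chart set"
    and g :: "('m, 'n) metric"
    and F :: "'m \<Rightarrow> real ^ 'd::finite"
    and k :: nat  \<comment> \<open>codimension\<close>
    and r :: nat  \<comment> \<open>regularity class of discrete maps\<close>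
  assumes "smooth_atlas A"
    and "riemannian_metric A g"
    and "CARD('d) = CARD('n) + k"
    and "isometric_immersion A g F"
    and "2 \<le> r"
  shows "(Q_less A g F (beta A g F) \<longrightarrow> property_N1 TYPE('v \<times> 'e) A g r) \<and>
    (\<forall>p::nat. 2 \<le> p \<longrightarrow> Q_less A g F (- (ereal (real p - 2) * gamma A g F)) \<longrightarrow>
       property_N TYPE('v \<times> 'e) p A g r)"
proof -
  interpret immersed_manifold A g F by (rule immersed_manifold.intro[OF assms(1,2,4)])
  show ?thesis
  proof (intro conjI allI impI)
    assume Q: "Q_less A g F (beta A g F)"
    show "property_N1 TYPE('v \<times> 'e) A g r"
      unfolding property_N1_def
    proof (rule notI, elim exE conjE)
      fix X :: "('v, 'e) pre_digraph" and arev w f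
      assume X: "finite_weighted_graph X arev w" and min: "discrete_minimal_immersion A g r X arev w f"
        and stab: "stable A g r X arev w 1 f"
      have dm: "discrete_map A r X arev f" and im: "immersion A X f"
        using min unfolding discrete_minimal_immersion_def by simp_all
      have fin: "finite (arcs X)" and wt: "\<And>e. e \<in> arcs X \<Longrightarrow> 0 < w e" and ne: "arcs X \<noteq> {}"
        using X unfolding finite_weighted_graph_def fin_digraph_def fin_digraph_axioms_def by blast+
      have moving: "curve_velocity (f e) t \<noteq> 0" if e: "e \<in> arcs X" and t: "t \<in> {0..1}" for e t
      proof -
        note c = chart_at[of "f e t"]
        note x = coord_in_img[OF c]
        have v: "velocity (chart_at A (f e t)) (f e) t \<noteq> 0" using im e t c unfolding immersion_def by blast
        have "curve_Ck A r (f e)" using dm e unfolding discrete_map_def by blast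
        from curve_velocity_chart[OF this _ c(1) t c(2)] assms(5)
        show ?thesis using v inj_differential[OF c(1) x] linear_0[OF linear_differential[OF c(1) x]]
          by (metis Suc_1 Suc_leD One_nat_def injD)
      qed
      obtain e0 where e0: "e0 \<in> arcs X" using ne by blast
      show False
      proof (rule not_stable[OF fin dm assms(5) _ _ stab wt _ e0, of 0])
        fix c x \<xi> assume c: "c \<in> A" and x: "x \<in> img_c c" and \<xi>: "\<xi> \<noteq> (0 :: real ^ 'n)"
        let ?m = "metric_form g c x \<xi> \<xi>" and ?b = "(norm (B c x \<xi> \<xi>))\<^sup>2"
        have pos: "0 < ?m" by (rule metric_positive[OF c x \<xi>])
        have "ereal (Q_tensor g F c x \<xi> \<xi>) < beta A g F * ereal ?m" using Q c x \<xi> unfolding Q_less_def by blast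
        also have "\<dots> \<le> ereal (?b / ?m\<^sup>2) * ereal ?m"
          unfolding beta_def using pos
          by (intro ereal_mult_right_mono INF_lower norm_second_ff_in_S_set[OF c x \<xi>]) simp
        finally have "Q_tensor g F c x \<xi> \<xi> < ?b / ?m" using pos by (simp add: power2_eq_square)
        then show "Q_tensor g F c x \<xi> \<xi> + (real 1 - 2) * ?b / ?m < 0" by simp
      qed (use moving e0 in auto)
    qed
  next
    fix p :: nat assume p: "2 \<le> p" and Q: "Q_less A g F (- (ereal (real p - 2) * gamma A g F))"
    show "property_N TYPE('v \<times> 'e) p A g r"
      unfolding property_N_def
    proof (rule notI, elim exE conjE)
      fix X :: "('v, 'e) pre_digraph" and arev w f
      assume X: "finite_weighted_graph X arev w" and harm: "discrete_p_harmonic A g r X arev w p f"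
        and nc: "non_constant X f" and stab: "stable A g r X arev w p f"
      have dm: "discrete_map A r X arev f" using harm unfolding discrete_p_harmonic_def by simp
      have fin: "finite (arcs X)" and wf: "wf_digraph X" and conn: "Digraph_Component.connected X"
        and wt: "\<And>e. e \<in> arcs X \<Longrightarrow> 0 < w e"
        using X unfolding finite_weighted_graph_def fin_digraph_def fin_digraph_axioms_def by blast+
      have "1 \<le> r" using assms(5) by simp
      from moving_point[OF dm this conn wf nc]
      obtain e0 t0 where e0: "e0 \<in> arcs X" "t0 \<in> {0..1}" "curve_velocity (f e0) t0 \<noteq> 0" by metis
      show False
      proof (rule not_stable[OF fin dm assms(5) _ _ stab wt _ e0])
        fix c x \<xi> assume c: "c \<in> A" and x: "x \<in> img_c c" and \<xi>: "\<xi> \<noteq> (0 :: real ^ 'n)"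
        let ?m = "metric_form g c x \<xi> \<xi>" and ?b = "(norm (B c x \<xi> \<xi>))\<^sup>2"
        have pos: "0 < ?m" by (rule metric_positive[OF c x \<xi>])
        have "ereal (?b / ?m\<^sup>2) \<le> gamma A g F"
          unfolding gamma_def by (intro SUP_upper norm_second_ff_in_S_set[OF c x \<xi>])
        then have "ereal (real p - 2) * ereal (?b / ?m\<^sup>2) \<le> ereal (real p - 2) * gamma A g F"
          using p by (intro ereal_mult_left_mono) simp_all
        then have g: "- (ereal (real p - 2) * gamma A g F) \<le> ereal (- ((real p - 2) * (?b / ?m\<^sup>2)))"
          by (simp add: ereal_minus_le_minus flip: uminus_ereal.simps)
        have "ereal (Q_tensor g F c x \<xi> \<xi>) < - (ereal (real p - 2) * gamma A g F) * ereal ?m"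
          using Q c x \<xi> unfolding Q_less_def by blast
        also have "\<dots> \<le> ereal (- ((real p - 2) * (?b / ?m\<^sup>2))) * ereal ?m"
          using pos by (intro ereal_mult_right_mono g) simp
        finally have "Q_tensor g F c x \<xi> \<xi> < - ((real p - 2) * ?b / ?m)" using pos by (simp add: power2_eq_square)
        then show "Q_tensor g F c x \<xi> \<xi> + (real p - 2) * ?b / ?m < 0" by simp
      qed (use p in auto)
    qed
  qed
qed

end
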